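(* Let $d\ge 2$ and $2\le k<l$ be integers with $k$ and $l$ relatively prime, and let $X_{d,k,l}\subset\mathbb{A}^4_{\mathbb{C}}$ be the hypersurface defined by $x^dy+z^k+t^l+x=0$. Then every automorphism of $X_{d,k,l}$ fixes the origin $(0,0,0,0)$.
   Context: Here $x,y,z,t$ are the coordinates of $\mathbb{A}^4_{\mathbb{C}}$, and automorphisms are automorphisms of complex algebraic varieties. The origin of $\mathbb{A}^4_{\mathbb{C}}$ lies on $X_{d,k,l}$. *)

theory Defs
  imports "HOL-Analysis.Analysis"
begin

text \<open>Polynomials in the coordinates of affine space, as functions on the closed points;
  an exponent vector is a function from the (finite) coordinate index type to the naturals.
  Over an infinite field a polynomial is determined by its function.\<close>

definition polynomial_fun :: "(complex ^ 'n \<Rightarrow> complex) \<Rightarrow> bool" where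
  "polynomial_fun P \<longleftrightarrow>
     (\<exists>(S :: ('n \<Rightarrow> nat) set) (c :: ('n \<Rightarrow> nat) \<Rightarrow> complex). finite S \<and>
        (\<forall>v. P v = (\<Sum>e\<in>S. c e * (\<Prod>i\<in>UNIV. (v $ i) ^ e i))))"

text \<open>The sets \<open>X\<close> and \<open>Y\<close> are meant to be Zariski closed, so that their regular functions
  are the restrictions of polynomials and their morphisms are the restrictions of polynomial
  maps. The values of \<open>\<phi>\<close> outside \<open>X\<close> are irrelevant.\<close>

definition regular_map ::
  "(complex ^ 'n) set \<Rightarrow> (complex ^ 'm) set \<Rightarrow> (complex ^ 'n \<Rightarrow> complex ^ 'm) \<Rightarrow> bool" where
  "regular_map X Y \<phi> \<longleftrightarrow>
     (\<forall>v\<in>X. \<phi> v \<in> Y) \<and>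
     (\<forall>j. \<exists>P. polynomial_fun P \<and> (\<forall>v\<in>X. \<phi> v $ j = P v))"

definition variety_automorphism ::
  "(complex ^ 'n) set \<Rightarrow> (complex ^ 'n \<Rightarrow> complex ^ 'n) \<Rightarrow> bool" where
  "variety_automorphism X \<phi> \<longleftrightarrow>
     regular_map X X \<phi> \<and>
     (\<exists>\<psi>. regular_map X X \<psi> \<and> (\<forall>v\<in>X. \<psi> (\<phi> v) = v) \<and> (\<forall>v\<in>X. \<phi> (\<psi> v) = v))"

text \<open>The coordinates \<open>x, y, z, t\<close> are the components \<open>1, 2, 3, 4\<close>. The defining polynomial is
  irreducible (it has degree one in \<open>y\<close>, with coprime coefficients \<open>x ^ d\<close> and
  \<open>z ^ k + t ^ l + x\<close>), so the hypersurface is reduced and is given by its closed points.\<close>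

definition hypersurface_X :: "nat \<Rightarrow> nat \<Rightarrow> nat \<Rightarrow> (complex ^ 4) set" where
  "hypersurface_X d k l =
     {v. (v $ 1) ^ d * (v $ 2) + (v $ 3) ^ k + (v $ 4) ^ l + v $ 1 = 0}"

lemma origin_in_hypersurface_X:
  "k > 0 \<Longrightarrow> l > 0 \<Longrightarrow> 0 \<in> hypersurface_X d k l"
  by (simp add: hypersurface_X_def power_0_left)

end

theory Submission
  imports Defs "HOL-Library.Poly_Mapping" "HOL-Computational_Algebra.Fundamental_Theorem_Algebra"
begin

text \<open>On the open set \<open>x \<noteq> 0\<close> the coordinate ring becomes the ring of Laurent polynomials
  \<open>\<complex>[x, 1/x, z, t]\<close>, with \<open>y = - (z\<^sup>k + t\<^sup>l + x) / x\<^sup>d\<close>. Following Makar-Limanov, a locally nilpotent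
  derivation is replaced by its leading part \<open>\<delta>\<close> for the weight given by the order of pole along
  \<open>x = 0\<close> and then by the quasi-homogeneous degree in \<open>z, t\<close>. If the kernel contained an element
  with a pole, \<open>\<delta>\<close> would kill the initial form of \<open>y\<close>; factoring bihomogeneous kernel elements,
  Mason's theorem and a comparison of weights exclude this. So kernels lie in \<open>\<complex>[x, z, t]\<close>, and
  applying this to the conjugates of the two obvious shear flows by an automorphism \<open>\<phi>\<close> shows
  that \<open>\<phi>\<close> lifts a polynomial automorphism \<open>(X, Z, T)\<close> of \<open>\<complex>\<^sup>3\<close>. It preserves the image of the
  hypersurface, whence \<open>X = a x\<close>, and units being constant \<open>(Z, T)\<close> has constant Jacobian. With
  \<open>F = z\<^sup>k + t\<^sup>l + x\<close> one gets \<open>Z\<^sup>k + T\<^sup>l + a x = u F + x\<^sup>d g\<close>, and the gradient at \<open>0\<close> gives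
  \<open>Z(0) = T(0) = 0\<close>. Finally the \<open>y\<close>-coordinate of \<open>\<phi>(0)\<close> is a multiple of \<open>g(0)\<close>. The
  pulled back Euler field differs from the Euler field by a Hamiltonian field of some \<open>q\<close>, so
  that \<open>u {F, q} + x\<^sup>d ((d - 1) g + \<dots>)\<close> is a multiple of \<open>F\<close>; integrating over a vanishing
  cycle of \<open>z\<^sup>k + t\<^sup>l = - x\<close>, a formal operation with Beta functions, gives \<open>g(0) = 0\<close>.\<close>

subsection \<open>Locally nilpotent derivations of domains\<close>

text \<open>The equations Z(0) = T(0) = 0 only place the image of the origin on the line x = z = t =
  0, which lies on the hypersurface, so the y-coordinate needs an argument of its own. For the
  weights 1, 1/k, 1/l of x, z, t the polynomial F has weight 1 and x^d has weight d; the factor d -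
  1 measures this difference and is nonzero because d >= 2. The period kills multiples of F and {F,
  q}, and on x^d K it sees only the constant term of K; this is why only the weight of x^d is kept.
  Two features shape the set-up. The Laurent ring does not see the points with x = 0, the origin
  among them, so regular functions are kept together with their Laurent polynomials. And the
  derivations live on the Laurent ring, where they need not be locally nilpotent, so nilpotency is a
  property of single elements. Coprimality of k and l enters through quasi-homogeneous polynomials:
  those divisible by neither z nor t are binary forms in z^k and t^l.\<close>

definition derivation :: "('a :: comm_ring_1 \<Rightarrow> 'a) \<Rightarrow> bool" where
  "derivation D \<longleftrightarrow> (\<forall>f g. D (f + g) = D f + D g) \<and> (\<forall>f g. D (f * g) = D f * g + f * D g)"

definition nilpotent_at :: "('a :: comm_ring_1 \<Rightarrow> 'a) \<Rightarrow> 'a \<Rightarrow> bool" where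
  "nilpotent_at D f \<longleftrightarrow> (\<exists>n. (D ^^ n) f = 0)"

text \<open>The degree function of a locally nilpotent derivation, as a relation because there is no
  value at 0 or where \<open>D\<close> is not nilpotent.\<close>

definition nil_degree :: "('a :: comm_ring_1 \<Rightarrow> 'a) \<Rightarrow> 'a \<Rightarrow> nat \<Rightarrow> bool" where
  "nil_degree D f n \<longleftrightarrow> (D ^^ n) f \<noteq> 0 \<and> (D ^^ Suc n) f = 0"

locale deriv =
  fixes D :: "'a :: {idom, ring_char_0} \<Rightarrow> 'a"
  assumes deriv: "derivation D"
begin

lemma add: "D (f + g) = D f + D g"
  and mult: "D (f * g) = D f * g + f * D g"
  using deriv by (auto simp: derivation_def)

lemma zero [simp]: "D 0 = 0"
  using add[of 0 0] by simp

lemma one [simp]: "D 1 = 0"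
  using mult[of 1 1] by simp

lemma minus: "D (- f) = - D f"
  using add[of f "- f"] by (simp add: eq_neg_iff_add_eq_0 add.commute)

lemma diff: "D (f - g) = D f - D g"
  using add[of f "- g"] minus by simp

lemma sum: "D (sum f I) = (\<Sum>i\<in>I. D (f i))"
  by (induction I rule: infinite_finite_induct) (auto simp: add)

lemma of_nat [simp]: "D (of_nat n) = 0"
  by (induction n) (auto simp: add)

lemma power: "D (f ^ n) = of_nat n * f ^ (n - 1) * D f"
proof (induction n)
  case (Suc n)
  then show ?case
    by (cases n) (auto simp: mult algebra_simps)
qed simp

lemma iter_zero [simp]: "(D ^^ n) 0 = 0"
  by (induction n) auto

lemma iter_add: "(D ^^ n) (f + g) = (D ^^ n) f + (D ^^ n) g"
  by (induction n) (auto simp: add)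

lemma iter_minus: "(D ^^ n) (- f) = - (D ^^ n) f"
  by (induction n) (auto simp: minus)

lemma iter_zero_mono: "(D ^^ n) f = 0 \<Longrightarrow> n \<le> m \<Longrightarrow> (D ^^ m) f = 0"
  by (metis iter_zero funpow_add comp_apply le_add_diff_inverse2)

lemma leibniz: "(D ^^ n) (f * g) = (\<Sum>i\<le>n. of_nat (n choose i) * (D ^^ i) f * (D ^^ (n - i)) g)"
proof (induction n)
  case (Suc n)
  let ?a = "\<lambda>i. (D ^^ i) f" and ?b = "\<lambda>i. (D ^^ i) g"
  have "(D ^^ Suc n) (f * g) = (\<Sum>i\<le>n. of_nat (n choose i) * ?a (Suc i) * ?b (n - i)) +
     (\<Sum>i\<le>n. of_nat (n choose i) * ?a i * ?b (Suc n - i))"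
    by (simp add: Suc sum mult sum.distrib[symmetric] Suc_diff_le algebra_simps)
  also have "(\<Sum>i\<le>n. of_nat (n choose i) * ?a (Suc i) * ?b (n - i)) =
     (\<Sum>i\<in>{1..Suc n}. of_nat (n choose (i - 1)) * ?a i * ?b (Suc n - i))"
    by (rule sum.reindex_bij_witness[of _ "\<lambda>i. i - 1" Suc]) auto
  also have "\<dots> = (\<Sum>i\<le>Suc n. (if i = 0 then 0 else of_nat (n choose (i - 1)) * ?a i * ?b (Suc n - i)))"
    by (rule sum.mono_neutral_cong_left) auto
  also have "(\<Sum>i\<le>n. of_nat (n choose i) * ?a i * ?b (Suc n - i)) =
     (\<Sum>i\<le>Suc n. of_nat (n choose i) * ?a i * ?b (Suc n - i))"
    by simp
  also have "(\<Sum>i\<le>Suc n. (if i = 0 then 0 else of_nat (n choose (i - 1)) * ?a i * ?b (Suc n - i))) + \<dots> =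
     (\<Sum>i\<le>Suc n. of_nat (Suc n choose i) * ?a i * ?b (Suc n - i))"
    unfolding sum.distrib[symmetric]
  proof (rule sum.cong)
    fix i assume "i \<in> {..Suc n}"
    then show "(if i = 0 then 0 else of_nat (n choose (i - 1)) * ?a i * ?b (Suc n - i)) +
        of_nat (n choose i) * ?a i * ?b (Suc n - i) = of_nat (Suc n choose i) * ?a i * ?b (Suc n - i)"
      by (cases i) (auto simp: algebra_simps)
  qed simp
  finally show ?case .
qed simp

abbreviation nilp :: "'a \<Rightarrow> bool" where "nilp \<equiv> nilpotent_at D"

lemma nilp_zero [simp]: "nilp 0"
  unfolding nilpotent_at_def by (rule exI[of _ 0]) simp

lemma nilp_ker: "D f = 0 \<Longrightarrow> nilp f"
  unfolding nilpotent_at_def by (rule exI[of _ 1]) simp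

lemma nilp_add: "nilp f \<Longrightarrow> nilp g \<Longrightarrow> nilp (f + g)"
  unfolding nilpotent_at_def
proof (elim exE)
  fix m n assume "(D ^^ m) f = 0" "(D ^^ n) g = 0"
  then have "(D ^^ max m n) (f + g) = 0"
    using iter_zero_mono[of m f "max m n"] iter_zero_mono[of n g "max m n"] by (simp add: iter_add)
  then show "\<exists>n. (D ^^ n) (f + g) = 0" ..
qed

lemma nilp_minus: "nilp f \<Longrightarrow> nilp (- f)"
  unfolding nilpotent_at_def by (simp add: iter_minus)

lemma nilp_diff: "nilp f \<Longrightarrow> nilp g \<Longrightarrow> nilp (f - g)"
  using nilp_add[of f "- g"] nilp_minus by simp

lemma nilp_mult: "nilp f \<Longrightarrow> nilp g \<Longrightarrow> nilp (f * g)"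
  unfolding nilpotent_at_def
proof (elim exE)
  fix m n assume mn: "(D ^^ m) f = 0" "(D ^^ n) g = 0"
  have "of_nat (m + n choose i) * (D ^^ i) f * (D ^^ (m + n - i)) g = 0" for i
    using iter_zero_mono[OF mn(1), of i] iter_zero_mono[OF mn(2), of "m + n - i"]
    by (cases "m \<le> i") auto
  then have "(D ^^ (m + n)) (f * g) = 0"
    unfolding leibniz by (intro sum.neutral ballI)
  then show "\<exists>n. (D ^^ n) (f * g) = 0" ..
qed

lemma nilp_one [simp]: "nilp 1"
  by (rule nilp_ker) simp

lemma nilp_power: "nilp f \<Longrightarrow> nilp (f ^ n)"
  by (induction n) (auto intro: nilp_mult)

lemma nilp_deriv: "nilp f \<Longrightarrow> nilp (D f)"
  unfolding nilpotent_at_def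
proof (elim exE)
  fix n assume "(D ^^ n) f = 0"
  then have "(D ^^ n) (D f) = 0"
    using iter_zero_mono[of n f "Suc n"] by (simp add: funpow_Suc_right del: funpow.simps)
  then show "\<exists>n. (D ^^ n) (D f) = 0" ..
qed

lemma nil_degree_exists: "nilp f \<Longrightarrow> f \<noteq> 0 \<Longrightarrow> \<exists>n. nil_degree D f n"
proof -
  assume f: "nilp f" "f \<noteq> 0"
  define n where "n = (LEAST n. (D ^^ n) f = 0)"
  have n: "(D ^^ n) f = 0"
    unfolding n_def using f(1) unfolding nilpotent_at_def by (rule LeastI_ex)
  moreover have "n \<noteq> 0"
    using n f(2) by (cases n) auto
  moreover have "(D ^^ (n - 1)) f \<noteq> 0"
    using not_less_Least[of "n - 1" "\<lambda>n. (D ^^ n) f = 0"] \<open>n \<noteq> 0\<close> unfolding n_def by auto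
  ultimately have "nil_degree D f (n - 1)"
    by (simp add: nil_degree_def del: funpow.simps)
  then show ?thesis ..
qed

lemma nil_degree_less: "nil_degree D f n \<Longrightarrow> (D ^^ m) f = 0 \<Longrightarrow> n < m"
  using iter_zero_mono unfolding nil_degree_def by (metis not_less)

lemma nil_degree_unique: "nil_degree D f n \<Longrightarrow> nil_degree D f m \<Longrightarrow> n = m"
  using nil_degree_less[of f n "Suc m"] nil_degree_less[of f m "Suc n"] by (simp add: nil_degree_def)

lemma nil_degree_0_iff: "nil_degree D f 0 \<longleftrightarrow> f \<noteq> 0 \<and> D f = 0"
  by (simp add: nil_degree_def)

lemma nil_degree_deriv: "nil_degree D f (Suc n) \<Longrightarrow> nil_degree D (D f) n"
  by (simp add: nil_degree_def funpow_swap1)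

lemma iter_nil_degree_ker: "nil_degree D f n \<Longrightarrow> D ((D ^^ n) f) = 0"
  by (simp add: nil_degree_def)

text \<open>In the Leibniz sum of order m + n only the term i = m survives, and its binomial
  coefficient is nonzero in characteristic 0.\<close>

lemma nil_degree_mult:
  assumes "nil_degree D f m" "nil_degree D g n"
  shows "nil_degree D (f * g) (m + n)"
proof -
  have f: "(D ^^ i) f = 0" if "i > m" for i
    using that assms(1) iter_zero_mono[of "Suc m" f i] by (simp add: nil_degree_def)
  have g: "(D ^^ i) g = 0" if "i > n" for i
    using that assms(2) iter_zero_mono[of "Suc n" g i] by (simp add: nil_degree_def)
  have "(D ^^ (m + n)) (f * g) =
      (\<Sum>i\<in>{m}. of_nat (m + n choose i) * (D ^^ i) f * (D ^^ (m + n - i)) g)"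
    unfolding leibniz
  proof (rule sum.mono_neutral_right)
    show "\<forall>i\<in>{..m + n} - {m}. of_nat (m + n choose i) * (D ^^ i) f * (D ^^ (m + n - i)) g = 0"
    proof
      fix i assume "i \<in> {..m + n} - {m}"
      then show "of_nat (m + n choose i) * (D ^^ i) f * (D ^^ (m + n - i)) g = 0"
        using f[of i] g[of "m + n - i"] by (cases "i < m") auto
    qed
  qed auto
  then have "(D ^^ (m + n)) (f * g) \<noteq> 0"
    using assms by (simp add: nil_degree_def)
  moreover have "of_nat (Suc (m + n) choose i) * (D ^^ i) f * (D ^^ (Suc (m + n) - i)) g = 0" for i
    using f[of i] g[of "Suc (m + n) - i"] by (cases "i > m") auto
  then have "(D ^^ Suc (m + n)) (f * g) = 0"
    unfolding leibniz by (intro sum.neutral ballI)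
  ultimately show ?thesis
    by (simp add: nil_degree_def)
qed

lemma nil_degree_power: "nil_degree D f m \<Longrightarrow> nil_degree D (f ^ n) (n * m)"
proof (induction n)
  case 0
  then show ?case by (simp add: nil_degree_0_iff)
qed (auto intro: nil_degree_mult)

text \<open>Degrees are natural numbers with sum 0: among nilpotent elements the kernel is
  factorially closed.\<close>

lemma ker_factor:
  assumes "D (f * g) = 0" "f \<noteq> 0" "g \<noteq> 0" "nilp f" "nilp g"
  shows "D f = 0"
proof -
  obtain m n where mn: "nil_degree D f m" "nil_degree D g n"
    using nil_degree_exists assms by blast
  then have "nil_degree D (f * g) (m + n)"
    by (rule nil_degree_mult)
  moreover have "nil_degree D (f * g) 0"
    using assms by (simp add: nil_degree_0_iff)
  ultimately have "m = 0"
    using nil_degree_unique by fastforce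
  then show ?thesis
    using mn by (simp add: nil_degree_0_iff)
qed

text \<open>An instance of Mason's theorem: the degrees \<open>m\<close>, \<open>n\<close> of nonconstant \<open>u\<close>, \<open>v\<close> would
  satisfy both \<open>n < m\<close> and \<open>m < n\<close>.\<close>

lemma ker_of_power_sum:
  assumes k: "k \<ge> 2" and l: "l \<ge> 2"
    and ker: "D a = 0" "D b = 0" "D c = 0" and nz: "a \<noteq> 0" "b \<noteq> 0" "c \<noteq> 0"
    and eq: "a * u ^ k + b * v ^ l = c" and nilp: "nilp u" "nilp v"
  shows "D u = 0" "D v = 0"
proof -
  \<comment> \<open>One inequality for arbitrary data; exchanging the two summands gives the
    opposite one.\<close>
  have *: "nil_degree D v n \<Longrightarrow> nil_degree D u m \<Longrightarrow> n < m"
    if kl: "k \<ge> 2" "l \<ge> 2" and ker: "D a = 0" "D b = 0" "D c = 0" and nz: "a \<noteq> 0" "b \<noteq> 0" "c \<noteq> 0"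
      and eq: "a * u ^ k + b * v ^ l = c" and nilp: "nilp u" "nilp v" and Du: "D u \<noteq> 0"
    for a b c u v :: 'a and k l n m :: nat
  proof -
    assume nil_degree: "nil_degree D v n" "nil_degree D u m"
    obtain k' l' where k': "k = Suc k'" "l = Suc l'"
      using kl by (metis Suc_le_D Suc_1 )
    have 1: "a * of_nat k * u ^ k' * D u = - (b * of_nat l * v ^ l' * D v)"
      using arg_cong[OF eq, of D] ker
      by (simp add: add mult power k' eq_neg_iff_add_eq_0 mult.assoc del: of_nat_Suc power_Suc)
    \<comment> \<open>Multiplying the relation by \<open>of_nat k * D u\<close> and eliminating
      \<open>u ^ k' * D u\<close> makes \<open>v ^ l'\<close> a factor of \<open>c * D u\<close> up
      to kernel elements, so m - 1 >= (l - 1) n.\<close>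
    have "of_nat k * c * D u = u * (a * of_nat k * u ^ k' * D u) + of_nat k * b * v ^ l * D u"
      unfolding eq[symmetric] by (simp add: k' algebra_simps del: of_nat_Suc)
    also have "\<dots> = b * v ^ l' * (of_nat k * v * D u - of_nat l * u * D v)"
      unfolding 1 by (simp add: k' algebra_simps del: of_nat_Suc)
    finally have 2: "of_nat k * c * D u = b * (v ^ l' * (of_nat k * v * D u - of_nat l * u * D v))"
      (is "_ = b * (_ * ?w)") by (simp add: mult.assoc)
    have "of_nat k * c * D u \<noteq> 0"
      using kl nz Du by simp
    with 2 have "?w \<noteq> 0" by auto
    moreover have "nilp ?w"
      by (intro nilp_diff nilp_mult nilp_deriv nilp nilp_ker) auto
    ultimately obtain w where w: "nil_degree D ?w w"
      using nil_degree_exists by blast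
    have "nil_degree D (b * (v ^ l' * ?w)) (0 + (l' * n + w))"
      by (intro nil_degree_mult nil_degree_power nil_degree w) (use ker nz in \<open>simp add: nil_degree_0_iff\<close>)
    moreover have "m \<noteq> 0"
      using nil_degree(2) Du nil_degree_0_iff by metis
    then obtain m' where m': "m = Suc m'"
      by (cases m) auto
    have "nil_degree D (of_nat k * c * D u) (0 + m')"
      by (intro nil_degree_mult nil_degree_deriv) (use kl ker nz nil_degree m' in \<open>simp_all add: nil_degree_0_iff mult\<close>)
    ultimately have "m' = l' * n + w"
      using nil_degree_unique unfolding 2 by fastforce
    moreover have "l' * n \<ge> n"
      using kl k' by simp
    ultimately show "n < m"
      using m' by linarith
  qed
  show u: "D u = 0"
  proof (rule ccontr)
    assume Du: "D u \<noteq> 0"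
    then have "u \<noteq> 0" by auto
    have "D v \<noteq> 0"
    proof
      assume "D v = 0"
      then have "a * (of_nat k * u ^ (k - 1) * D u) = 0"
        using arg_cong[OF eq, of D] ker by (simp add: add mult power)
      then show False
        using nz k Du \<open>u \<noteq> 0\<close> by auto
    qed
    then have "v \<noteq> 0" by auto
    obtain m n where "nil_degree D u m" "nil_degree D v n"
      using nil_degree_exists nilp \<open>u \<noteq> 0\<close> \<open>v \<noteq> 0\<close> by blast
    then show False
      using *[OF k l ker nz eq nilp Du] *[OF l k ker(2,1,3) nz(2,1,3) _ nilp(2,1) \<open>D v \<noteq> 0\<close>] eq
      by (metis add.commute less_asym)
  qed
  then have "b * (of_nat l * v ^ (l - 1) * D v) = 0"
    using arg_cong[OF eq, of D] ker by (simp add: add mult power)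
  then show "D v = 0"
    using nz l by auto
qed

end

subsection \<open>Laurent polynomials in three variables\<close>

text \<open>The lexicographic order of the exponents makes the ring of Laurent polynomials an
  instance of \<open>idom\<close>; the weights used to filter it are again triples of integers.\<close>

datatype expo = Expo (ex: int) (ez: int) (et: int)

instantiation expo :: linordered_ab_group_add
begin

definition "0 = Expo 0 0 0"
definition "a + b = Expo (ex a + ex b) (ez a + ez b) (et a + et b)"
definition "- a = Expo (- ex a) (- ez a) (- et a)"
definition "a - b = Expo (ex a - ex b) (ez a - ez b) (et a - et b)"
definition "a < b \<longleftrightarrow> ex a < ex b \<or> ex a = ex b \<and> (ez a < ez b \<or> ez a = ez b \<and> et a < et b)"
definition "a \<le> b \<longleftrightarrow> ex a < ex b \<or> ex a = ex b \<and> (ez a < ez b \<or> ez a = ez b \<and> et a \<le> et b)"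

instance
  by standard
    (auto simp: zero_expo_def plus_expo_def uminus_expo_def minus_expo_def less_expo_def
      less_eq_expo_def expo.expand)

end

lemma expo_sel [simp]:
  "ex 0 = 0" "ez 0 = 0" "et 0 = 0"
  "ex (a + b) = ex a + ex b" "ez (a + b) = ez a + ez b" "et (a + b) = et a + et b"
  "ex (- a) = - ex a" "ez (- a) = - ez a" "et (- a) = - et a"
  "ex (a - b) = ex a - ex b" "ez (a - b) = ez a - ez b" "et (a - b) = et a - et b"
  by (simp_all add: zero_expo_def plus_expo_def uminus_expo_def minus_expo_def)

lemma Expo_add [simp]: "Expo a i j + Expo b m n = Expo (a + b) (i + m) (j + n)"
  by (simp add: plus_expo_def)

lemma Expo_0 [simp]: "Expo 0 0 0 = 0"
  by (simp add: zero_expo_def)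

lemma Expo_eq_0 [simp]:
  "Expo a i j = 0 \<longleftrightarrow> a = 0 \<and> i = 0 \<and> j = 0" "0 = Expo a i j \<longleftrightarrow> a = 0 \<and> i = 0 \<and> j = 0"
  by (auto simp flip: Expo_0)

type_synonym laur = "expo \<Rightarrow>\<^sub>0 complex"

abbreviation sg :: "expo \<Rightarrow> complex \<Rightarrow> laur" where "sg \<equiv> Poly_Mapping.single"
abbreviation lk :: "laur \<Rightarrow> expo \<Rightarrow> complex" where "lk \<equiv> Poly_Mapping.lookup"
abbreviation ks :: "laur \<Rightarrow> expo set" where "ks \<equiv> Poly_Mapping.keys"

abbreviation cst :: "complex \<Rightarrow> laur" where "cst \<equiv> sg 0"
abbreviation vx :: laur where "vx \<equiv> sg (Expo 1 0 0) 1"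
abbreviation vz :: laur where "vz \<equiv> sg (Expo 0 1 0) 1"
abbreviation vt :: laur where "vt \<equiv> sg (Expo 0 0 1) 1"

lemma laur_expand: "f = (\<Sum>e\<in>ks f. sg e (lk f e))"
  by (rule poly_mapping_eqI) (auto simp: lookup_sum lookup_single when_def in_keys_iff)

text \<open>The monomials are restricted to the support of \<open>f\<close>, so that properties of
  its exponents, such as nonnegativity, are available in the induction.\<close>

lemma laur_induct [case_names single add]:
  assumes "\<And>e c. e \<in> ks f \<Longrightarrow> P (sg e c)" and "\<And>f g. P f \<Longrightarrow> P g \<Longrightarrow> P (f + g)" and "P 0"
  shows "P f"
proof -
  have "P (\<Sum>e\<in>S. sg e (lk f e))" if "S \<subseteq> ks f" for S
    using finite_subset[OF that finite_keys] that
    by (induction S rule: finite_induct) (auto intro: assms)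
  then show ?thesis
    using laur_expand[of f] by fastforce
qed

lemma laur_induct' [case_names single add]:
  assumes "\<And>e c. P (sg e c)" and "\<And>f g. P f \<Longrightarrow> P g \<Longrightarrow> P (f + g)"
  shows "P (f :: laur)"
  using assms(1)[of 0 0] by (intro laur_induct[of f P] assms) simp_all

lemma lk_sg_mult: "lk (sg s c * f) e = c * lk f (e - s)"
proof (induction f rule: laur_induct')
  case (single e' c')
  have "s + e' = e \<longleftrightarrow> e' = e - s"
    by (auto simp: algebra_simps)
  then show ?case
    by (simp add: mult_single lookup_single when_def)
qed (simp add: lookup_add algebra_simps)

lemma sg_mult_inverse: "sg e 1 * sg (- e) 1 = (1 :: laur)"
  by (simp add: mult_single flip: single_one)

lemma sg_cst: "cst c * sg e b = sg e (c * b)"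
  by (simp add: mult_single)

lemma cst_mult: "cst (a * b) = cst a * cst b"
  by (simp add: mult_single)

lemma sg_power: "sg (Expo a i j) c ^ n = sg (Expo (int n * a) (int n * i) (int n * j)) (c ^ n)"
  by (induction n) (auto simp: mult_single algebra_simps)

lemma ks_mult: "e \<in> ks (f * g) \<Longrightarrow> \<exists>a\<in>ks f. \<exists>b\<in>ks g. e = a + b"
  using keys_mult[of f g] by blast

lemma ks_add: "e \<in> ks (f + g) \<Longrightarrow> e \<in> ks f \<or> e \<in> ks g"
  using keys_add[of f g] by blast

lemma ks_minus: "ks (- f) = ks f"
  by (auto simp: in_keys_iff)

lemma ks_diff: "e \<in> ks (f - g) \<Longrightarrow> e \<in> ks f \<or> e \<in> ks g"
  by (auto simp: in_keys_iff lookup_minus)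

lemma ks_sg: "e \<in> ks (sg s c) \<Longrightarrow> e = s"
  by (auto split: if_splits)

lemma sg_nz [simp]: "sg e c = 0 \<longleftrightarrow> c = 0"
  by (metis lookup_single_eq lookup_zero single_zero)

subsection \<open>Polynomials\<close>

definition nonneg :: "expo \<Rightarrow> bool" where
  "nonneg e \<longleftrightarrow> 0 \<le> ex e \<and> 0 \<le> ez e \<and> 0 \<le> et e"

definition pol :: "laur set" where
  "pol = {f. \<forall>e\<in>ks f. nonneg e}"

lemma polI: "(\<And>e. e \<in> ks f \<Longrightarrow> nonneg e) \<Longrightarrow> f \<in> pol"
  by (simp add: pol_def)

lemma polD: "f \<in> pol \<Longrightarrow> e \<in> ks f \<Longrightarrow> nonneg e"
  by (simp add: pol_def)

lemma pol_lk: "f \<in> pol \<Longrightarrow> \<not> nonneg e \<Longrightarrow> lk f e = 0"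
  by (auto simp: pol_def in_keys_iff)

lemma pol_add [intro]: "f \<in> pol \<Longrightarrow> g \<in> pol \<Longrightarrow> f + g \<in> pol"
  by (meson polI polD ks_add)

lemma pol_minus [intro]: "f \<in> pol \<Longrightarrow> - f \<in> pol"
  by (simp add: pol_def ks_minus)

lemma pol_diff [intro]: "f \<in> pol \<Longrightarrow> g \<in> pol \<Longrightarrow> f - g \<in> pol"
  by (meson polI polD ks_diff)

lemma pol_mult [intro]: "f \<in> pol \<Longrightarrow> g \<in> pol \<Longrightarrow> f * g \<in> pol"
proof (rule polI)
  fix e assume fg: "f \<in> pol" "g \<in> pol" "e \<in> ks (f * g)"
  then obtain a b where "a \<in> ks f" "b \<in> ks g" "e = a + b"
    using ks_mult by blast
  then show "nonneg e"
    using polD[OF fg(1)] polD[OF fg(2)] by (force simp: nonneg_def)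
qed

lemma pol_sg [intro]: "nonneg e \<Longrightarrow> sg e c \<in> pol"
  by (rule polI) (auto simp del: keys_single dest: ks_sg)

lemma pol_cst [simp]: "cst c \<in> pol"
  by (rule pol_sg) (simp add: nonneg_def)

lemma pol_0 [simp]: "0 \<in> pol" and pol_1 [simp]: "1 \<in> pol"
  using pol_cst[of 0] pol_cst[of 1] by simp_all

lemma pol_vars [simp]: "vx \<in> pol" "vz \<in> pol" "vt \<in> pol"
  by (auto simp: nonneg_def)

lemma pol_power [intro]: "f \<in> pol \<Longrightarrow> f ^ n \<in> pol"
  by (induction n) auto

lemma pol_sum [intro]: "(\<And>i. i \<in> I \<Longrightarrow> f i \<in> pol) \<Longrightarrow> sum f I \<in> pol"
  by (induction I rule: infinite_finite_induct) auto

lemma pol_of_nat [simp]: "of_nat n \<in> pol"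
  by (induction n) auto

lemma sg_nonneg: "nonneg e \<Longrightarrow> sg e c = cst c * vx ^ nat (ex e) * vz ^ nat (ez e) * vt ^ nat (et e)"
  by (cases e) (simp add: sg_power mult_single nonneg_def)

lemma pol_induct [consumes 1, case_names cst vx vz vt add mult]:
  assumes f: "f \<in> pol" and cst: "\<And>c. P (cst c)" and vx: "P vx" and vz: "P vz" and vt: "P vt"
    and add: "\<And>f g. f \<in> pol \<Longrightarrow> g \<in> pol \<Longrightarrow> P f \<Longrightarrow> P g \<Longrightarrow> P (f + g)"
    and mult: "\<And>f g. f \<in> pol \<Longrightarrow> g \<in> pol \<Longrightarrow> P f \<Longrightarrow> P g \<Longrightarrow> P (f * g)"
  shows "P f"
proof -
  have pw: "P (g ^ n)" if "P g" "g \<in> pol" for g n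
    by (induction n) (use that cst[of 1] in \<open>auto intro!: mult\<close>)
  have "P f \<and> f \<in> pol"
  proof (rule laur_induct[of f])
    fix e c assume "e \<in> ks f"
    with f have e: "nonneg e" by (rule polD)
    show "P (sg e c) \<and> sg e c \<in> pol"
      unfolding sg_nonneg[OF e] by (intro conjI mult pol_mult pw vx vz vt cst pol_power) auto
  qed (use cst[of 0] add in auto)
  then show ?thesis ..
qed

subsection \<open>Weights and initial forms\<close>

definition weight :: "(expo \<Rightarrow> 'w :: linordered_ab_group_add) \<Rightarrow> bool" where
  "weight W \<longleftrightarrow> (\<forall>a b. W (a + b) = W a + W b)"

definition wle :: "(expo \<Rightarrow> 'w :: linordered_ab_group_add) \<Rightarrow> 'w \<Rightarrow> laur \<Rightarrow> bool" where
  "wle W w f \<longleftrightarrow> (\<forall>e\<in>ks f. W e \<le> w)"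

text \<open>The component of weight exactly \<open>w\<close>. Under \<open>wle W w f\<close> it is
  the initial form or 0, which spares case distinctions for vanishing leading parts.\<close>

definition hc :: "(expo \<Rightarrow> 'w :: linordered_ab_group_add) \<Rightarrow> 'w \<Rightarrow> laur \<Rightarrow> laur" where
  "hc W w f = Poly_Mapping.mapp (\<lambda>e c. if W e = w then c else 0) f"

lemma lk_hc: "lk (hc W w f) e = (if W e = w then lk f e else 0)"
  by (simp add: hc_def lookup_mapp when_def in_keys_iff)

lemma ks_hc: "ks (hc W w f) = {e \<in> ks f. W e = w}"
  by (auto simp: in_keys_iff lk_hc split: if_splits)

lemma hc_0 [simp]: "hc W w 0 = 0"
  by (simp add: hc_def poly_mapping_eq_iff lookup_mapp fun_eq_iff)

lemma hc_add: "hc W w (f + g) = hc W w f + hc W w g"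
  by (rule poly_mapping_eqI) (simp add: lk_hc lookup_add)

lemma hc_minus: "hc W w (- f) = - hc W w f"
  by (rule poly_mapping_eqI) (simp add: lk_hc)

lemma hc_hom: "(\<And>e. e \<in> ks f \<Longrightarrow> W e = w) \<Longrightarrow> hc W w f = f"
  by (rule poly_mapping_eqI) (auto simp: lk_hc in_keys_iff)

lemma hc_eq_0: "(\<And>e. e \<in> ks f \<Longrightarrow> W e \<noteq> w) \<Longrightarrow> hc W w f = 0"
  by (rule poly_mapping_eqI) (auto simp: lk_hc in_keys_iff)

lemma wleD: "wle W w f \<Longrightarrow> e \<in> ks f \<Longrightarrow> W e \<le> w"
  by (simp add: wle_def)

lemma wle_0 [simp]: "wle W w 0"
  by (simp add: wle_def)

lemma wle_add: "wle W w f \<Longrightarrow> wle W w g \<Longrightarrow> wle W w (f + g)"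
  by (meson wle_def ks_add)

lemma wle_minus: "wle W w f \<Longrightarrow> wle W w (- f)"
  by (simp add: wle_def ks_minus)

lemma wle_diff: "wle W w f \<Longrightarrow> wle W w g \<Longrightarrow> wle W w (f - g)"
  by (meson wle_def ks_diff)

lemma wle_mono: "wle W w f \<Longrightarrow> w \<le> w' \<Longrightarrow> wle W w' f"
  by (meson wle_def order_trans)

lemma wle_sg: "W e \<le> w \<Longrightarrow> wle W w (sg e c)"
  by (auto simp: wle_def simp del: keys_single dest: ks_sg)

lemma wle_mult:
  assumes "weight W" "wle W w1 f" "wle W w2 g"
  shows "wle W (w1 + w2) (f * g)"
  unfolding wle_def
proof
  fix e assume "e \<in> ks (f * g)"
  then obtain a b where "a \<in> ks f" "b \<in> ks g" "e = a + b"
    using ks_mult by blast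
  then show "W e \<le> w1 + w2"
    using assms by (auto simp: weight_def wle_def intro: add_mono)
qed

text \<open>Terms of \<open>f\<close> or \<open>g\<close> below their bounds only produce terms
  strictly below \<open>w1 + w2\<close>.\<close>

lemma hc_mult:
  assumes W: "weight W" and f: "wle W w1 f" and g: "wle W w2 g"
  shows "hc W (w1 + w2) (f * g) = hc W w1 f * hc W w2 g"
proof -
  let ?f = "hc W w1 f" and ?g = "hc W w2 g"
  have lt: "W e < w1" if "e \<in> ks (f - ?f)" for e
    using that wleD[OF f, of e] by (auto simp: in_keys_iff lookup_minus lk_hc less_le split: if_splits)
  have gt: "W e < w2" if "e \<in> ks (g - ?g)" for e
    using that wleD[OF g, of e] by (auto simp: in_keys_iff lookup_minus lk_hc less_le split: if_splits)
  have "hc W (w1 + w2) ((f - ?f) * g) = 0"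
  proof (rule hc_eq_0)
    fix e assume "e \<in> ks ((f - ?f) * g)"
    then obtain a b where ab: "a \<in> ks (f - ?f)" "b \<in> ks g" "e = a + b"
      using ks_mult by blast
    then show "W e \<noteq> w1 + w2"
      using add_less_le_mono[OF lt[OF ab(1)] wleD[OF g ab(2)]] W by (auto simp: weight_def)
  qed
  moreover have "hc W (w1 + w2) (?f * (g - ?g)) = 0"
  proof (rule hc_eq_0)
    fix e assume "e \<in> ks (?f * (g - ?g))"
    then obtain a b where ab: "a \<in> ks ?f" "b \<in> ks (g - ?g)" "e = a + b"
      using ks_mult by blast
    then show "W e \<noteq> w1 + w2"
      using gt[OF ab(2)] W by (auto simp: weight_def ks_hc)
  qed
  moreover have "hc W (w1 + w2) (?f * ?g) = ?f * ?g"
  proof (rule hc_hom)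
    fix e assume "e \<in> ks (?f * ?g)"
    then obtain a b where "a \<in> ks ?f" "b \<in> ks ?g" "e = a + b"
      using ks_mult by blast
    then show "W e = w1 + w2"
      using W by (auto simp: weight_def ks_hc)
  qed
  moreover have "f * g = (f - ?f) * g + (?f * (g - ?g) + ?f * ?g)"
    by (simp add: algebra_simps)
  ultimately show ?thesis
    by (metis hc_add add_0)
qed

lemma top_weight:
  assumes "f \<noteq> 0"
  obtains w where "wle W w f" "hc W w f \<noteq> 0" "\<exists>e\<in>ks f. w = W e"
proof -
  let ?w = "Max (W ` ks f)"
  have ne: "W ` ks f \<noteq> {}" using assms by simp
  then have "?w \<in> W ` ks f" by (intro Max_in) auto
  then obtain e where e: "e \<in> ks f" "W e = ?w" by auto
  have "wle W ?w f" by (simp add: wle_def)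
  moreover have "e \<in> ks (hc W ?w f)" using e by (simp add: ks_hc)
  then have "hc W ?w f \<noteq> 0" by auto
  ultimately show ?thesis using that e by metis
qed

text \<open>In a domain initial forms multiply without cancellation, so a bound for the product and
  an attained bound for one factor bound the other.\<close>

lemma wle_cancel:
  assumes W: "weight W" and fg: "wle W (w1 + w2) (f * g)" and f: "wle W w1 f" "hc W w1 f \<noteq> 0"
  shows "wle W w2 g"
proof (cases "g = 0")
  case False
  then obtain w where w: "wle W w g" "hc W w g \<noteq> 0"
    by (rule top_weight)
  then have "hc W (w1 + w) (f * g) \<noteq> 0"
    using f hc_mult[OF W f(1) w(1)] by simp
  then obtain e where "e \<in> ks (hc W (w1 + w) (f * g))"
    by fastforce
  then have "w1 + w \<le> w1 + w2"
    using fg by (auto simp: ks_hc wle_def)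
  then show ?thesis
    using w(1) wle_mono by auto
qed simp

text \<open>The value group is arbitrary, so the n-fold multiple of \<open>w\<close> is an iterated
  sum.\<close>

lemma wle_power: "weight W \<Longrightarrow> wle W w f \<Longrightarrow> wle W (((+) w ^^ n) 0) (f ^ n)"
proof (induction n)
  case 0
  then have "W 0 = 0"
    unfolding weight_def by (metis add_cancel_right_right)
  then show ?case
    using wle_sg[of W 0 0 1] by simp
qed (auto intro: wle_mult)

lemma hc_power: "weight W \<Longrightarrow> wle W w f \<Longrightarrow> hc W (((+) w ^^ n) 0) (f ^ n) = hc W w f ^ n"
proof (induction n)
  case 0
  then have "W 0 = 0"
    unfolding weight_def by (metis add_cancel_right_right)
  then show ?case
    by (intro poly_mapping_eqI) (simp add: lk_hc lookup_one when_def)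
next
  case (Suc n)
  then show ?case
    using hc_mult[OF Suc.prems(1) Suc.prems(2) wle_power[OF Suc.prems]] by simp
qed

lemma funpow_add_int: "((+) (w :: int) ^^ n) a = a + int n * w"
  by (induction n) (auto simp: algebra_simps)

lemma funpow_add_expo:
  "((+) w ^^ n) a = Expo (ex a + int n * ex w) (ez a + int n * ez w) (et a + int n * et w)"
  by (induction n) (auto simp: algebra_simps plus_expo_def)

subsection \<open>Derivations of Laurent polynomials\<close>

text \<open>A diagonal operator on monomials: a derivation for additive \<open>v\<close>
  (\<open>euler_mult\<close>), while other \<open>v\<close> serve to cancel, select or integrate
  terms.\<close>

definition euler :: "(expo \<Rightarrow> complex) \<Rightarrow> laur \<Rightarrow> laur" where
  "euler v f = Poly_Mapping.mapp (\<lambda>e c. v e * c) f"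

lemma lk_euler: "lk (euler v f) e = v e * lk f e"
  by (simp add: euler_def lookup_mapp when_def in_keys_iff)

lemma ks_euler: "e \<in> ks (euler v f) \<Longrightarrow> e \<in> ks f"
  by (auto simp: in_keys_iff lk_euler)

lemma euler_add: "euler v (f + g) = euler v f + euler v g"
  by (rule poly_mapping_eqI) (simp add: lk_euler lookup_add algebra_simps)

lemma euler_sg: "euler v (sg e c) = sg e (v e * c)"
  by (rule poly_mapping_eqI) (simp add: lk_euler lookup_single when_def)

lemma hc_euler: "hc W w (euler v f) = euler v (hc W w f)"
  by (rule poly_mapping_eqI) (simp add: lk_hc lk_euler)

lemma wle_euler: "wle W w f \<Longrightarrow> wle W w (euler v f)"
  using ks_euler by (auto simp: wle_def)

lemma euler_mult:
  assumes v: "\<And>a b. v (a + b) = v a + v b"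
  shows "euler v (f * g) = euler v f * g + f * euler v g"
proof (induction f rule: laur_induct')
  case (single e c)
  show ?case
  proof (induction g rule: laur_induct')
    case (single e' c')
    then show ?case
      by (simp add: euler_sg mult_single v algebra_simps flip: single_add)
  qed (simp add: euler_add algebra_simps)
qed (simp add: euler_add algebra_simps)

abbreviation eux :: "laur \<Rightarrow> laur" where "eux \<equiv> euler (\<lambda>e. of_int (ex e))"
abbreviation euz :: "laur \<Rightarrow> laur" where "euz \<equiv> euler (\<lambda>e. of_int (ez e))"
abbreviation eut :: "laur \<Rightarrow> laur" where "eut \<equiv> euler (\<lambda>e. of_int (et e))"

lemma eu_mult:
  "eux (f * g) = eux f * g + f * eux g"
  "euz (f * g) = euz f * g + f * euz g"
  "eut (f * g) = eut f * g + f * eut g"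
  by (rule euler_mult; simp)+

lemma derivation_eu: "derivation (\<lambda>f. a * eux f + b * euz f + c * eut f)"
  by (simp add: derivation_def euler_add eu_mult algebra_simps)


definition px :: "laur \<Rightarrow> laur" where "px f = sg (Expo (-1) 0 0) 1 * eux f"
definition pz :: "laur \<Rightarrow> laur" where "pz f = sg (Expo 0 (-1) 0) 1 * euz f"
definition pt :: "laur \<Rightarrow> laur" where "pt f = sg (Expo 0 0 (-1)) 1 * eut f"

interpretation px: deriv px
  by standard (simp add: derivation_def px_def euler_add eu_mult algebra_simps)

interpretation pz: deriv pz
  by standard (simp add: derivation_def pz_def euler_add eu_mult algebra_simps)

interpretation pt: deriv pt
  by standard (simp add: derivation_def pt_def euler_add eu_mult algebra_simps)

lemma lk_partial:
  "lk (px f) e = of_int (ex e + 1) * lk f (e + Expo 1 0 0)"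
  "lk (pz f) e = of_int (ez e + 1) * lk f (e + Expo 0 1 0)"
  "lk (pt f) e = of_int (et e + 1) * lk f (e + Expo 0 0 1)"
proof -
  have eq: "e - Expo (- 1) 0 0 = e + Expo 1 0 0" "e - Expo 0 (- 1) 0 = e + Expo 0 1 0"
    "e - Expo 0 0 (- 1) = e + Expo 0 0 1"
    by (rule expo.expand; simp)+
  then show
    "lk (px f) e = of_int (ex e + 1) * lk f (e + Expo 1 0 0)"
    "lk (pz f) e = of_int (ez e + 1) * lk f (e + Expo 0 1 0)"
    "lk (pt f) e = of_int (et e + 1) * lk f (e + Expo 0 0 1)"
    unfolding px_def pz_def pt_def lk_sg_mult eq lk_euler by simp_all
qed

lemma partial_sg:
  "px (sg (Expo a i j) c) = sg (Expo (a - 1) i j) (of_int a * c)"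
  "pz (sg (Expo a i j) c) = sg (Expo a (i - 1) j) (of_int i * c)"
  "pt (sg (Expo a i j) c) = sg (Expo a i (j - 1)) (of_int j * c)"
  by (simp_all add: px_def pz_def pt_def euler_sg mult_single)

lemma partial_vars [simp]:
  "px vx = 1" "px vz = 0" "px vt = 0" "pz vx = 0" "pz vz = 1" "pz vt = 0"
  "pt vx = 0" "pt vz = 0" "pt vt = 1"
  by (simp_all add: partial_sg)

lemma partial_cst [simp]: "px (cst c) = 0" "pz (cst c) = 0" "pt (cst c) = 0"
  using partial_sg[of 0 0 0 c] by simp_all

lemma partial_commute: "px (pz f) = pz (px f)" "px (pt f) = pt (px f)" "pz (pt f) = pt (pz f)"
  by (rule poly_mapping_eqI; simp add: lk_partial algebra_simps)+

lemma pol_partial [intro]: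
  assumes "f \<in> pol"
  shows "px f \<in> pol" "pz f \<in> pol" "pt f \<in> pol"
proof -
  have *: "lk f e \<noteq> 0 \<Longrightarrow> nonneg e" for e
    using pol_lk[OF assms] by blast
  show "px f \<in> pol"
  proof (rule polI)
    fix e assume "e \<in> ks (px f)"
    then have "of_int (ex e + 1) \<noteq> (0 :: complex)" "lk f (e + Expo 1 0 0) \<noteq> 0"
      unfolding in_keys_iff lk_partial mult_eq_0_iff by blast+
    then show "nonneg e"
      using *[of "e + Expo 1 0 0"] unfolding of_int_eq_0_iff by (auto simp: nonneg_def)
  qed
  show "pz f \<in> pol"
  proof (rule polI)
    fix e assume "e \<in> ks (pz f)"
    then have "of_int (ez e + 1) \<noteq> (0 :: complex)" "lk f (e + Expo 0 1 0) \<noteq> 0"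
      unfolding in_keys_iff lk_partial mult_eq_0_iff by blast+
    then show "nonneg e"
      using *[of "e + Expo 0 1 0"] unfolding of_int_eq_0_iff by (auto simp: nonneg_def)
  qed
  show "pt f \<in> pol"
  proof (rule polI)
    fix e assume "e \<in> ks (pt f)"
    then have "of_int (et e + 1) \<noteq> (0 :: complex)" "lk f (e + Expo 0 0 1) \<noteq> 0"
      unfolding in_keys_iff lk_partial mult_eq_0_iff by blast+
    then show "nonneg e"
      using *[of "e + Expo 0 0 1"] unfolding of_int_eq_0_iff by (auto simp: nonneg_def)
  qed
qed

subsection \<open>Evaluation\<close>

definition evm :: "complex \<Rightarrow> complex \<Rightarrow> complex \<Rightarrow> expo \<Rightarrow> complex" where
  "evm x z t e = x powi ex e * z powi ez e * t powi et e"

definition ev :: "complex \<Rightarrow> complex \<Rightarrow> complex \<Rightarrow> laur \<Rightarrow> complex" where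
  "ev x z t f = (\<Sum>e\<in>ks f. lk f e * evm x z t e)"

text \<open>At a zero coordinate \<open>powi\<close> turns negative powers into 0, which breaks
  multiplicativity of evaluation; such exponents are excluded here.\<close>

definition defd :: "complex \<Rightarrow> complex \<Rightarrow> complex \<Rightarrow> laur \<Rightarrow> bool" where
  "defd x z t f \<longleftrightarrow>
     (\<forall>e\<in>ks f. (x = 0 \<longrightarrow> 0 \<le> ex e) \<and> (z = 0 \<longrightarrow> 0 \<le> ez e) \<and> (t = 0 \<longrightarrow> 0 \<le> et e))"

lemma defd_pol [simp]: "f \<in> pol \<Longrightarrow> defd x z t f"
  by (auto simp: pol_def nonneg_def defd_def)

lemma defd_torus [simp]: "x \<noteq> 0 \<Longrightarrow> z \<noteq> 0 \<Longrightarrow> t \<noteq> 0 \<Longrightarrow> defd x z t f"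
  by (auto simp: defd_def)

lemma ev_superset: "finite S \<Longrightarrow> ks f \<subseteq> S \<Longrightarrow> ev x z t f = (\<Sum>e\<in>S. lk f e * evm x z t e)"
  unfolding ev_def by (rule sum.mono_neutral_left) (auto simp: in_keys_iff)

lemma ev_add [simp]: "ev x z t (f + g) = ev x z t f + ev x z t g"
proof -
  have "ev x z t (f + g) = (\<Sum>e\<in>ks f \<union> ks g. lk (f + g) e * evm x z t e)"
    using keys_add[of f g] by (intro ev_superset) auto
  moreover have "ev x z t f = (\<Sum>e\<in>ks f \<union> ks g. lk f e * evm x z t e)"
    "ev x z t g = (\<Sum>e\<in>ks f \<union> ks g. lk g e * evm x z t e)"
    by (intro ev_superset; auto)+
  ultimately show ?thesis
    by (simp add: lookup_add algebra_simps sum.distrib)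
qed

lemma ev_sg: "ev x z t (sg e c) = c * evm x z t e"
  by (simp add: ev_def)

lemma ev_cst [simp]: "ev x z t (cst c) = c"
  by (simp add: ev_sg evm_def)

lemma ev_0 [simp]: "ev x z t 0 = 0" and ev_1 [simp]: "ev x z t 1 = 1"
  using ev_cst[of x z t 0] ev_cst[of x z t 1] by simp_all

lemma ev_minus [simp]: "ev x z t (- f) = - ev x z t f"
  by (simp add: ev_def ks_minus sum_negf)

lemma ev_diff [simp]: "ev x z t (f - g) = ev x z t f - ev x z t g"
  using ev_add[of x z t f "- g"] by simp

lemma ev_vars [simp]: "ev x z t vx = x" "ev x z t vz = z" "ev x z t vt = t"
  by (simp_all add: ev_sg evm_def)

lemma powi_add_nonneg: "(x :: complex) = 0 \<longrightarrow> 0 \<le> i \<and> 0 \<le> j \<Longrightarrow> x powi (i + j) = x powi i * x powi j"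
  by (cases "x = 0") (auto simp: power_int_0_left_if power_int_add)

lemma ev_mult:
  assumes f: "defd x z t f" and g: "defd x z t g"
  shows "ev x z t (f * g) = ev x z t f * ev x z t g"
proof (rule laur_induct[of f])
  fix e c assume e: "e \<in> ks f"
  show "ev x z t (sg e c * g) = ev x z t (sg e c) * ev x z t g"
  proof (rule laur_induct[of g])
    fix e' c' assume e': "e' \<in> ks g"
    have "evm x z t (e + e') = evm x z t e * evm x z t e'"
    proof -
      have "x powi (ex e + ex e') = x powi ex e * x powi ex e'"
        "z powi (ez e + ez e') = z powi ez e * z powi ez e'"
        "t powi (et e + et e') = t powi et e * t powi et e'"
        using f g e e' by (auto simp: defd_def intro!: powi_add_nonneg)
      then show ?thesis
        by (simp add: evm_def)
    qed
    then show "ev x z t (sg e c * sg e' c') = ev x z t (sg e c) * ev x z t (sg e' c')"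
      by (simp add: mult_single ev_sg)
  qed (simp_all add: algebra_simps)
qed (simp_all add: algebra_simps)

lemma ev_mult_pol [simp]: "f \<in> pol \<Longrightarrow> g \<in> pol \<Longrightarrow> ev x z t (f * g) = ev x z t f * ev x z t g"
  by (simp add: ev_mult)

lemma ev_power_pol [simp]: "f \<in> pol \<Longrightarrow> ev x z t (f ^ n) = ev x z t f ^ n"
  by (induction n) (auto simp: pol_power)

lemma ev_mult_torus:
  "x \<noteq> 0 \<Longrightarrow> z \<noteq> 0 \<Longrightarrow> t \<noteq> 0 \<Longrightarrow> ev x z t (f * g) = ev x z t f * ev x z t g"
  by (simp add: ev_mult)

lemma ev_power_torus:
  "x \<noteq> 0 \<Longrightarrow> z \<noteq> 0 \<Longrightarrow> t \<noteq> 0 \<Longrightarrow> ev x z t (f ^ n) = ev x z t f ^ n"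
  by (induction n) (auto simp: ev_mult_torus)

lemma powi_2_inj: "(2 :: complex) powi a = 2 powi b \<Longrightarrow> a = b"
proof -
  assume "(2 :: complex) powi a = 2 powi b"
  then have "norm ((2 :: complex) powi a) = norm ((2 :: complex) powi b)" by simp
  then have "(2 :: real) powi a = 2 powi b" by (simp add: norm_power_int)
  then show "a = b"
    using power_int_strict_increasing[of a b "2 :: real"] power_int_strict_increasing[of b a "2 :: real"]
    by linarith
qed

text \<open>Linear independence of characters of the torus.\<close>

lemma ev_eq_0_imp:
  assumes "\<And>x z t. x \<noteq> 0 \<Longrightarrow> z \<noteq> 0 \<Longrightarrow> t \<noteq> 0 \<Longrightarrow> ev x z t f = 0"
  shows "f = 0"
  using assms
proof (induction "card (ks f)" arbitrary: f rule: less_induct)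
  case less
  show ?case
  proof (rule ccontr)
    assume "f \<noteq> 0"
    then obtain e1 where e1: "e1 \<in> ks f" by fastforce
    show False
    proof (cases "ks f \<subseteq> {e1}")
      case True
      then have "ev 1 1 1 f = lk f e1"
        by (subst ev_superset[of "{e1}"]) (auto simp: evm_def)
      then show False
        using less.prems[of 1 1 1] e1 by (simp add: in_keys_iff)
    next
      case False
      then obtain e2 where e2: "e2 \<in> ks f" "e2 \<noteq> e1" by blast
      have "\<exists>u v w. u \<noteq> 0 \<and> v \<noteq> 0 \<and> w \<noteq> 0 \<and> evm u v w e2 \<noteq> evm u v w e1"
      proof (cases "ex e1 = ex e2")
        case False
        then show ?thesis
          by (intro exI[of _ 2] exI[of _ 1]) (auto simp: evm_def dest: powi_2_inj)
      next
        case xx: True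
        show ?thesis
        proof (cases "ez e1 = ez e2")
          case False
          show ?thesis
            by (rule exI[of _ 1], rule exI[of _ 2], rule exI[of _ 1])
              (use False in \<open>auto simp: evm_def dest: powi_2_inj\<close>)
        next
          case True
          then have "et e1 \<noteq> et e2"
            using xx e2 expo.expand by blast
          show ?thesis
            by (rule exI[of _ 1], rule exI[of _ 1], rule exI[of _ 2])
              (use \<open>et e1 \<noteq> et e2\<close> in \<open>auto simp: evm_def dest: powi_2_inj\<close>)
        qed
      qed
      then obtain u v w where uvw: "u \<noteq> 0" "v \<noteq> 0" "w \<noteq> 0" "evm u v w e2 \<noteq> evm u v w e1"
        by blast
      \<comment> \<open>Dedekind's argument: moving the point by \<open>(u, v, w)\<close> and
        subtracting a multiple of \<open>f\<close> removes the exponent \<open>e1\<close> and keeps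
        \<open>e2\<close>.\<close>
      define g where "g = euler (\<lambda>e. evm u v w e - evm u v w e1) f"
      have sub: "ks g \<subseteq> ks f - {e1}"
        by (auto simp: g_def in_keys_iff lk_euler)
      then have "card (ks g) < card (ks f)"
        using e1 by (metis Diff_iff card_Diff1_less card_mono finite_Diff finite_keys leD
            le_less_trans not_less)
      moreover have "ev x z t g = 0" if nz: "x \<noteq> 0" "z \<noteq> 0" "t \<noteq> 0" for x z t
      proof -
        have "ev x z t g = (\<Sum>e\<in>ks f. lk g e * evm x z t e)"
          using sub by (intro ev_superset) auto
        also have "\<dots> = (\<Sum>e\<in>ks f. lk f e * evm (u * x) (v * z) (w * t) e - evm u v w e1 * (lk f e * evm x z t e))"
          by (intro sum.cong) (auto simp: g_def lk_euler evm_def power_int_mult_distrib algebra_simps)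
        also have "\<dots> = ev (u * x) (v * z) (w * t) f - evm u v w e1 * ev x z t f"
          by (simp add: sum_subtractf sum_distrib_left ev_def)
        also have "\<dots> = 0"
          using less.prems nz uvw by simp
        finally show ?thesis .
      qed
      ultimately have "g = 0"
        using less.hyps by blast
      then have "lk g e2 = 0" by simp
      then show False
        using e2 uvw by (simp add: g_def lk_euler in_keys_iff)
    qed
  qed
qed

lemma ev_inject:
  assumes "\<And>x z t. x \<noteq> 0 \<Longrightarrow> z \<noteq> 0 \<Longrightarrow> t \<noteq> 0 \<Longrightarrow> ev x z t f = ev x z t g"
  shows "f = g"
  using ev_eq_0_imp[of "f - g"] assms by simp

lemma DERIV_ev_torus:
  assumes a: "(a has_field_derivative a') (at s)" "a s \<noteq> 0"
    and b: "(b has_field_derivative b') (at s)" "b s \<noteq> 0"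
    and c: "(c has_field_derivative c') (at s)" "c s \<noteq> 0"
  shows "((\<lambda>s. ev (a s) (b s) (c s) f) has_field_derivative
    (a' * ev (a s) (b s) (c s) (px f) + b' * ev (a s) (b s) (c s) (pz f)
      + c' * ev (a s) (b s) (c s) (pt f))) (at s)"
proof (induction f rule: laur_induct')
  case (single e u)
  obtain i j m where e: "e = Expo i j m" by (cases e)
  show ?case
    unfolding e partial_sg ev_sg evm_def expo.sel
    by (rule derivative_eq_intros refl disjI2 a b c)+ (simp add: algebra_simps)
next
  case (add f g)
  then show ?case
    using DERIV_add[OF add] by (simp add: px.add pz.add pt.add algebra_simps)
qed

lemma DERIV_ev_pol:
  assumes f: "f \<in> pol"
    and abc: "(a has_field_derivative a') (at s)" "(b has_field_derivative b') (at s)"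
      "(c has_field_derivative c') (at s)"
  shows "((\<lambda>s. ev (a s) (b s) (c s) f) has_field_derivative
    (a' * ev (a s) (b s) (c s) (px f) + b' * ev (a s) (b s) (c s) (pz f)
      + c' * ev (a s) (b s) (c s) (pt f))) (at s)"
  using f
proof (induction rule: pol_induct)
  case (add f g)
  show ?case
    using DERIV_add[OF add(3,4)] by (simp add: px.add pz.add pt.add algebra_simps)
next
  case (mult f g)
  show ?case
    using DERIV_mult[OF mult(3,4)] mult(1,2)
    by (simp add: px.mult pz.mult pt.mult pol_partial pol_mult algebra_simps)
qed (use abc in simp_all)

text \<open>There is no substitution operation on \<open>laur\<close>; a composite is a polynomial
  with the right values, which determine it by \<open>ev_inject\<close>.\<close>

lemma pol_compose:
  assumes "f \<in> pol" "a \<in> pol" "b \<in> pol" "c \<in> pol"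
  obtains h where "h \<in> pol" "\<And>x z t. ev x z t h = ev (ev x z t a) (ev x z t b) (ev x z t c) f"
proof -
  have "\<exists>h\<in>pol. \<forall>x z t. ev x z t h = ev (ev x z t a) (ev x z t b) (ev x z t c) f"
    using assms(1)
  proof (induction rule: pol_induct)
    case (cst u)
    then show ?case by (intro bexI[of _ "cst u"]) auto
  next
    case vx
    show ?case using assms by (intro bexI[of _ a]) auto
  next
    case vz
    show ?case using assms by (intro bexI[of _ b]) auto
  next
    case vt
    show ?case using assms by (intro bexI[of _ c]) auto
  next
    case (add f g)
    then obtain u v where uv: "u \<in> pol" "v \<in> pol"
      "\<And>x z t. ev x z t u = ev (ev x z t a) (ev x z t b) (ev x z t c) f"
      "\<And>x z t. ev x z t v = ev (ev x z t a) (ev x z t b) (ev x z t c) g" by metis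
    then show ?case by (intro bexI[of _ "u + v"]) auto
  next
    case (mult f g)
    then obtain u v where uv: "u \<in> pol" "v \<in> pol"
      "\<And>x z t. ev x z t u = ev (ev x z t a) (ev x z t b) (ev x z t c) f"
      "\<And>x z t. ev x z t v = ev (ev x z t a) (ev x z t b) (ev x z t c) g" by metis
    then show ?case using mult by (intro bexI[of _ "u * v"]) auto
  qed
  then show ?thesis using that by blast
qed

lemma ev_0_pol: "f \<in> pol \<Longrightarrow> ev 0 0 0 f = lk f 0"
proof -
  assume f: "f \<in> pol"
  have "lk f e * evm 0 0 0 e = (if e = 0 then lk f 0 else 0)" if "e \<in> ks f" for e
  proof (cases "e = 0")
    case False
    then have "ex e \<noteq> 0 \<or> ez e \<noteq> 0 \<or> et e \<noteq> 0"
      by (metis expo.expand expo_sel(1-3))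
    then show ?thesis
      using False by (auto simp: evm_def)
  qed (simp add: evm_def)
  then have "ev 0 0 0 f = (\<Sum>e\<in>ks f. if e = 0 then lk f 0 else 0)"
    unfolding ev_def by (intro sum.cong) auto
  then show ?thesis
    by (auto simp: in_keys_iff)
qed

lemma ev_0_mult: "f \<in> pol \<Longrightarrow> g \<in> pol \<Longrightarrow> lk (f * g) 0 = lk f 0 * lk g 0"
  by (simp flip: ev_0_pol add: pol_mult)

lemma ev_continuous_pol: "f \<in> pol \<Longrightarrow> isCont (\<lambda>s. ev s z t f) x"
  using DERIV_ev_pol[of f "\<lambda>s. s" 1 x "\<lambda>_. z" 0 "\<lambda>_. t" 0] by (intro DERIV_isCont) auto

text \<open>The hypersurface has a point over every (x, z, t) with x nonzero, so identities are
  first known there; continuity adds x = 0.\<close>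

lemma ev_eq_extend:
  assumes "f \<in> pol" "g \<in> pol" "\<And>s. s \<noteq> 0 \<Longrightarrow> ev s z t f = ev s z t g"
  shows "ev x z t f = ev x z t g"
proof (cases "x = 0")
  case True
  have "(\<lambda>s. ev s z t f) \<midarrow>0\<rightarrow> ev 0 z t f" "(\<lambda>s. ev s z t g) \<midarrow>0\<rightarrow> ev 0 z t g"
    using ev_continuous_pol[OF assms(1), of 0 z t] ev_continuous_pol[OF assms(2), of 0 z t]
    by (simp_all add: isCont_def)
  moreover have "(\<lambda>s. ev s z t f) \<midarrow>0\<rightarrow> ev 0 z t g"
    by (rule Lim_transform_eventually[OF calculation(2)])
      (use assms(3) in \<open>auto simp: eventually_at_filter\<close>)
  ultimately show ?thesis
    using LIM_unique True by blast
qed (use assms in auto)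

text \<open>The total degrees of \<open>f\<close> and \<open>g\<close> add up to 0, so both are
  0.\<close>

lemma pol_unit:
  assumes "f \<in> pol" "g \<in> pol" "f * g = 1"
  obtains c where "f = cst c" "c \<noteq> 0"
proof -
  define W where "W e = ex e + ez e + et e" for e
  have W: "weight W"
    by (simp add: weight_def W_def)
  have pos: "0 \<le> W e" if "h \<in> pol" "e \<in> ks h" for e h
    using polD[OF that] by (simp add: W_def nonneg_def)
  have "f \<noteq> 0" "g \<noteq> 0"
    using assms(3) by auto
  from \<open>f \<noteq> 0\<close> obtain m where m: "wle W m f" "hc W m f \<noteq> 0" "\<exists>e\<in>ks f. m = W e"
    by (rule top_weight)
  from \<open>g \<noteq> 0\<close> obtain n where n: "wle W n g" "hc W n g \<noteq> 0" "\<exists>e\<in>ks g. n = W e"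
    by (rule top_weight)
  have "hc W (m + n) 1 \<noteq> 0"
    using hc_mult[OF W m(1) n(1)] m n assms by simp
  then obtain e where "e \<in> ks (hc W (m + n) 1)" by fastforce
  then have "m + n = 0"
    by (auto simp: ks_hc W_def split: if_splits simp flip: single_one)
  then have "m = 0"
    using m(3) n(3) pos[OF assms(1)] pos[OF assms(2)]
    by (metis add_nonneg_eq_0_iff)
  have "e = 0" if e: "e \<in> ks f" for e
    using wleD[OF m(1) e] polD[OF assms(1) e] \<open>m = 0\<close>
    by (intro expo.expand) (simp add: W_def nonneg_def)
  then have "ks f \<subseteq> {0}" by blast
  then have "f = cst (lk f 0)"
    by (intro poly_mapping_eqI) (auto simp: lookup_single when_def in_keys_iff)
  with \<open>f \<noteq> 0\<close> show ?thesis
    using that by (metis single_zero)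
qed

subsection \<open>Quasi-homogeneous polynomials in two variables\<close>

lemma sg_shift_pol:
  assumes "f \<in> pol" "\<And>e. e \<in> ks f \<Longrightarrow> nonneg (e - s)"
  shows "\<exists>g\<in>pol. f = sg s 1 * g \<and> (\<forall>e. e \<in> ks g \<longleftrightarrow> e + s \<in> ks f)"
proof (intro bexI[of _ "sg (- s) 1 * f"] conjI allI)
  let ?g = "sg (- s) 1 * f"
  show keys: "e \<in> ks ?g \<longleftrightarrow> e + s \<in> ks f" for e
    by (simp add: in_keys_iff lk_sg_mult)
  show "?g \<in> pol"
    by (rule polI) (use keys assms(2) in force)
  show "f = sg s 1 * ?g"
    using sg_mult_inverse[of s] by (simp flip: mult.assoc)
qed

text \<open>If neither variable divides \<open>h\<close>, pure powers of z and of t both occur, so k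
  l divides \<open>q\<close> by coprimality and \<open>h\<close> is a binary form in z^k and t^l,
  which has a linear factor over the complex numbers.\<close>

lemma quasi_homogeneous_factor:
  fixes k l :: nat
  assumes kl: "k > 0" "l > 0" "coprime k l"
    and h: "h \<in> pol" "h \<noteq> 0" and keys: "\<And>e. e \<in> ks h \<Longrightarrow> ex e = 0 \<and> int l * ez e + int k * et e = q"
    and q: "q > 0"
  shows "\<exists>g\<in>pol. h = vz * g \<or> h = vt * g \<or> (\<exists>c. c \<noteq> 0 \<and> h = (vz ^ k + cst c * vt ^ l) * g)"
proof (cases "(\<forall>e\<in>ks h. ez e \<noteq> 0) \<or> (\<forall>e\<in>ks h. et e \<noteq> 0)")
  case True
  then show ?thesis
  proof
    assume *: "\<forall>e\<in>ks h. ez e \<noteq> 0"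
    have "nonneg (e - Expo 0 1 0)" if "e \<in> ks h" for e
      using polD[OF h(1) that] bspec[OF * that] by (simp add: nonneg_def)
    from sg_shift_pol[OF h(1) this] show ?thesis by blast
  next
    assume *: "\<forall>e\<in>ks h. et e \<noteq> 0"
    have "nonneg (e - Expo 0 0 1)" if "e \<in> ks h" for e
      using polD[OF h(1) that] bspec[OF * that] by (simp add: nonneg_def)
    from sg_shift_pol[OF h(1) this] show ?thesis by blast
  qed
next
  case False
  then obtain e1 e2 where e1: "e1 \<in> ks h" "ez e1 = 0" and e2: "e2 \<in> ks h" "et e2 = 0"
    by blast
  have cop: "coprime (int k) (int l)" using kl by simp
  have "q = int k * et e1" "q = int l * ez e2"
    using keys[OF e1(1)] keys[OF e2(1)] e1 e2 by simp_all
  then have "int k dvd q" "int l dvd q"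
    by (blast intro: dvdI)+
  then have "int k * int l dvd q"
    using cop by (simp add: divides_mult)
  then obtain r' where "q = int k * int l * r'" by (auto elim: dvdE)
  moreover have "0 < int k * int l"
    using kl by simp
  then have "r' > 0"
    using q calculation by (metis zero_less_mult_pos)
  ultimately obtain r where r: "q = int k * int l * int (Suc r)"
    by (metis gr0_implies_Suc zero_less_imp_eq_int)
  \<comment> \<open>\<open>hom r p\<close> is the form of degree \<open>r\<close> in
    \<open>vz ^ k\<close> and \<open>vt ^ l\<close> with the coefficients of
    \<open>p\<close>.\<close>
  define E where "E s r = Expo 0 (int k * int s) (int l * (int r - int s))" for s r :: nat
  define hom where "hom r p = (\<Sum>s\<le>r. sg (E s r) (coeff p s))" for r :: nat and p :: "complex poly"
  have Einj: "E s r = E s' r \<longleftrightarrow> s = s'" for s s' r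
    using kl by (auto simp: E_def)
  define p where "p = (\<Sum>s\<le>Suc r. monom (lk h (E s (Suc r))) s)"
  have cp: "coeff p s = (if s \<le> Suc r then lk h (E s (Suc r)) else 0)" for s
  proof -
    have "coeff p s = (\<Sum>i\<le>Suc r. if s = i then lk h (E i (Suc r)) else 0)"
      unfolding p_def coeff_sum by (intro sum.cong) auto
    then show ?thesis by (simp only: sum.delta' finite_atMost atMost_iff)
  qed
  have keyE: "\<exists>s\<le>Suc r. e = E s (Suc r)" if e: "e \<in> ks h" for e
  proof -
    have eq: "int l * ez e + int k * et e = int k * int l * int (Suc r)" and "ex e = 0"
      and nn: "0 \<le> ez e" "0 \<le> et e"
      using keys[OF e] r polD[OF h(1) e] by (auto simp: nonneg_def)
    have "int k dvd int l * ez e"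
      using eq by (metis dvd_add_left_iff dvd_triv_left mult.assoc)
    then have "int k dvd ez e"
      using cop coprime_dvd_mult_right_iff by blast
    then obtain s' where s': "ez e = int k * s'" by (auto elim: dvdE)
    with nn kl have "s' \<ge> 0" by (simp add: zero_le_mult_iff)
    then obtain s where s: "ez e = int k * int s" using s' nonneg_int_cases by metis
    have "int k * et e = int k * (int l * (int (Suc r) - int s))"
      using eq s by (simp add: algebra_simps)
    then have et: "et e = int l * (int (Suc r) - int s)" using kl by simp
    with nn kl have "s \<le> Suc r" by (simp add: zero_le_mult_iff)
    moreover have "e = E s (Suc r)"
      by (rule expo.expand) (simp add: E_def s et \<open>ex e = 0\<close>)
    ultimately show ?thesis by blast
  qed
  have h_eq: "h = hom (Suc r) p"
  proof (rule poly_mapping_eqI)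
    fix e
    have "lk (hom (Suc r) p) e = (\<Sum>s\<le>Suc r. if E s (Suc r) = e then lk h e else 0)"
      unfolding hom_def lookup_sum by (intro sum.cong) (auto simp: lookup_single when_def cp)
    also have "\<dots> = lk h e"
    proof (cases "e \<in> ks h")
      case True
      then obtain s where s: "s \<le> Suc r" "e = E s (Suc r)"
        using keyE by blast
      then have "(\<Sum>i\<le>Suc r. if E i (Suc r) = e then lk h e else 0) =
          (\<Sum>i\<le>Suc r. if i = s then lk h e else 0)"
        by (intro sum.cong) (auto simp: Einj)
      then show ?thesis using s by (simp only: sum.delta finite_atMost atMost_iff) simp
    next
      case False
      then have "lk h e = 0" by (simp add: in_keys_iff)
      then show ?thesis by (intro trans[OF sum.neutral]) auto
    qed
    finally show "lk h e = lk (hom (Suc r) p) e" by simp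
  qed
  \<comment> \<open>The pure powers of t and z give the constant and leading coefficients of
    \<open>p\<close>, so \<open>p\<close> has degree \<open>Suc r\<close> and no root 0.\<close>
  obtain s1 where "e1 = E s1 (Suc r)" using keyE[OF e1(1)] by blast
  with e1 have "coeff p 0 \<noteq> 0"
    using kl by (auto simp: cp E_def in_keys_iff)
  obtain s2 where "s2 \<le> Suc r" "e2 = E s2 (Suc r)" using keyE[OF e2(1)] by blast
  with e2 have "coeff p (Suc r) \<noteq> 0"
    using kl by (auto simp: cp E_def in_keys_iff)
  moreover have "degree p \<le> Suc r"
    by (rule degree_le) (simp add: cp)
  ultimately have deg: "degree p = Suc r"
    using le_degree[of p "Suc r"] by auto
  then obtain \<rho> where \<rho>: "poly p \<rho> = 0"
    using fundamental_theorem_of_algebra[of p] by (auto simp: constant_degree)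
  then obtain p' where p': "p = [:- \<rho>, 1:] * p'"
    by (auto simp: poly_eq_0_iff_dvd elim: dvdE)
  have "\<rho> \<noteq> 0"
    using \<rho> \<open>coeff p 0 \<noteq> 0\<close> by (auto simp: poly_0_coeff_0)
  have "p' \<noteq> 0" using deg p' by auto
  then have deg': "degree p' = r"
    using deg by (simp add: p' degree_mult_eq del: mult_pCons_left)
  have "(\<Sum>s\<le>Suc r. sg (E s (Suc r)) (coeff (pCons 0 p') s)) = (\<Sum>s\<le>r. vz ^ k * sg (E s r) (coeff p' s))"
    by (subst sum.atMost_Suc_shift)
      (auto simp: E_def sg_power mult_single algebra_simps intro!: sum.cong)
  moreover have "(\<Sum>s\<le>Suc r. sg (E s (Suc r)) (\<rho> * coeff p' s)) =
      (\<Sum>s\<le>r. cst \<rho> * vt ^ l * sg (E s r) (coeff p' s))"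
    using deg' by (auto simp: E_def sg_power mult_single algebra_simps coeff_eq_0 intro!: sum.cong)
  moreover have "hom (Suc r) p = (\<Sum>s\<le>Suc r. sg (E s (Suc r)) (coeff (pCons 0 p') s)) -
      (\<Sum>s\<le>Suc r. sg (E s (Suc r)) (\<rho> * coeff p' s))"
    unfolding hom_def p' sum_subtractf[symmetric] by (intro sum.cong) (simp_all add: single_diff)
  ultimately have "h = (vz ^ k + cst (- \<rho>) * vt ^ l) * hom r p'"
    by (simp add: h_eq hom_def sum_distrib_left algebra_simps sum_subtractf single_uminus)
  moreover have "hom r p' \<in> pol"
    unfolding hom_def by (intro pol_sum pol_sg) (auto simp: E_def nonneg_def)
  ultimately show ?thesis
    using \<open>\<rho> \<noteq> 0\<close> by (metis neg_equal_0_iff_equal)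
qed

subsection \<open>The coordinate ring inside the Laurent polynomials\<close>

abbreviation evv :: "complex ^ 4 \<Rightarrow> laur \<Rightarrow> complex" where
  "evv v f \<equiv> ev (v $ 1) (v $ 3) (v $ 4) f"

lemma prod_UNIV_4: "(\<Prod>i\<in>UNIV. f (i :: 4)) = f 1 * f 2 * f 3 * f 4"
  unfolding UNIV_4 by (simp add: ac_simps)

locale koras =
  fixes d k l :: nat
  assumes d: "d \<ge> 2" and k: "2 \<le> k" and kl: "k < l" and cop: "coprime k l"
begin

abbreviation X :: "(complex ^ 4) set" where "X \<equiv> hypersurface_X d k l"

definition H :: laur where "H = vz ^ k + vt ^ l"
definition F :: laur where "F = H + vx"

text \<open>The coordinate functions \<open>x, z, t\<close> embed the part of the hypersurface with \<open>x \<noteq> 0\<close>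
  into affine space, and \<open>yy\<close> is the function \<open>y\<close> there.\<close>

definition yy :: laur where "yy = - (F * sg (Expo (- int d) 0 0) 1)"

lemma l: "l \<ge> 2" "l > 0" and k0: "k > 0"
  using k kl by simp_all

lemma H_pol [simp]: "H \<in> pol" and F_pol [simp]: "F \<in> pol"
  unfolding F_def H_def by (intro pol_add pol_power pol_vars)+

lemma x_d_yy: "vx ^ d * yy = - F"
  by (simp add: yy_def sg_power mult_single mult.assoc mult.left_commute[of _ F])

lemma evv_F: "v \<in> X \<Longrightarrow> (v $ 1) ^ d * v $ 2 = - evv v F"
  by (simp add: hypersurface_X_def F_def H_def pol_power eq_neg_iff_add_eq_0 algebra_simps)

lemma evv_yy: "v \<in> X \<Longrightarrow> v $ 1 \<noteq> 0 \<Longrightarrow> v $ 3 \<noteq> 0 \<Longrightarrow> v $ 4 \<noteq> 0 \<Longrightarrow> evv v yy = v $ 2"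
proof -
  assume v: "v \<in> X" "v $ 1 \<noteq> 0" "v $ 3 \<noteq> 0" "v $ 4 \<noteq> 0"
  have "(v $ 1) ^ d * evv v yy = evv v (vx ^ d * yy)"
    using v by (simp add: ev_mult_torus ev_power_torus)
  also have "\<dots> = (v $ 1) ^ d * v $ 2"
    by (simp add: x_d_yy evv_F[OF v(1)])
  finally show ?thesis
    using v by simp
qed

text \<open>\<open>arep b f G\<close>: a polynomial \<open>\<Sum>\<^sub>i y\<^sup>i g\<^sub>i(x, z, t)\<close> of degree at most \<open>b\<close> in \<open>y\<close> induces the
  function \<open>f\<close> on the hypersurface and the Laurent polynomial \<open>G\<close>.\<close>

fun arep :: "nat \<Rightarrow> (complex ^ 4 \<Rightarrow> complex) \<Rightarrow> laur \<Rightarrow> bool" where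
  "arep 0 f G \<longleftrightarrow> G \<in> pol \<and> (\<forall>v\<in>X. f v = evv v G)"
| "arep (Suc b) f G \<longleftrightarrow> (\<exists>g\<in>pol. \<exists>f' G'. arep b f' G' \<and> G = yy ^ Suc b * g + G' \<and>
     (\<forall>v\<in>X. f v = (v $ 2) ^ Suc b * evv v g + f' v))"

lemma arep_cong: "arep b f G \<Longrightarrow> (\<And>v. v \<in> X \<Longrightarrow> f v = f' v) \<Longrightarrow> arep b f' G"
  by (cases b) auto

lemma arep_Suc: "arep b f G \<Longrightarrow> arep (Suc b) f G"
  by (auto intro!: bexI[of _ 0])

lemma arep_mono: "arep b f G \<Longrightarrow> b \<le> c \<Longrightarrow> arep c f G"
  by (induction c) (auto simp: le_Suc_eq simp del: arep.simps intro: arep_Suc)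

lemma arep_add: "arep b f G \<Longrightarrow> arep b f' G' \<Longrightarrow> arep b (\<lambda>v. f v + f' v) (G + G')"
proof (induction b arbitrary: f G f' G')
  case (Suc b)
  obtain g f1 G1 where 1: "g \<in> pol" "arep b f1 G1" "G = yy ^ Suc b * g + G1"
    "\<And>v. v \<in> X \<Longrightarrow> f v = (v $ 2) ^ Suc b * evv v g + f1 v"
    using Suc.prems(1) by auto
  obtain g' f1' G1' where 2: "g' \<in> pol" "arep b f1' G1'" "G' = yy ^ Suc b * g' + G1'"
    "\<And>v. v \<in> X \<Longrightarrow> f' v = (v $ 2) ^ Suc b * evv v g' + f1' v"
    using Suc.prems(2) by auto
  have "G + G' = yy ^ Suc b * (g + g') + (G1 + G1')"
    by (simp add: 1 2 algebra_simps)
  then show ?case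
    using Suc.IH[OF 1(2) 2(2)] 1 2 unfolding arep.simps
    by (intro bexI[of _ "g + g'"] exI[of _ "\<lambda>v. f1 v + f1' v"] exI[of _ "G1 + G1'"])
      (auto simp: algebra_simps)
qed auto

lemma arep_zero: "arep b (\<lambda>v. 0) 0"
  by (induction b) (auto intro!: bexI[of _ 0])

lemma arep_monom: "g \<in> pol \<Longrightarrow> arep b (\<lambda>v. (v $ 2) ^ b * evv v g) (yy ^ b * g)"
proof (cases b)
  case (Suc c)
  assume "g \<in> pol"
  then show ?thesis
    using arep_zero[of c] unfolding Suc arep.simps
    by (intro bexI[of _ g] exI[of _ "\<lambda>v. 0"] exI[of _ 0]) auto
qed simp

lemma arep_pol: "g \<in> pol \<Longrightarrow> arep b (\<lambda>v. evv v g) g"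
  using arep_mono[of 0 _ _ b] by simp

lemma arep_poly_fun:
  assumes "polynomial_fun f"
  shows "\<exists>b G. arep b f G"
proof -
  obtain S c where S: "finite S" and
    f: "\<And>v. f v = (\<Sum>e\<in>S. c e * (\<Prod>i\<in>UNIV. (v $ i) ^ (e :: 4 \<Rightarrow> nat) i))"
    using assms unfolding polynomial_fun_def by blast
  have "\<exists>b G. arep b (\<lambda>v. \<Sum>e\<in>S. c e * (\<Prod>i\<in>UNIV. (v $ i) ^ e i)) G"
    using S
  proof (induction S)
    case empty
    then show ?case using arep_zero by auto
  next
    case (insert e S)
    obtain b G where b: "arep b (\<lambda>v. \<Sum>e\<in>S. c e * (\<Prod>i\<in>UNIV. (v $ i) ^ e i)) G"
      using insert by blast
    define g where "g = cst (c e) * vx ^ e 1 * vz ^ e 3 * vt ^ e 4"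
    have g: "g \<in> pol" and evg: "evv v g = c e * (v $ 1) ^ e 1 * (v $ 3) ^ e 3 * (v $ 4) ^ e 4" for v
      by (auto simp: g_def pol_power pol_mult)
    have "arep (e 2) (\<lambda>v. c e * (\<Prod>i\<in>UNIV. (v $ i) ^ e i)) (yy ^ e 2 * g)"
      by (rule arep_cong[OF arep_monom[OF g]]) (simp only: evg prod_UNIV_4 mult_ac)
    then have "arep (max b (e 2)) (\<lambda>v. c e * (\<Prod>i\<in>UNIV. (v $ i) ^ e i) +
        (\<Sum>e\<in>S. c e * (\<Prod>i\<in>UNIV. (v $ i) ^ e i))) (yy ^ e 2 * g + G)"
      using b by (intro arep_add) (auto elim: arep_mono)
    then show ?case
      using insert by auto
  qed
  then show ?thesis
    unfolding f[symmetric] .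
qed

lemma arep_ev:
  "arep b f G \<Longrightarrow> v \<in> X \<Longrightarrow> v $ 1 \<noteq> 0 \<Longrightarrow> v $ 3 \<noteq> 0 \<Longrightarrow> v $ 4 \<noteq> 0 \<Longrightarrow> f v = evv v G"
proof (induction b arbitrary: f G)
  case (Suc b)
  obtain g f1 G1 where 1: "g \<in> pol" "arep b f1 G1" "G = yy ^ Suc b * g + G1"
    "f v = (v $ 2) ^ Suc b * evv v g + f1 v"
    using Suc.prems by auto
  then show ?case
    using Suc.IH[OF 1(2)] Suc.prems evv_yy[of v] by (simp add: ev_mult_torus ev_power_torus)
qed auto

lemma point_exists:
  assumes "x \<noteq> 0"
  obtains v where "v \<in> X" "v $ 1 = x" "v $ 3 = z" "v $ 4 = t"
proof
  let ?v = "(\<chi> i. if i = 1 then x else if i = 2 then - (z ^ k + t ^ l + x) / x ^ d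
    else if i = 3 then z else t) :: complex ^ 4"
  show "?v \<in> X" "?v $ 1 = x" "?v $ 3 = z" "?v $ 4 = t"
    using assms by (simp_all add: hypersurface_X_def field_simps)
qed

lemma arep_unique:
  assumes "arep b f G" "arep b' f' G'" "\<And>v. v \<in> X \<Longrightarrow> f v = f' v"
  shows "G = G'"
proof (rule ev_inject)
  fix x z t :: complex assume nz: "x \<noteq> 0" "z \<noteq> 0" "t \<noteq> 0"
  obtain v where "v \<in> X" "v $ 1 = x" "v $ 3 = z" "v $ 4 = t"
    using point_exists nz by blast
  then show "ev x z t G = ev x z t G'"
    using arep_ev[OF assms(1), of v] arep_ev[OF assms(2), of v] assms(3)[of v] nz by simp
qed

definition Wx :: "expo \<Rightarrow> int" where "Wx e = - ex e"

lemma weight_Wx: "weight Wx"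
  by (simp add: weight_def Wx_def)

lemma wle_Wx_pol: "g \<in> pol \<Longrightarrow> 0 \<le> n \<Longrightarrow> wle Wx n g"
  using polD by (fastforce simp: wle_def Wx_def nonneg_def)

lemma wle_yy: "wle Wx (int d) yy"
  unfolding yy_def
  by (intro wle_minus) (use wle_mult[OF weight_Wx wle_Wx_pol[OF F_pol order_refl] wle_sg[of Wx "Expo (- int d) 0 0" "int d"]] in \<open>simp add: Wx_def\<close>)

lemma lk_H: "lk H e = (if e = Expo 0 (int k) 0 then 1 else 0) + (if e = Expo 0 0 (int l) then 1 else 0)"
  by (auto simp: H_def sg_power lookup_add lookup_single when_def)

lemma H_nz: "H \<noteq> 0"
proof
  assume "H = 0"
  then have "lk H (Expo 0 (int k) 0) = 0" by simp
  then show False using k0 by (simp add: lk_H split: if_splits)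
qed

lemma ks_H: "e \<in> ks H \<Longrightarrow> e = Expo 0 (int k) 0 \<or> e = Expo 0 0 (int l)"
  by (auto simp: in_keys_iff lk_H split: if_splits)

lemma hc_yy_Wx: "hc Wx (int d) yy \<noteq> 0"
proof -
  have "hc Wx 0 F = H"
    unfolding F_def hc_add
    by (subst hc_hom[of H]) (auto simp: Wx_def intro!: hc_eq_0 dest!: ks_H)
  moreover have "hc Wx (int d) (sg (Expo (- int d) 0 0) 1) = sg (Expo (- int d) 0 0) 1"
    by (rule hc_hom) (auto simp: Wx_def dest: ks_sg)
  ultimately have "hc Wx (int d) yy = - (H * sg (Expo (- int d) 0 0) 1)"
    using hc_mult[OF weight_Wx wle_Wx_pol[OF F_pol order_refl] wle_sg[of Wx "Expo (- int d) 0 0" "int d" 1]]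
    by (simp add: yy_def Wx_def hc_minus)
  moreover have "sg (Expo (- int d) 0 0) (1 :: complex) \<noteq> 0"
    by (metis lookup_single_eq lookup_zero zero_neq_one)
  ultimately show ?thesis
    using H_nz by simp
qed

lemma arep_wle: "arep b f G \<Longrightarrow> wle Wx (int d * int b) G"
proof (induction b arbitrary: f G)
  case (Suc b)
  obtain g f1 G1 where 1: "g \<in> pol" "arep b f1 G1" "G = yy ^ Suc b * g + G1"
    using Suc.prems by auto
  have "wle Wx (int d * int (Suc b)) (yy ^ Suc b)"
    using wle_power[OF weight_Wx wle_yy, of "Suc b"] by (simp add: funpow_add_int algebra_simps)
  from wle_mult[OF weight_Wx this wle_Wx_pol[OF 1(1) order_refl]]
  have "wle Wx (int d * int (Suc b)) (yy ^ Suc b * g)" by simp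
  moreover have "wle Wx (int d * int (Suc b)) G1"
    using Suc.IH[OF 1(2)] by (rule wle_mono) (simp add: algebra_simps)
  ultimately show ?case
    unfolding 1(3) by (rule wle_add)
qed (simp add: wle_Wx_pol)

text \<open>The leading coefficient of \<open>y\<^sup>b\<close> is a power of \<open>F\<close> divided by \<open>x\<^sup>d\<^sup>b\<close>, and \<open>x\<close> does not divide \<open>F\<close>:
  if the order of pole is smaller than it could be, the coefficient of the
  highest power of \<open>y\<close> is divisible by \<open>x\<^sup>d\<close>, and \<open>x\<^sup>d y = - F\<close> lowers the degree in \<open>y\<close>.\<close>

lemma arep_descent:
  assumes "arep (Suc b) f G" and G: "wle Wx (int d * int b) G"
  shows "arep b f G"
proof -
  obtain g f1 G1 where 1: "g \<in> pol" "arep b f1 G1" "G = yy ^ Suc b * g + G1"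
    "\<And>v. v \<in> X \<Longrightarrow> f v = (v $ 2) ^ Suc b * evv v g + f1 v"
    using assms(1) by auto
  \<comment> \<open>\<open>yy ^ Suc b\<close> has pole order exactly d (b + 1), so \<open>g\<close>
    must vanish to order d along x = 0.\<close>
  have "wle Wx (int d * int (Suc b) + - int d) (yy ^ Suc b * g)"
    using wle_diff[OF G arep_wle[OF 1(2)]] by (simp add: 1(3) algebra_simps)
  moreover have "wle Wx (int d * int (Suc b)) (yy ^ Suc b)"
    using wle_power[OF weight_Wx wle_yy, of "Suc b"] by (simp add: funpow_add_int algebra_simps)
  moreover have "hc Wx (int d * int (Suc b)) (yy ^ Suc b) \<noteq> 0"
    using hc_power[OF weight_Wx wle_yy, of "Suc b"] hc_yy_Wx by (simp add: funpow_add_int algebra_simps)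
  ultimately have "wle Wx (- int d) g"
    by (rule wle_cancel[OF weight_Wx])
  then have "nonneg (e - Expo (int d) 0 0)" if "e \<in> ks g" for e
    using that polD[OF 1(1) that] by (auto simp: wle_def Wx_def nonneg_def)
  with 1(1) obtain g1 where g1: "g1 \<in> pol" "g = sg (Expo (int d) 0 0) 1 * g1"
    using sg_shift_pol[of g "Expo (int d) 0 0"] by blast
  then have g: "g = vx ^ d * g1"
    by (simp add: sg_power)
  have "yy ^ Suc b * g = yy ^ b * (vx ^ d * yy) * g1"
    by (simp add: g algebra_simps)
  then have eq: "G = yy ^ b * - (F * g1) + G1"
    unfolding 1(3) x_d_yy by (simp only:) simp
  show ?thesis
    unfolding eq
  proof (rule arep_cong[OF arep_add[OF arep_monom 1(2)]])
    show "- (F * g1) \<in> pol" using g1 by (intro pol_minus pol_mult F_pol)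
    fix v assume v: "v \<in> X"
    have "(v $ 2) ^ Suc b * evv v g = (v $ 2) ^ b * ((v $ 1) ^ d * v $ 2) * evv v g1"
      unfolding g using g1(1) by (simp add: pol_power)
    then show "v $ 2 ^ b * evv v (- (F * g1)) + f1 v = f v"
      using g1(1) unfolding 1(4)[OF v] evv_F[OF v] by simp
  qed
qed

lemma arep_reduce: "arep b f G \<Longrightarrow> wle Wx (int d * int c) G \<Longrightarrow> arep c f G"
proof (induction b)
  case 0
  then show ?case using arep_mono[of 0 f G c] by simp
next
  case (Suc b)
  show ?case
  proof (cases "Suc b \<le> c")
    case True
    then show ?thesis using Suc.prems arep_mono by blast
  next
    case False
    then have "int d * int c \<le> int d * int b"
      by (intro mult_left_mono) auto
    then show ?thesis
      using Suc arep_descent wle_mono by blast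
  qed
qed

text \<open>The point is x = 0, which \<open>G\<close> does not see: reduction to degree 0 in y
  gives the equality on the whole hypersurface.\<close>

lemma arep_pol_ev: "arep b f G \<Longrightarrow> G \<in> pol \<Longrightarrow> v \<in> X \<Longrightarrow> f v = evv v G"
  using arep_reduce[of b f G 0] wle_Wx_pol[of G 0] by simp

lemma arep_wle_0_pol: "arep b f G \<Longrightarrow> wle Wx 0 G \<Longrightarrow> G \<in> pol"
  using arep_reduce[of b f G 0] by simp

lemma arep_linear:
  assumes "arep b f G" "wle Wx (int d) G"
  obtains u g where "u \<in> pol" "g \<in> pol" "G = yy * u + g" "\<And>v. v \<in> X \<Longrightarrow> f v = v $ 2 * evv v u + evv v g"
  using arep_reduce[of b f G 1] assms by auto

subsection \<open>Bihomogeneous initial forms\<close>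

text \<open>Order of pole along \<open>x = 0\<close> first, then the weight with \<open>z\<close>, \<open>t\<close> of weights \<open>l\<close>, \<open>k\<close>.\<close>

definition W :: "expo \<Rightarrow> expo" where "W e = Expo (- ex e) (int l * ez e + int k * et e) 0"

definition yh :: laur where "yh = - (H * sg (Expo (- int d) 0 0) 1)"

definition wy :: expo where "wy = Expo (int d) (int k * int l) 0"

lemma weight_W: "weight W"
  by (simp add: weight_def W_def algebra_simps)

lemma W_sel [simp]: "ex (W e) = - ex e" "ez (W e) = int l * ez e + int k * et e" "et (W e) = 0"
  by (simp_all add: W_def)

lemma W_H: "e \<in> ks H \<Longrightarrow> W e = Expo 0 (int k * int l) 0"
  by (auto simp: W_def dest!: ks_H)

lemma x_d_yh: "vx ^ d * yh = - H"
  by (simp add: yh_def sg_power mult_single mult.assoc mult.left_commute[of _ H])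

lemma yh_nz: "yh \<noteq> 0"
  using x_d_yh H_nz by auto

lemma wle_W_yy: "wle W wy yy" and hc_W_yy: "hc W wy yy = yh"
proof -
  let ?s = "Expo (- int d) 0 0" and ?w = "Expo 0 (int k * int l) 0"
  have wy: "wy = ?w + W ?s"
    by (simp add: wy_def W_def)
  \<comment> \<open>Vanishing along x = 0 lowers the first component, so the term x of
    \<open>F\<close> lies below \<open>H\<close>.\<close>
  have x: "W (Expo 1 0 0) < ?w"
    using k0 l by (simp add: W_def less_expo_def)
  have F: "wle W ?w F"
    unfolding F_def by (intro wle_add wle_sg) (use W_H x in \<open>auto simp: wle_def\<close>)
  have "hc W ?w F = H"
    unfolding F_def hc_add using W_H x by (subst hc_hom[of H]) (auto intro!: hc_eq_0 dest: ks_sg)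
  moreover have "hc W (W ?s) (sg ?s 1) = sg ?s 1"
    by (rule hc_hom) (auto dest: ks_sg)
  ultimately show "hc W wy yy = yh"
    unfolding wy yy_def yh_def hc_minus hc_mult[OF weight_W F wle_sg[OF order_refl]] by simp
  show "wle W wy yy"
    unfolding wy yy_def by (intro wle_minus wle_mult weight_W F wle_sg) simp
qed

lemma initial_form_pol:
  assumes "g \<in> pol"
  obtains c h q where "hc W w g = vx ^ c * h" "h \<in> pol"
    "h \<noteq> 0 \<Longrightarrow> w = Expo (- int c) q 0"
    "\<And>e. e \<in> ks h \<Longrightarrow> ex e = 0 \<and> int l * ez e + int k * et e = q"
proof (cases "ex w \<le> 0")
  case True
  define c where "c = nat (- ex w)"
  have pol: "hc W w g \<in> pol"
    using assms by (auto simp: pol_def ks_hc)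
  have key: "ex e = int c \<and> int l * ez e + int k * et e = ez w \<and> et w = 0" if "e \<in> ks (hc W w g)" for e
    using that True by (auto simp: ks_hc c_def)
  have "nonneg (e - Expo (int c) 0 0)" if "e \<in> ks (hc W w g)" for e
    using key[OF that] polD[OF pol that] by (simp add: nonneg_def)
  with pol obtain h where h: "h \<in> pol" "hc W w g = sg (Expo (int c) 0 0) 1 * h"
    "\<And>e. e \<in> ks h \<longleftrightarrow> e + Expo (int c) 0 0 \<in> ks (hc W w g)"
    using sg_shift_pol[of "hc W w g" "Expo (int c) 0 0"] by blast
  show ?thesis
  proof (rule that[of c h "ez w"])
    show "hc W w g = vx ^ c * h"
      by (simp add: h(2) sg_power)
    show "w = Expo (- int c) (ez w) 0" if "h \<noteq> 0"
    proof -
      from that obtain e where "e \<in> ks h" by fastforce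
      then have "et w = 0" using key h(3) by blast
      then show ?thesis
        using True by (intro expo.expand) (simp add: c_def)
    qed
    fix e assume "e \<in> ks h"
    then show "ex e = 0 \<and> int l * ez e + int k * et e = ez w"
      using key[of "e + Expo (int c) 0 0"] h(3)[of e] by simp
  qed (rule h(1))
next
  case False
  then have "hc W w g = 0"
    using polD[OF assms] by (intro hc_eq_0) (auto simp: nonneg_def)
  then show ?thesis
    using that[of 0 0] by simp
qed

text \<open>If the degree in y cannot be lowered, \<open>G\<close> has pole order above
  \<open>d * b\<close>; the part of lower degree in y then lies below weight \<open>w\<close>, and
  only \<open>yy ^ Suc b * g\<close> contributes.\<close>

lemma initial_form:
  assumes "arep b f G" "wle W w G"
  obtains \<beta> c h q where "hc W w G = yh ^ \<beta> * (vx ^ c * h)" "h \<in> pol"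
    "h \<noteq> 0 \<Longrightarrow> w = Expo (int d * int \<beta> - int c) (int k * int l * int \<beta> + q) 0"
    "\<And>e. e \<in> ks h \<Longrightarrow> ex e = 0 \<and> int l * ez e + int k * et e = q"
  using assms
proof (induction b arbitrary: thesis)
  case 0
  then have "G \<in> pol" by simp
  from initial_form_pol[OF this, of w] obtain c h q where
    "hc W w G = vx ^ c * h" "h \<in> pol" "h \<noteq> 0 \<Longrightarrow> w = Expo (- int c) q 0"
    "\<And>e. e \<in> ks h \<Longrightarrow> ex e = 0 \<and> int l * ez e + int k * et e = q"
    by metis
  then show ?case
    by (intro 0(1)[of 0 c h q]) auto
next
  case (Suc b)
  show ?case
  proof (cases "wle Wx (int d * int b) G")
    case True
    then show ?thesis
      by (intro Suc.IH[OF Suc.prems(1) arep_descent[OF Suc.prems(2) True] Suc.prems(3)])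
  next
    case False
    then obtain e0 where "e0 \<in> ks G" "int d * int b < - ex e0"
      by (auto simp: wle_def Wx_def)
    then have w: "int d * int b < ex w"
      using wleD[OF Suc.prems(3), of e0] by (auto simp: less_eq_expo_def)
    obtain g f1 G1 where 1: "g \<in> pol" "arep b f1 G1" "G = yy ^ Suc b * g + G1"
      using Suc.prems(2) by auto
    have lt: "W e < w" if "e \<in> ks G1" for e
      using wleD[OF arep_wle[OF 1(2)] that] w by (auto simp: Wx_def less_expo_def)
    have "wle W w (yy ^ Suc b * g)"
      using wle_diff[OF Suc.prems(3), of G1] lt by (simp add: 1(3) wle_def less_imp_le)
    moreover define w1 where "w1 = ((+) wy ^^ Suc b) 0"
    moreover define w2 where "w2 = w - w1"
    ultimately have "wle W (w1 + w2) (yy ^ Suc b * g)" by simp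
    moreover have y: "wle W w1 (yy ^ Suc b)" "hc W w1 (yy ^ Suc b) = yh ^ Suc b"
      unfolding w1_def by (rule wle_power[OF weight_W wle_W_yy])
        (subst hc_power[OF weight_W wle_W_yy], simp add: hc_W_yy)
    moreover have "yh ^ Suc b \<noteq> 0"
      using yh_nz by simp
    ultimately have g: "wle W w2 g"
      using wle_cancel[OF weight_W] by metis
    have "hc W w G = hc W (w1 + w2) (yy ^ Suc b * g)"
      using lt hc_eq_0[of G1 W w] by (simp add: 1(3) hc_add w2_def less_imp_neq)
    also have "\<dots> = yh ^ Suc b * hc W w2 g"
      using hc_mult[OF weight_W y(1) g] y(2) by simp
    finally have eq: "hc W w G = yh ^ Suc b * hc W w2 g" .
    obtain c h q where h: "hc W w2 g = vx ^ c * h" "h \<in> pol" "h \<noteq> 0 \<Longrightarrow> w2 = Expo (- int c) q 0"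
      "\<And>e. e \<in> ks h \<Longrightarrow> ex e = 0 \<and> int l * ez e + int k * et e = q"
      using initial_form_pol[OF 1(1), of w2] by metis
    show ?thesis
    proof (rule Suc.prems(1)[of "Suc b" c h q])
      show "w = Expo (int d * int (Suc b) - int c) (int k * int l * int (Suc b) + q) 0" if "h \<noteq> 0"
      proof -
        have "w = w1 + w2" by (simp add: w2_def)
        then show ?thesis
          unfolding h(3)[OF that] w1_def funpow_add_expo
          by (simp add: wy_def algebra_simps)
      qed
    qed (use eq h in auto)
  qed
qed

end

section \<open>The leading part of a locally nilpotent derivation of the coordinate ring\<close>

locale koras_lnd = koras +
  fixes a1 a2 a3 :: laur and m :: expo and D \<delta> :: "laur \<Rightarrow> laur"
  defines "D f \<equiv> a1 * eux f + a2 * euz f + a3 * eut f"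
    and "\<delta> f \<equiv> hc W m a1 * eux f + hc W m a2 * euz f + hc W m a3 * eut f"
  assumes m: "wle W m a1" "wle W m a2" "wle W m a3"
    and m_max: "hc W m a1 \<noteq> 0 \<or> hc W m a2 \<noteq> 0 \<or> hc W m a3 \<noteq> 0"
    and arep_D: "\<And>b f G. arep b f G \<Longrightarrow> \<exists>b f. arep b f (D G)"
    and nilpotent_D: "\<And>b f G. arep b f G \<Longrightarrow> nilpotent_at D G"
begin

sublocale \<delta>: deriv \<delta>
  by standard (unfold \<delta>_def, rule derivation_eu)

text \<open>Euler fields preserve each weight, so \<open>D\<close> shifts weights by those of its
  coefficients, which are at most \<open>m\<close>.\<close>

lemma D_leading:
  assumes "wle W w f"
  shows "wle W (m + w) (D f)" "hc W (m + w) (D f) = \<delta> (hc W w f)"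
proof -
  show "wle W (m + w) (D f)"
    unfolding D_def by (intro wle_add wle_mult[OF weight_W] m wle_euler assms)
  show "hc W (m + w) (D f) = \<delta> (hc W w f)"
    unfolding D_def \<delta>_def hc_add
    using hc_mult[OF weight_W m(1) wle_euler[OF assms]] hc_mult[OF weight_W m(2) wle_euler[OF assms]]
      hc_mult[OF weight_W m(3) wle_euler[OF assms]] by (simp add: hc_euler)
qed

lemma D_iter_leading:
  assumes "wle W w f"
  shows "wle W (((+) m ^^ n) w) ((D ^^ n) f) \<and> hc W (((+) m ^^ n) w) ((D ^^ n) f) = (\<delta> ^^ n) (hc W w f)"
  by (induction n) (use assms in \<open>auto simp: D_leading\<close>)

lemma arep_D_iter: "arep b f G \<Longrightarrow> \<exists>b f. arep b f ((D ^^ n) G)"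
  by (induction n) (auto dest: arep_D)

lemma nilp_leading:
  assumes "arep b f G" "wle W w G"
  shows "\<delta>.nilp (hc W w G)"
proof -
  obtain n where "(D ^^ n) G = 0"
    using nilpotent_D[OF assms(1)] by (auto simp: nilpotent_at_def)
  then have "(\<delta> ^^ n) (hc W w G) = 0"
    using D_iter_leading[OF assms(2), of n] by simp
  then show ?thesis
    by (auto simp: nilpotent_at_def)
qed

lemma hc_sg: "hc W (W e) (sg e c) = sg e c"
  by (rule hc_hom) (auto simp del: keys_single dest: ks_sg)

lemma nilp_sg: "nonneg e \<Longrightarrow> \<delta>.nilp (sg e c)"
  using nilp_leading[OF arep_pol[OF pol_sg], of e "W e" c] hc_sg wle_sg[of W e "W e" c] by simp

lemma nilp_pol: "f \<in> pol \<Longrightarrow> \<delta>.nilp f"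
proof (induction rule: pol_induct)
  case (cst c)
  show ?case by (rule nilp_sg) (simp add: nonneg_def)
next
  case vx
  show ?case by (rule nilp_sg) (simp add: nonneg_def)
next
  case vz
  show ?case by (rule nilp_sg) (simp add: nonneg_def)
next
  case vt
  show ?case by (rule nilp_sg) (simp add: nonneg_def)
qed (auto intro: \<delta>.nilp_add \<delta>.nilp_mult)

lemma nilp_yh: "\<delta>.nilp yh"
  using nilp_leading[OF arep_monom[OF pol_1, of 1], of wy] wle_W_yy hc_W_yy by simp

lemma \<delta>_cst [simp]: "\<delta> (cst c) = 0"
  by (simp add: \<delta>_def euler_sg)

lemma \<delta>_vars: "\<delta> vx = hc W m a1 * vx" "\<delta> vz = hc W m a2 * vz" "\<delta> vt = hc W m a3 * vt"
  by (simp_all add: \<delta>_def euler_sg)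

lemma binomial_nz: "c \<noteq> 0 \<Longrightarrow> vz ^ k + cst c * vt ^ l \<noteq> 0"
proof
  assume "c \<noteq> 0" "vz ^ k + cst c * vt ^ l = 0"
  then have "lk (vz ^ k + cst c * vt ^ l) (Expo 0 (int k) 0) = 0" by simp
  then show False
    using k0 by (simp add: sg_power mult_single lookup_add lookup_single when_def)
qed

lemma not_all_ker: "\<delta> vx \<noteq> 0 \<or> \<delta> vz \<noteq> 0 \<or> \<delta> vt \<noteq> 0"
  using m_max by (auto simp: \<delta>_vars)

lemma binomial_ker:
  assumes "c \<noteq> 0" "\<delta> (vz ^ k + cst c * vt ^ l) = 0"
  shows "\<delta> vz = 0" "\<delta> vt = 0"
  using \<delta>.ker_of_power_sum[OF k l(1), of 1 "cst c" "vz ^ k + cst c * vt ^ l" vz vt]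
    assms binomial_nz[of c] by (simp_all add: nilp_pol)

text \<open>The assumption is contradictory, as \<open>yh_ker_False\<close> shows; the lemmas before
  it determine the homogeneous kernel under this assumption.\<close>

context
  assumes yh_ker: "\<delta> yh = 0"
begin

text \<open>If x is killed, so is z^k + t^l, hence z and t, and \<open>\<delta>\<close> would be 0.
  If z or t is killed, \<open>ker_of_power_sum\<close> for the other two terms of
  \<open>x ^ d * yh + z ^ k + t ^ l = 0\<close>, with \<open>yh\<close> as a coefficient, kills
  x.\<close>

lemma vars_not_ker: "\<delta> vx \<noteq> 0" "\<delta> vz \<noteq> 0" "\<delta> vt \<noteq> 0"
proof -
  have x: False if "\<delta> vx = 0"
  proof -
    have "\<delta> (- (vx ^ d * yh)) = 0"
      using that yh_ker by (simp add: \<delta>.minus \<delta>.mult \<delta>.power)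
    then have "\<delta> (vz ^ k + cst 1 * vt ^ l) = 0"
      by (simp add: x_d_yh H_def add.commute)
    then show False
      using binomial_ker[of 1] that not_all_ker by simp
  qed
  then show "\<delta> vx \<noteq> 0" by blast
  have "yh * vx ^ d + (vz ^ k + vt ^ l) = 0"
    using x_d_yh by (simp add: H_def mult.commute)
  then have eq: "yh * vx ^ d + 1 * vt ^ l = - (vz ^ k)" "yh * vx ^ d + 1 * vz ^ k = - (vt ^ l)"
    by (simp_all add: eq_neg_iff_add_eq_0 add_ac)
  show "\<delta> vz \<noteq> 0"
  proof
    assume z: "\<delta> vz = 0"
    then have "\<delta> (- (vz ^ k)) = 0" by (simp add: \<delta>.minus \<delta>.power)
    then show False
      using \<delta>.ker_of_power_sum(1)[OF d l(1) _ _ _ _ _ _ eq(1)] yh_ker yh_nz x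
      by (simp add: nilp_pol)
  qed
  show "\<delta> vt \<noteq> 0"
  proof
    assume z: "\<delta> vt = 0"
    then have "\<delta> (- (vt ^ l)) = 0" by (simp add: \<delta>.minus \<delta>.power)
    then show False
      using \<delta>.ker_of_power_sum(1)[OF d k _ _ _ _ _ _ eq(2)] yh_ker yh_nz x
      by (simp add: nilp_pol)
  qed
qed

lemma ker_factor_pol: "\<delta> (f * g) = 0 \<Longrightarrow> f * g \<noteq> 0 \<Longrightarrow> f \<in> pol \<Longrightarrow> g \<in> pol \<Longrightarrow> \<delta> f = 0"
  by (rule \<delta>.ker_factor[of f g]) (auto intro: nilp_pol)

text \<open>The kernel is factorially closed and contains none of x, z, t and the binomials z^k + c
  t^l, so only a constant and a power of \<open>yh\<close> remain.\<close>

lemma ker_leading: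
  assumes G: "arep b f G" "wle W w G" and nz: "hc W w G \<noteq> 0" and ker: "\<delta> (hc W w G) = 0"
  obtains \<beta> c where "hc W w G = cst c * yh ^ \<beta>" "c \<noteq> 0" "w = Expo (int d * int \<beta>) (int k * int l * int \<beta>) 0"
proof -
  obtain \<beta> c h q where eq: "hc W w G = yh ^ \<beta> * (vx ^ c * h)" and h: "h \<in> pol"
    and w: "h \<noteq> 0 \<Longrightarrow> w = Expo (int d * int \<beta> - int c) (int k * int l * int \<beta> + q) 0"
    and keys: "\<And>e. e \<in> ks h \<Longrightarrow> ex e = 0 \<and> int l * ez e + int k * et e = q"
    using initial_form[OF G] by metis
  have h0: "h \<noteq> 0" using nz eq by auto
  have xh: "vx ^ c * h \<in> pol" "vx ^ c * h \<noteq> 0"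
    by (intro pol_mult pol_power pol_vars h) (use h0 in auto)
  have "\<delta> (vx ^ c * h * yh ^ \<beta>) = 0"
    using ker by (simp add: eq mult.commute)
  then have xh_ker: "\<delta> (vx ^ c * h) = 0"
    by (rule \<delta>.ker_factor) (use xh yh_nz nilp_yh in \<open>auto intro: nilp_pol \<delta>.nilp_power\<close>)
  have c: "c = 0"
  proof (rule ccontr)
    assume "c \<noteq> 0"
    then have eq': "vx ^ c * h = vx * (vx ^ (c - 1) * h)"
      by (simp add: power_eq_if)
    have "\<delta> vx = 0"
      by (rule ker_factor_pol[OF xh_ker[unfolded eq'] xh(2)[unfolded eq']]) (intro pol_mult pol_power pol_vars h)+
    then show False using vars_not_ker by blast
  qed
  then have h_ker: "\<delta> h = 0" using xh_ker by simp
  have "q \<ge> 0"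
  proof -
    from h0 obtain e where "e \<in> ks h" by fastforce
    then show ?thesis
      using keys[of e] polD[OF h, of e] by (auto simp: nonneg_def)
  qed
  have "q = 0"
  proof (rule ccontr)
    assume "q \<noteq> 0"
    with \<open>q \<ge> 0\<close> have "q > 0" by simp
    with h h0 keys obtain g where g: "g \<in> pol" and
      *: "h = vz * g \<or> h = vt * g \<or> (\<exists>c. c \<noteq> 0 \<and> h = (vz ^ k + cst c * vt ^ l) * g)"
      using quasi_homogeneous_factor[OF k0 l(2) cop, of h q] by blast
    have bin: "vz ^ k + cst c * vt ^ l \<in> pol" for c
      by (intro pol_add pol_mult pol_power pol_vars pol_cst)
    from * show False
      using ker_factor_pol[of _ g] h_ker h0 g vars_not_ker binomial_ker(1) bin pol_vars by metis
  qed
  have "e = 0" if e: "e \<in> ks h" for e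
  proof -
    have "int l * ez e = 0 \<and> int k * et e = 0"
      using keys[OF e] polD[OF h e] \<open>q = 0\<close> by (auto simp: nonneg_def add_nonneg_eq_0_iff)
    then show ?thesis
      using keys[OF e] k0 l by (intro expo.expand) auto
  qed
  then have "h = cst (lk h 0)"
    by (intro poly_mapping_eqI) (auto simp: lookup_single when_def in_keys_iff)
  moreover from this have "lk h 0 \<noteq> 0" using h0 by (metis single_zero)
  ultimately show ?thesis
    using that[of "lk h 0" \<beta>] eq c w[OF h0] \<open>q = 0\<close> by (simp add: mult.commute)
qed

text \<open>The last nonzero iterate lies in the kernel, so it is a power of \<open>yh\<close> up to
  a constant; comparing weights gives two equations for \<open>m\<close>.\<close>

lemma nil_degree_leading:
  assumes g: "g \<in> pol" "\<And>e. e \<in> ks g \<Longrightarrow> W e = Expo a b 0" and n: "nil_degree \<delta> g n"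
  obtains \<beta> c where "(\<delta> ^^ n) g = cst c * yh ^ \<beta>" "c \<noteq> 0"
    "a + int n * ex m = int d * int \<beta>" "b + int n * ez m = int k * int l * int \<beta>"
proof -
  let ?w = "Expo a b 0"
  have g': "wle W ?w g" "hc W ?w g = g"
    using g(2) by (auto simp: wle_def intro!: hc_hom)
  obtain b' f' where b': "arep b' f' ((D ^^ n) g)"
    using arep_D_iter[OF arep_pol[OF g(1), of 0], of n] by blast
  let ?v = "((+) m ^^ n) ?w"
  have *: "wle W ?v ((D ^^ n) g)" "hc W ?v ((D ^^ n) g) = (\<delta> ^^ n) g"
    using D_iter_leading[OF g'(1), of n] g'(2) by auto
  obtain \<beta> c where "hc W ?v ((D ^^ n) g) = cst c * yh ^ \<beta>" "c \<noteq> 0"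
    and v: "?v = Expo (int d * int \<beta>) (int k * int l * int \<beta>) 0"
    using ker_leading[OF b' *(1)] * n by (metis nil_degree_def \<delta>.iter_nil_degree_ker)
  then show ?thesis
    using that[of c \<beta>] * v by (simp add: funpow_add_expo)
qed

text \<open>The iterates of x show that \<open>m\<close> is linearly independent of the weight (d, k
  l) of \<open>yh\<close>. So bihomogeneous polynomials of weight (0, k l) all have the same degree,
  but a combination of z^k and t^l can be made to have a smaller one.\<close>

lemma yh_ker_False: False
proof -
  have dgx: "\<exists>n. nil_degree \<delta> f n" if "f \<in> pol" "f \<noteq> 0" for f
    using that nilp_pol \<delta>.nil_degree_exists by blast
  obtain nx where nx: "nil_degree \<delta> vx nx" using dgx pol_vars by (metis sg_nz one_neq_zero)
  obtain nz where nz: "nil_degree \<delta> vz nz" using dgx pol_vars by (metis sg_nz one_neq_zero)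
  obtain nt where nt: "nil_degree \<delta> vt nt" using dgx pol_vars by (metis sg_nz one_neq_zero)
  have "W e = Expo (- 1) 0 0" if "e \<in> ks vx" for e
    using that by (auto simp: W_def dest: ks_sg)
  with nx obtain \<beta> where \<beta>: "- 1 + int nx * ex m = int d * int \<beta>" "0 + int nx * ez m = int k * int l * int \<beta>"
    using nil_degree_leading[of vx "- 1" 0 nx] pol_vars(1) by blast
  have indep: "N = 0" if N: "int N * ex m = int d * s" "int N * ez m = int k * int l * s" for N s
  proof -
    have "int k * int l * (int nx * s) = int nx * (int N * ez m)"
      unfolding N(2) by (simp add: algebra_simps)
    also have "\<dots> = int N * (0 + int nx * ez m)"
      by (simp add: algebra_simps)
    also have "\<dots> = int k * int l * (int N * int \<beta>)"
      unfolding \<beta>(2) by (simp add: algebra_simps)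
    finally have eq: "int nx * s = int N * int \<beta>"
      using k0 l by simp
    have "int N * (- 1 + int nx * ex m) = - int N + int nx * (int N * ex m)"
      by (simp add: algebra_simps)
    also have "\<dots> = - int N + int d * (int nx * s)"
      unfolding N(1) by (simp add: algebra_simps)
    finally show ?thesis
      unfolding \<beta>(1) eq by (simp add: algebra_simps)
  qed
  have Wz: "W e = Expo 0 (int k * int l) 0" if "e \<in> ks (vz ^ k)" for e
    using that by (auto simp: W_def sg_power dest: ks_sg)
  have Wt: "W e = Expo 0 (int k * int l) 0" if "e \<in> ks (vt ^ l)" for e
    using that by (auto simp: W_def sg_power dest: ks_sg)
  have dz: "nil_degree \<delta> (vz ^ k) (k * nz)" and dt: "nil_degree \<delta> (vt ^ l) (l * nt)"
    using nz nt \<delta>.nil_degree_power by auto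
  obtain \<beta>1 c1 where 1: "(\<delta> ^^ (k * nz)) (vz ^ k) = cst c1 * yh ^ \<beta>1" "c1 \<noteq> 0"
    "0 + int (k * nz) * ex m = int d * int \<beta>1" "int k * int l + int (k * nz) * ez m = int k * int l * int \<beta>1"
    using nil_degree_leading[OF pol_power[OF pol_vars(2)] Wz dz] by blast
  obtain \<beta>2 c2 where 2: "(\<delta> ^^ (l * nt)) (vt ^ l) = cst c2 * yh ^ \<beta>2" "c2 \<noteq> 0"
    "0 + int (l * nt) * ex m = int d * int \<beta>2" "int k * int l + int (l * nt) * ez m = int k * int l * int \<beta>2"
    using nil_degree_leading[OF pol_power[OF pol_vars(3)] Wt dt] by blast
  have sub: "int (M - N) * ex m = int d * (int B - int C) \<and> int (M - N) * ez m = int k * int l * (int B - int C)"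
    if "N \<le> M" "0 + int M * ex m = int d * int B" "0 + int N * ex m = int d * int C"
      "int k * int l + int M * ez m = int k * int l * int B"
      "int k * int l + int N * ez m = int k * int l * int C" for M N B C
    using that by (simp add: algebra_simps of_nat_diff)
  have "k * nz - l * nt = 0" "l * nt - k * nz = 0"
    using indep sub[OF _ 1(3) 2(3) 1(4) 2(4)] sub[OF _ 2(3) 1(3) 2(4) 1(4)] nat_le_linear
    by (metis diff_is_0_eq)+
  then have n: "k * nz = l * nt" by simp
  then have "int k * int l * int \<beta>1 = int k * int l * int \<beta>2"
    using 1(4) 2(4) by metis
  then have \<beta>12: "\<beta>1 = \<beta>2" using k0 l by simp
  \<comment> \<open>With these constants the iterates of order \<open>k * nz\<close> cancel:
    \<open>g\<close> has smaller degree than \<open>vz ^ k\<close> but the same weight.\<close>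
  define g where "g = cst c2 * vz ^ k - cst c1 * vt ^ l"
  have gpol: "g \<in> pol" unfolding g_def by (intro pol_diff pol_mult pol_power pol_vars pol_cst)
  have "lk g (Expo 0 (int k) 0) \<noteq> 0"
    using k0 2(2) by (simp add: g_def sg_power mult_single lookup_minus lookup_single when_def)
  then have "g \<noteq> 0" by auto
  with gpol obtain N where N: "nil_degree \<delta> g N" using dgx by blast
  have cst_iter: "(\<delta> ^^ n) (cst c * f) = cst c * (\<delta> ^^ n) f" for n c f
    by (induction n) (auto simp: \<delta>.mult)
  have "(\<delta> ^^ (k * nz)) g = (\<delta> ^^ (k * nz)) (cst c2 * vz ^ k) + - (\<delta> ^^ (k * nz)) (cst c1 * vt ^ l)"
    unfolding g_def diff_conv_add_uminus \<delta>.iter_add \<delta>.iter_minus ..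
  also have "\<dots> = 0"
    unfolding cst_iter 1(1) using 2(1) n \<beta>12 by (simp add: algebra_simps)
  finally have lt: "N < k * nz"
    using \<delta>.nil_degree_less[OF N] by blast
  have Wg: "W e = Expo 0 (int k * int l) 0" if "e \<in> ks g" for e
    using that unfolding g_def sg_power mult_single
    by (auto simp: W_def dest!: ks_diff ks_sg simp del: keys_single)
  obtain B c where "0 + int N * ex m = int d * int B" "int k * int l + int N * ez m = int k * int l * int B"
    using nil_degree_leading[OF gpol Wg N] by blast
  from sub[OF less_imp_le[OF lt] 1(3) this(1) 1(4) this(2)] have "k * nz - N = 0"
    using indep by blast
  then show False using lt by simp
qed

end

theorem ker_subset_pol:
  assumes G: "arep b f G" "D G = 0"
  shows "G \<in> pol"
proof (rule ccontr)
  assume "G \<notin> pol"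
  then have "\<not> wle Wx 0 G" using arep_wle_0_pol G by blast
  then obtain e where e: "e \<in> ks G" "ex e < 0"
    by (auto simp: wle_def Wx_def)
  then have "G \<noteq> 0" by auto
  then obtain w where w: "wle W w G" "hc W w G \<noteq> 0"
    by (rule top_weight)
  have "ex w > 0"
    using wleD[OF w(1) e(1)] e(2) by (auto simp: less_eq_expo_def)
  have ker: "\<delta> (hc W w G) = 0"
    using D_leading(2)[OF w(1)] G by simp
  obtain \<beta> c h q where eq: "hc W w G = yh ^ \<beta> * (vx ^ c * h)" and h: "h \<in> pol"
    and wq: "h \<noteq> 0 \<Longrightarrow> w = Expo (int d * int \<beta> - int c) (int k * int l * int \<beta> + q) 0"
    using initial_form[OF G(1) w(1)] by metis
  have "h \<noteq> 0" using w eq by auto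
  \<comment> \<open>A positive pole order \<open>d * \<beta> - c\<close> requires a factor
    \<open>yh\<close>.\<close>
  with wq \<open>ex w > 0\<close> have "\<beta> \<noteq> 0" by (cases \<beta>) auto
  then have eq': "hc W w G = yh * (yh ^ (\<beta> - 1) * (vx ^ c * h))"
    by (simp add: eq power_eq_if)
  have "\<delta> yh = 0"
  proof (rule \<delta>.ker_factor[OF ker[unfolded eq']])
    show "yh ^ (\<beta> - 1) * (vx ^ c * h) \<noteq> 0"
      using w eq' by auto
    show "\<delta>.nilp (yh ^ (\<beta> - 1) * (vx ^ c * h))"
      using h by (intro \<delta>.nilp_mult \<delta>.nilp_power nilp_yh nilp_pol pol_vars)
  qed (use yh_nz nilp_yh in auto)
  then show False by (rule yh_ker_False)
qed

end

subsection \<open>Polynomial functions\<close>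

text \<open>Exponent vectors may repeat in the family, whereas \<open>polynomial_fun\<close> sums
  over a set of them, so coefficients are collected.\<close>

lemma polynomial_funI:
  fixes c :: "'i \<Rightarrow> complex" and e :: "'i \<Rightarrow> 'n :: finite \<Rightarrow> nat"
  assumes "finite I" "\<And>v. P v = (\<Sum>i\<in>I. c i * (\<Prod>j\<in>UNIV. (v $ j) ^ e i j))"
  shows "polynomial_fun P"
  unfolding polynomial_fun_def
proof (intro exI conjI allI)
  show "finite (e ` I)" using assms(1) by simp
  fix v
  have "P v = (\<Sum>y\<in>e ` I. \<Sum>i\<in>{i \<in> I. e i = y}. c i * (\<Prod>j\<in>UNIV. (v $ j) ^ e i j))"
    unfolding assms(2) using assms(1) by (intro sum.group[symmetric]) auto
  also have "\<dots> = (\<Sum>y\<in>e ` I. (\<Sum>i\<in>{i \<in> I. e i = y}. c i) * (\<Prod>j\<in>UNIV. (v $ j) ^ y j))"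
    by (intro sum.cong) (auto simp: sum_distrib_right)
  finally show "P v = (\<Sum>y\<in>e ` I. (\<Sum>i\<in>{i \<in> I. e i = y}. c i) * (\<Prod>j\<in>UNIV. (v $ j) ^ y j))" .
qed

lemma polynomial_fun_const: "polynomial_fun (\<lambda>v. a)"
  by (rule polynomial_funI[of "{()}" _ "\<lambda>_. a" "\<lambda>_ _. 0"]) auto

lemma polynomial_fun_coord: "polynomial_fun (\<lambda>v. v $ j)"
proof (rule polynomial_funI[of "{()}" _ "\<lambda>_. 1" "\<lambda>_ i. if i = j then 1 else 0"])
  fix v :: "complex ^ 'a"
  have "(\<Prod>i\<in>UNIV. (v $ i) ^ (if i = j then 1 else 0)) = (\<Prod>i\<in>UNIV. if i = j then v $ i else 1)"
    by (intro prod.cong) auto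
  then show "v $ j = (\<Sum>u\<in>{()}. 1 * (\<Prod>i\<in>UNIV. (v $ i) ^ (if i = j then 1 else 0)))"
    by simp
qed simp

lemma polynomial_fun_add:
  assumes "polynomial_fun P" "polynomial_fun Q"
  shows "polynomial_fun (\<lambda>v. P v + Q v)"
proof -
  obtain S c where S: "finite S" "\<And>v. P v = (\<Sum>e\<in>S. c e * (\<Prod>i\<in>UNIV. (v $ i) ^ e i))"
    using assms(1) unfolding polynomial_fun_def by blast
  obtain T b where T: "finite T" "\<And>v. Q v = (\<Sum>e\<in>T. b e * (\<Prod>i\<in>UNIV. (v $ i) ^ e i))"
    using assms(2) unfolding polynomial_fun_def by blast
  show ?thesis
    by (rule polynomial_funI[of "S <+> T" _ "case_sum c b" "case_sum (\<lambda>e. e) (\<lambda>e. e)"])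
      (simp_all add: S T sum.Plus)
qed

lemma polynomial_fun_mult:
  assumes "polynomial_fun P" "polynomial_fun Q"
  shows "polynomial_fun (\<lambda>v. P v * Q v)"
proof -
  obtain S c where S: "finite S" "\<And>v. P v = (\<Sum>e\<in>S. c e * (\<Prod>i\<in>UNIV. (v $ i) ^ e i))"
    using assms(1) unfolding polynomial_fun_def by blast
  obtain T b where T: "finite T" "\<And>v. Q v = (\<Sum>e\<in>T. b e * (\<Prod>i\<in>UNIV. (v $ i) ^ e i))"
    using assms(2) unfolding polynomial_fun_def by blast
  show ?thesis
  proof (rule polynomial_funI[of "S \<times> T" _ "\<lambda>(e, e'). c e * b e'" "\<lambda>(e, e') i. e i + e' i"])
    show "P v * Q v = (\<Sum>p\<in>S \<times> T. (case p of (e, e') \<Rightarrow> c e * b e') *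
        (\<Prod>i\<in>UNIV. (v $ i) ^ (case p of (e, e') \<Rightarrow> \<lambda>i. e i + e' i) i))" for v
      unfolding S(2) T(2) sum_product sum.cartesian_product
      by (intro sum.cong) (auto simp: power_add prod.distrib)
  qed (use S T in simp)
qed

lemma polynomial_fun_power: "polynomial_fun P \<Longrightarrow> polynomial_fun (\<lambda>v. P v ^ n)"
  by (induction n) (auto intro: polynomial_fun_const polynomial_fun_mult)

lemma polynomial_fun_sum:
  "(\<And>i. i \<in> I \<Longrightarrow> polynomial_fun (P i)) \<Longrightarrow> polynomial_fun (\<lambda>v. \<Sum>i\<in>I. P i v)"
  by (induction I rule: infinite_finite_induct) (auto intro: polynomial_fun_const polynomial_fun_add)

lemma polynomial_fun_induct [consumes 1, case_names const coord add mult]: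
  assumes "polynomial_fun P" and const: "\<And>a. Q (\<lambda>v. a)" and coord: "\<And>j. Q (\<lambda>v. v $ j)"
    and add: "\<And>f g. Q f \<Longrightarrow> Q g \<Longrightarrow> Q (\<lambda>v. f v + g v)"
    and mult: "\<And>f g. Q f \<Longrightarrow> Q g \<Longrightarrow> Q (\<lambda>v. f v * g v)"
  shows "Q P"
proof -
  have pow: "Q (\<lambda>v. f v ^ n)" if "Q f" for f n
    by (induction n) (use that const mult in auto)
  have prod: "Q (\<lambda>v. \<Prod>i\<in>I. (v $ i) ^ e i)" for e :: "'a \<Rightarrow> nat" and I
    by (induction I rule: infinite_finite_induct) (use const mult pow coord in auto)
  obtain S c where S: "finite S" "\<And>v. P v = (\<Sum>e\<in>S. c e * (\<Prod>i\<in>UNIV. (v $ i) ^ e i))"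
    using assms(1) unfolding polynomial_fun_def by blast
  have "Q (\<lambda>v. \<Sum>e\<in>S. c e * (\<Prod>i\<in>UNIV. (v $ i) ^ e i))"
    using S(1) by (induction S) (use const add mult prod in auto)
  then show ?thesis
    unfolding S(2)[symmetric] .
qed

lemma polynomial_fun_ev:
  "g \<in> pol \<Longrightarrow> polynomial_fun (\<lambda>v :: complex ^ 4. evv v g)"
  by (induction rule: pol_induct)
    (auto intro: polynomial_fun_const polynomial_fun_coord polynomial_fun_add polynomial_fun_mult)

lemma polynomial_fun_compose:
  assumes f: "polynomial_fun f" and \<phi>: "regular_map Y Z \<phi>"
  obtains g where "polynomial_fun g" "\<And>v. v \<in> Y \<Longrightarrow> f (\<phi> v) = g v"
proof -
  have "\<exists>g. polynomial_fun g \<and> (\<forall>v\<in>Y. f (\<phi> v) = g v)"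
    using f
  proof (induction rule: polynomial_fun_induct)
    case (const a)
    then show ?case using polynomial_fun_const by blast
  next
    case (coord j)
    then show ?case using \<phi> by (simp add: regular_map_def)
  next
    case (add f g)
    then show ?case using polynomial_fun_add by metis
  next
    case (mult f g)
    then show ?case using polynomial_fun_mult by metis
  qed
  then show ?thesis using that by blast
qed

subsection \<open>Algebraic flows\<close>

text \<open>Coefficients are 0 from \<open>n\<close> on, so that expansions of different lengths can
  be added and multiplied.\<close>

definition poly_family ::
  "(complex ^ 'n) set \<Rightarrow> (complex \<Rightarrow> complex ^ 'n \<Rightarrow> complex) \<Rightarrow> bool" where
  "poly_family Y h \<longleftrightarrow> (\<exists>n c. (\<forall>i. polynomial_fun (c i)) \<and> (\<forall>i\<ge>n. c i = (\<lambda>v. 0)) \<and>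
     (\<forall>v\<in>Y. \<forall>s. h s v = (\<Sum>i<n. c i v * s ^ i)))"

lemma sum_extend_zero:
  fixes c :: "nat \<Rightarrow> complex"
  shows "n \<le> m \<Longrightarrow> (\<And>i. i \<ge> n \<Longrightarrow> c i = 0) \<Longrightarrow> (\<Sum>i<n. c i * s ^ i) = (\<Sum>i<m. c i * s ^ i)"
  by (rule sum.mono_neutral_left) auto

lemma poly_family_const: "polynomial_fun f \<Longrightarrow> poly_family Y (\<lambda>s. f)"
  unfolding poly_family_def
  by (rule exI[of _ 1], rule exI[of _ "\<lambda>i. if i = 0 then f else (\<lambda>v. 0)"])
    (auto intro: polynomial_fun_const)

lemma poly_family_id: "poly_family Y (\<lambda>s v. s)"
  unfolding poly_family_def
  by (rule exI[of _ 2], rule exI[of _ "\<lambda>i v. if i = 1 then 1 else 0"])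
    (auto simp: numeral_2_eq_2 intro: polynomial_fun_const)

lemma poly_family_add:
  assumes "poly_family Y g" "poly_family Y h"
  shows "poly_family Y (\<lambda>s v. g s v + h s v)"
proof -
  obtain m b where b: "\<And>i. polynomial_fun (b i)" "\<And>i. i \<ge> m \<Longrightarrow> b i = (\<lambda>v. 0)"
    "\<And>v s. v \<in> Y \<Longrightarrow> g s v = (\<Sum>i<m. b i v * s ^ i)"
    using assms(1) unfolding poly_family_def by blast
  obtain n c where c: "\<And>i. polynomial_fun (c i)" "\<And>i. i \<ge> n \<Longrightarrow> c i = (\<lambda>v. 0)"
    "\<And>v s. v \<in> Y \<Longrightarrow> h s v = (\<Sum>i<n. c i v * s ^ i)"
    using assms(2) unfolding poly_family_def by blast
  show ?thesis
    unfolding poly_family_def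
  proof (rule exI[of _ "max m n"], rule exI[of _ "\<lambda>i v. b i v + c i v"], intro conjI allI ballI impI)
    show "polynomial_fun (\<lambda>v. b i v + c i v)" for i
      using b c polynomial_fun_add by blast
    fix v s assume v: "v \<in> Y"
    show "g s v + h s v = (\<Sum>i<max m n. (b i v + c i v) * s ^ i)"
      using sum_extend_zero[of m "max m n" "\<lambda>i. b i v" s] sum_extend_zero[of n "max m n" "\<lambda>i. c i v" s]
      by (simp add: b(2,3) c(2,3) v sum.distrib algebra_simps)
  qed (use b c in auto)
qed

lemma poly_family_mult:
  assumes "poly_family Y g" "poly_family Y h"
  shows "poly_family Y (\<lambda>s v. g s v * h s v)"
proof -
  obtain m b where b: "\<And>i. polynomial_fun (b i)" "\<And>i. i \<ge> m \<Longrightarrow> b i = (\<lambda>v. 0)"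
    "\<And>v s. v \<in> Y \<Longrightarrow> g s v = (\<Sum>i<m. b i v * s ^ i)"
    using assms(1) unfolding poly_family_def by blast
  obtain n c where c: "\<And>i. polynomial_fun (c i)" "\<And>i. i \<ge> n \<Longrightarrow> c i = (\<lambda>v. 0)"
    "\<And>v s. v \<in> Y \<Longrightarrow> h s v = (\<Sum>i<n. c i v * s ^ i)"
    using assms(2) unfolding poly_family_def by blast
  show ?thesis
    unfolding poly_family_def
  proof (rule exI[of _ "Suc (m + n)"], rule exI[of _ "\<lambda>i v. \<Sum>j\<le>i. b j v * c (i - j) v"],
      intro conjI allI ballI impI)
    show "polynomial_fun (\<lambda>v. \<Sum>j\<le>i. b j v * c (i - j) v)" for i
      using b c by (intro polynomial_fun_sum polynomial_fun_mult) auto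
    show "(\<lambda>v. \<Sum>j\<le>i. b j v * c (i - j) v) = (\<lambda>v. 0)" if "i \<ge> Suc (m + n)" for i
    proof (rule ext, rule sum.neutral, rule ballI)
      fix v j
      show "b j v * c (i - j) v = 0"
        using b(2)[of j] c(2)[of "i - j"] that by (cases "j \<ge> m") auto
    qed
    fix v s assume v: "v \<in> Y"
    have "g s v * h s v = (\<Sum>i\<le>m. b i v * s ^ i) * (\<Sum>i\<le>n. c i v * s ^ i)"
      using sum_extend_zero[of m "Suc m" "\<lambda>i. b i v" s] sum_extend_zero[of n "Suc n" "\<lambda>i. c i v" s]
      by (simp add: b(2,3) c(2,3) v lessThan_Suc_atMost)
    also have "\<dots> = (\<Sum>r\<le>m + n. (\<Sum>j\<le>r. b j v * c (r - j) v) * s ^ r)"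
      using b(2) c(2) by (intro polynomial_product) auto
    finally show "g s v * h s v = (\<Sum>i<Suc (m + n). (\<Sum>j\<le>i. b j v * c (i - j) v) * s ^ i)"
      by (simp only: lessThan_Suc_atMost)
  qed
qed

lemma poly_family_power: "poly_family Y h \<Longrightarrow> poly_family Y (\<lambda>s v. h s v ^ n)"
  by (induction n) (auto intro: poly_family_mult poly_family_const polynomial_fun_const)

lemma poly_family_sum:
  "(\<And>i. i \<in> I \<Longrightarrow> poly_family Y (h i)) \<Longrightarrow> poly_family Y (\<lambda>s v. \<Sum>i\<in>I. h i s v)"
  by (induction I rule: infinite_finite_induct)
    (auto intro: poly_family_add poly_family_const polynomial_fun_const)

lemma poly_family_compose:
  assumes "polynomial_fun f" "\<And>j. poly_family Y (\<lambda>s v. \<alpha> s v $ j)"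
  shows "poly_family Y (\<lambda>s v. f (\<alpha> s v))"
  using assms(1)
proof (induction rule: polynomial_fun_induct)
  case (const a)
  then show ?case by (intro poly_family_const polynomial_fun_const)
qed (use assms(2) poly_family_add poly_family_mult in auto)

text \<open>An algebraic action of the additive group; the last clause is the coaction on regular
  functions.\<close>

definition alg_flow :: "(complex ^ 'n) set \<Rightarrow> (complex \<Rightarrow> complex ^ 'n \<Rightarrow> complex ^ 'n) \<Rightarrow> bool" where
  "alg_flow Y \<alpha> \<longleftrightarrow> (\<forall>v\<in>Y. \<forall>s. \<alpha> s v \<in> Y) \<and> (\<forall>v\<in>Y. \<alpha> 0 v = v) \<and>
     (\<forall>v\<in>Y. \<forall>s u. \<alpha> (s + u) v = \<alpha> s (\<alpha> u v)) \<and>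
     (\<forall>f. polynomial_fun f \<longrightarrow> poly_family Y (\<lambda>s v. f (\<alpha> s v)))"

lemma alg_flow_conj:
  assumes \<alpha>: "alg_flow Y \<alpha>" and \<phi>: "regular_map Y Y \<phi>" and \<psi>: "regular_map Y Y \<psi>"
    and inv: "\<forall>v\<in>Y. \<psi> (\<phi> v) = v" "\<forall>v\<in>Y. \<phi> (\<psi> v) = v"
  shows "alg_flow Y (\<lambda>s v. \<psi> (\<alpha> s (\<phi> v)))"
  unfolding alg_flow_def
proof (intro conjI ballI allI impI)
  fix f :: "complex ^ 'a \<Rightarrow> complex" assume "polynomial_fun f"
  then obtain g where g: "polynomial_fun g" "\<And>v. v \<in> Y \<Longrightarrow> f (\<psi> v) = g v"
    using polynomial_fun_compose[OF _ \<psi>] by metis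
  obtain n c where c: "\<And>i. polynomial_fun (c i)" "\<And>i. i \<ge> n \<Longrightarrow> c i = (\<lambda>v. 0)"
    "\<And>v s. v \<in> Y \<Longrightarrow> g (\<alpha> s v) = (\<Sum>i<n. c i v * s ^ i)"
    using \<alpha> g(1) unfolding alg_flow_def poly_family_def by metis
  have "\<exists>h. polynomial_fun h \<and> (\<forall>v\<in>Y. c i (\<phi> v) = h v) \<and> (i \<ge> n \<longrightarrow> h = (\<lambda>v. 0))" for i
  proof (cases "i \<ge> n")
    case True
    then show ?thesis
      using c(2) by (intro exI[of _ "\<lambda>v. 0"]) (auto intro: polynomial_fun_const)
  next
    case False
    then show ?thesis
      using polynomial_fun_compose[OF c(1)[of i] \<phi>] by metis
  qed
  then obtain h where h: "\<And>i. polynomial_fun (h i)" "\<And>i v. v \<in> Y \<Longrightarrow> c i (\<phi> v) = h i v"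
    "\<And>i. i \<ge> n \<Longrightarrow> h i = (\<lambda>v. 0)" by metis
  show "poly_family Y (\<lambda>s v. f (\<psi> (\<alpha> s (\<phi> v))))"
    unfolding poly_family_def
  proof (rule exI[of _ n], rule exI[of _ h], intro conjI allI ballI impI)
    fix v s assume v: "v \<in> Y"
    then have "\<phi> v \<in> Y" "\<alpha> s (\<phi> v) \<in> Y"
      using \<alpha> \<phi> by (auto simp: alg_flow_def regular_map_def)
    then show "f (\<psi> (\<alpha> s (\<phi> v))) = (\<Sum>i<n. h i v * s ^ i)"
      using g(2) c(3) h(2)[OF v] by simp
  qed (use h in auto)
qed (use \<alpha> \<phi> \<psi> inv in \<open>auto simp: alg_flow_def regular_map_def\<close>)

section \<open>The derivation generated by an algebraic flow\<close>

locale koras_flow = koras +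
  fixes \<alpha> :: "complex \<Rightarrow> complex ^ 4 \<Rightarrow> complex ^ 4"
  assumes \<alpha>: "alg_flow X \<alpha>"
begin

lemma \<alpha>_X: "v \<in> X \<Longrightarrow> \<alpha> s v \<in> X" and \<alpha>_0: "v \<in> X \<Longrightarrow> \<alpha> 0 v = v"
  and \<alpha>_add: "v \<in> X \<Longrightarrow> \<alpha> (s + u) v = \<alpha> s (\<alpha> u v)"
  using \<alpha> by (auto simp: alg_flow_def)

definition lie :: "(complex ^ 4 \<Rightarrow> complex) \<Rightarrow> (complex ^ 4 \<Rightarrow> complex) \<Rightarrow> bool" where
  "lie p p' \<longleftrightarrow> polynomial_fun p' \<and> (\<forall>v\<in>X. \<forall>s. ((\<lambda>s. p (\<alpha> s v)) has_field_derivative p' (\<alpha> s v)) (at s))"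

text \<open>The derivative along the flow is the coefficient of \<open>s\<close>. Its own expansion
  has one term fewer, which is the source of nilpotency in \<open>D_nilpotent\<close>.\<close>

lemma lie_exists:
  assumes p: "polynomial_fun p"
    and c: "\<And>i. polynomial_fun (c i)" "\<And>i. i \<ge> n \<Longrightarrow> c i = (\<lambda>v. 0)"
      "\<And>v s. v \<in> X \<Longrightarrow> p (\<alpha> s v) = (\<Sum>i<n. c i v * s ^ i)"
  shows "lie p (c 1)"
    and "\<And>v s. v \<in> X \<Longrightarrow> c 1 (\<alpha> s v) = (\<Sum>i<n - 1. of_nat (Suc i) * c (Suc i) v * s ^ i)"
proof -
  have D: "((\<lambda>s. \<Sum>i<n. c i v * s ^ i) has_field_derivative (\<Sum>i<n - 1. of_nat (Suc i) * c (Suc i) v * s ^ i)) (at s)"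
    for v s
  proof -
    have "((\<lambda>s. \<Sum>i<n. c i v * s ^ i) has_field_derivative (\<Sum>i<n. c i v * (of_nat i * s ^ (i - 1)))) (at s)"
      by (rule derivative_eq_intros refl)+ (simp add: mult_ac)
    moreover have "(\<Sum>i<n. c i v * (of_nat i * s ^ (i - 1))) = (\<Sum>i<n - 1. of_nat (Suc i) * c (Suc i) v * s ^ i)"
    proof (cases n)
      case (Suc m)
      show ?thesis
        unfolding Suc by (subst sum.lessThan_Suc_shift) (simp add: algebra_simps del: of_nat_Suc)
    qed simp
    ultimately show ?thesis by simp
  qed
  have deriv0: "(\<Sum>i<n - 1. of_nat (Suc i) * c (Suc i) v * 0 ^ i) = c 1 v" for v
  proof (cases "n \<le> 1")
    case True
    then show ?thesis using c(2)[of 1] by simp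
  next
    case False
    then obtain m where "n - 1 = Suc m" by (metis diff_is_0_eq old.nat.exhaust)
    then show ?thesis by (simp add: sum.lessThan_Suc_shift)
  qed
  have D1: "((\<lambda>s. p (\<alpha> s v)) has_field_derivative c 1 (\<alpha> s v)) (at s)" if v: "v \<in> X" for v s
  proof -
    have "((\<lambda>u. p (\<alpha> u (\<alpha> s v))) has_field_derivative c 1 (\<alpha> s v)) (at 0)"
      using D[of "\<alpha> s v" 0] unfolding c(3)[OF \<alpha>_X[OF v]] deriv0 .
    \<comment> \<open>The group law carries the derivative at time 0 to time
      \<open>s\<close>.\<close>
    then have "((\<lambda>u. p (\<alpha> (u + s) v)) has_field_derivative c 1 (\<alpha> s v)) (at 0)"
      by (simp add: \<alpha>_add v)
    then show ?thesis
      using DERIV_shift[of "\<lambda>s. p (\<alpha> s v)" "c 1 (\<alpha> s v)" 0 s] by simp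
  qed
  then show "lie p (c 1)"
    using c(1) by (simp add: lie_def)
  fix v s assume v: "v \<in> X"
  show "c 1 (\<alpha> s v) = (\<Sum>i<n - 1. of_nat (Suc i) * c (Suc i) v * s ^ i)"
    using DERIV_unique[OF D1[OF v] ] D[of v s] unfolding c(3)[OF v] by blast
qed

lemma flow_coeffs:
  assumes "polynomial_fun p"
  shows "\<exists>n c. (\<forall>i. polynomial_fun (c i)) \<and> (\<forall>i\<ge>n. c i = (\<lambda>v. 0)) \<and>
    (\<forall>v\<in>X. \<forall>s. p (\<alpha> s v) = (\<Sum>i<n. c i v * s ^ i))"
  using \<alpha> assms unfolding alg_flow_def poly_family_def by blast

lemma lie_ex:
  assumes "polynomial_fun p"
  shows "\<exists>p'. lie p p'"
proof -
  obtain n c where c: "\<And>i. polynomial_fun (c i)" "\<And>i. i \<ge> n \<Longrightarrow> c i = (\<lambda>v. 0)"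
    "\<And>v s. v \<in> X \<Longrightarrow> p (\<alpha> s v) = (\<Sum>i<n. c i v * s ^ i)"
    using flow_coeffs[OF assms] by blast
  show ?thesis
    using lie_exists(1)[OF assms c] by blast
qed

lemma lie_arep: "lie p p' \<Longrightarrow> \<exists>b G. arep b p' G"
  by (simp add: lie_def arep_poly_fun)

definition flow_coord :: "4 \<Rightarrow> laur" where
  "flow_coord j = (SOME G. \<exists>p' b. lie (\<lambda>v. v $ j) p' \<and> arep b p' G)"

lemma flow_coord: "\<exists>p' b. lie (\<lambda>v. v $ j) p' \<and> arep b p' (flow_coord j)"
proof -
  obtain p' where p': "lie (\<lambda>v. v $ j) p'"
    using lie_ex polynomial_fun_coord by blast
  then obtain b G where "arep b p' G"
    using lie_arep by blast
  with p' have "\<exists>G p' b. lie (\<lambda>v. v $ j) p' \<and> arep b p' G" by blast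
  then show ?thesis
    unfolding flow_coord_def by (rule someI_ex)
qed

text \<open>The vector field in the chart x, z, t; by \<open>arep_lie\<close> it also differentiates
  functions involving y correctly.\<close>

definition D :: "laur \<Rightarrow> laur" where
  "D f = flow_coord 1 * px f + flow_coord 3 * pz f + flow_coord 4 * pt f"

text \<open>The chain rule at points with x, z, t nonzero, an open condition that the flow respects
  for small times.\<close>

lemma arep_lie:
  assumes p: "arep b p G" "lie p p'" and G': "arep b' p' G'"
  shows "G' = D G"
proof (rule ev_inject)
  fix x z t :: complex assume nz: "x \<noteq> 0" "z \<noteq> 0" "t \<noteq> 0"
  obtain v where v: "v \<in> X" "v $ 1 = x" "v $ 3 = z" "v $ 4 = t"
    using point_exists nz by blast
  have C: "((\<lambda>s. \<alpha> s v $ j) has_field_derivative ev x z t (flow_coord j)) (at 0)" for j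
  proof -
    obtain q b1 where q: "lie (\<lambda>v. v $ j) q" "arep b1 q (flow_coord j)"
      using flow_coord by blast
    have "((\<lambda>s. \<alpha> s v $ j) has_field_derivative q (\<alpha> 0 v)) (at 0)"
      using q(1) v by (auto simp: lie_def)
    then show ?thesis
      using arep_ev[OF q(2) v(1)] v nz by (simp add: \<alpha>_0)
  qed
  have ne: "eventually (\<lambda>s. \<alpha> s v $ j \<noteq> 0) (at 0)" if "v $ j \<noteq> 0" for j
  proof -
    have "isCont (\<lambda>s. \<alpha> s v $ j) 0"
      using C DERIV_isCont by blast
    then have "((\<lambda>s. \<alpha> s v $ j) \<longlongrightarrow> v $ j) (at 0)"
      using \<alpha>_0[OF v(1)] by (simp add: isCont_def)
    then show ?thesis
      using that tendsto_imp_eventually_ne by blast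
  qed
  have ev: "eventually (\<lambda>s. p (\<alpha> s v) = evv (\<alpha> s v) G) (at 0)"
  proof -
    have "eventually (\<lambda>s. \<alpha> s v $ 1 \<noteq> 0) (at 0)" "eventually (\<lambda>s. \<alpha> s v $ 3 \<noteq> 0) (at 0)"
      "eventually (\<lambda>s. \<alpha> s v $ 4 \<noteq> 0) (at 0)"
      using ne v nz by auto
    then show ?thesis
      by eventually_elim (intro arep_ev[OF p(1)] \<alpha>_X v(1))
  qed
  have "((\<lambda>s. p (\<alpha> s v)) has_field_derivative ev x z t G') (at 0)"
    using p(2) v arep_ev[OF G' v(1)] nz unfolding lie_def by (metis \<alpha>_0)
  then have "((\<lambda>s. evv (\<alpha> s v) G) has_field_derivative ev x z t G') (at 0)"
    using ev arep_ev[OF p(1) v(1)] v nz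
    by (subst (asm) has_field_derivative_cong_eventually[where g = "\<lambda>s. evv (\<alpha> s v) G"]) (auto simp: \<alpha>_0)
  moreover have "((\<lambda>s. evv (\<alpha> s v) G) has_field_derivative
      (ev x z t (flow_coord 1) * evv (\<alpha> 0 v) (px G) + ev x z t (flow_coord 3) * evv (\<alpha> 0 v) (pz G)
      + ev x z t (flow_coord 4) * evv (\<alpha> 0 v) (pt G))) (at 0)"
    by (rule DERIV_ev_torus; (rule C)?) (use v nz \<alpha>_0 in auto)
  ultimately show "ev x z t G' = ev x z t (D G)"
    using DERIV_unique v nz \<alpha>_0[OF v(1)] unfolding D_def by (fastforce simp: ev_mult_torus)
qed

text \<open>\<open>arep\<close> ignores values off the hypersurface, so \<open>f\<close> itself need
  not be a polynomial function.\<close>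

lemma arep_polynomial: "arep b f G \<Longrightarrow> \<exists>p. polynomial_fun p \<and> arep b p G"
proof (induction b arbitrary: f G)
  case 0
  then show ?case
    by (intro exI[of _ "\<lambda>v. evv v G"]) (auto intro: polynomial_fun_ev)
next
  case (Suc b)
  obtain g f1 G1 where 1: "g \<in> pol" "arep b f1 G1" "G = yy ^ Suc b * g + G1"
    using Suc.prems by auto
  obtain p where p: "polynomial_fun p" "arep b p G1"
    using Suc.IH[OF 1(2)] by blast
  have "polynomial_fun (\<lambda>v :: complex ^ 4. (v $ 2) ^ Suc b * evv v g + p v)"
    by (intro polynomial_fun_add polynomial_fun_mult polynomial_fun_power polynomial_fun_coord polynomial_fun_ev 1 p)
  then show ?case
    using 1 p by (intro exI[of _ "\<lambda>v. (v $ 2) ^ Suc b * evv v g + p v"]) auto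
qed

lemma D_arep:
  assumes "arep b f G"
  shows "\<exists>b f. arep b f (D G)"
proof -
  obtain p where p: "polynomial_fun p" "arep b p G"
    using arep_polynomial assms by blast
  obtain p' where p': "lie p p'" using lie_ex p by blast
  then obtain b' G' where G': "arep b' p' G'" using lie_arep by blast
  then show ?thesis using arep_lie[OF p(2) p' G'] by blast
qed

lemma D_nilpotent:
  assumes "arep b f G"
  shows "nilpotent_at D G"
proof -
  have "(D ^^ n) G = 0"
    if "polynomial_fun p" "arep b p G" "\<And>i. polynomial_fun (c i)" "\<And>i. i \<ge> n \<Longrightarrow> c i = (\<lambda>v. 0)"
      "\<And>v s. v \<in> X \<Longrightarrow> p (\<alpha> s v) = (\<Sum>i<n. c i v * s ^ i)" for n p G b c
    using that
  proof (induction n arbitrary: p G b c)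
    case 0
    have "p v = 0" if "v \<in> X" for v
      using 0(5)[OF that, of 0] \<alpha>_0[OF that] by simp
    then show ?case
      using arep_unique[OF 0(2) arep_zero] by simp
  next
    case (Suc n)
    note lie = lie_exists[OF Suc.prems(1,3-5)]
    obtain b' G' where G': "arep b' (c 1) G'"
      using arep_poly_fun Suc.prems(3) by blast
    have "polynomial_fun (\<lambda>v. of_nat (Suc i) * c (Suc i) v)" for i
      using Suc.prems(3) by (intro polynomial_fun_mult polynomial_fun_const)
    then have "(D ^^ n) G' = 0"
      using lie(2) Suc.prems(4)
      by (intro Suc.IH[OF Suc.prems(3)[of 1] G', of "\<lambda>i v. of_nat (Suc i) * c (Suc i) v"]) auto
    then show ?case
      using arep_lie[OF Suc.prems(2) lie(1) G'] by (simp add: funpow_Suc_right del: funpow.simps)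
  qed
  note nil = this
  obtain p where p: "polynomial_fun p" "arep b p G"
    using arep_polynomial assms by blast
  obtain n c where c: "\<And>i. polynomial_fun (c i)" "\<And>i. i \<ge> n \<Longrightarrow> c i = (\<lambda>v. 0)"
    "\<And>v s. v \<in> X \<Longrightarrow> p (\<alpha> s v) = (\<Sum>i<n. c i v * s ^ i)"
    using flow_coeffs[OF p(1)] by blast
  show ?thesis
    using nil[OF p c] unfolding nilpotent_at_def by blast
qed

theorem invariant_pol:
  assumes p: "polynomial_fun p" "arep b p G" and inv: "\<And>v s. v \<in> X \<Longrightarrow> p (\<alpha> s v) = p v"
    and q: "polynomial_fun q" "v0 \<in> X" "q (\<alpha> s0 v0) \<noteq> q v0"
  shows "G \<in> pol"
proof -
  define a1 a2 a3 where "a1 = sg (Expo (-1) 0 0) 1 * flow_coord 1" and "a2 = sg (Expo 0 (-1) 0) 1 * flow_coord 3"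
    and "a3 = sg (Expo 0 0 (-1)) 1 * flow_coord 4"
  have D_eq: "D = (\<lambda>f. a1 * eux f + a2 * euz f + a3 * eut f)"
    by (simp add: fun_eq_iff D_def a1_def a2_def a3_def px_def pz_def pt_def algebra_simps)
  \<comment> \<open>With a vanishing generator \<open>q\<close> would be constant along the orbit of
    \<open>v0\<close>.\<close>
  have "\<not> (a1 = 0 \<and> a2 = 0 \<and> a3 = 0)"
  proof
    assume "a1 = 0 \<and> a2 = 0 \<and> a3 = 0"
    then have D0: "D f = 0" for f by (simp add: D_eq)
    obtain q' where q': "lie q q'" using lie_ex q by blast
    obtain b1 G1 where G1: "arep b1 q G1" using arep_poly_fun q by blast
    obtain b2 G2 where G2: "arep b2 q' G2" using lie_arep q' by blast
    have "G2 = 0" using arep_lie[OF G1 q' G2] D0 by simp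
    then have "q' v = 0" if "v \<in> X" for v
      using arep_pol_ev[OF G2 _ that] by simp
    then have "((\<lambda>s. q (\<alpha> s v0)) has_field_derivative 0) (at s)" for s
      using q' q(2) \<alpha>_X unfolding lie_def by metis
    then have "\<exists>c. \<forall>s\<in>UNIV. q (\<alpha> s v0) = c"
      by (intro has_field_derivative_zero_constant) auto
    then have "q (\<alpha> s0 v0) = q (\<alpha> 0 v0)" by auto
    then show False using q \<alpha>_0 by simp
  qed
  then have ne: "W ` (ks a1 \<union> ks a2 \<union> ks a3) \<noteq> {}" by auto
  \<comment> \<open>The highest weight in any of the three coefficients, which makes the leading
    part nonzero.\<close>
  define m where "m = Max (W ` (ks a1 \<union> ks a2 \<union> ks a3))"
  have fin: "finite (W ` (ks a1 \<union> ks a2 \<union> ks a3))" by simp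
  have m: "wle W m a1" "wle W m a2" "wle W m a3"
    using Max_ge[OF fin] by (auto simp: wle_def m_def)
  have "m \<in> W ` (ks a1 \<union> ks a2 \<union> ks a3)"
    unfolding m_def using fin ne by (rule Max_in)
  then obtain e where "e \<in> ks a1 \<or> e \<in> ks a2 \<or> e \<in> ks a3" "W e = m" by blast
  then have "e \<in> ks (hc W m a1) \<or> e \<in> ks (hc W m a2) \<or> e \<in> ks (hc W m a3)"
    by (simp add: ks_hc)
  then have mm: "hc W m a1 \<noteq> 0 \<or> hc W m a2 \<noteq> 0 \<or> hc W m a3 \<noteq> 0" by auto
  interpret koras_lnd d k l a1 a2 a3 m "\<lambda>f. a1 * eux f + a2 * euz f + a3 * eut f"
    "\<lambda>f. hc W m a1 * eux f + hc W m a2 * euz f + hc W m a3 * eut f"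
    by unfold_locales (use m mm D_arep D_nilpotent D_eq in auto)
  obtain p' where p': "lie p p'" using lie_ex p by blast
  then obtain b' G' where G': "arep b' p' G'" using lie_arep by blast
  have "p' v = 0" if "v \<in> X" for v
  proof -
    have "((\<lambda>s. p (\<alpha> s v)) has_field_derivative p' (\<alpha> 0 v)) (at 0)"
      using p' that by (simp add: lie_def)
    then have "((\<lambda>s. p v) has_field_derivative p' v) (at 0)"
      using inv[OF that] \<alpha>_0[OF that] by simp
    then show ?thesis
      using DERIV_unique DERIV_const by blast
  qed
  then have "D G = 0"
    using arep_unique[OF G' arep_zero] arep_lie[OF p(2) p' G'] by simp
  then show ?thesis
    using ker_subset_pol[OF p(2)] D_eq by simp
qed

end

subsection \<open>Divergence-free vector fields in the plane\<close>

text \<open>\<open>q = \<integral> A dt - \<integral> B(z, 0) dz\<close>.\<close>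

lemma hamiltonian_exists:
  assumes A: "A \<in> pol" and B: "B \<in> pol" and div: "pz A + pt B = 0"
  obtains q where "q \<in> pol" "pt q = A" "pz q = - B"
proof -
  define It where "It = vt * euler (\<lambda>e. 1 / (of_int (et e) + 1)) A"
  \<comment> \<open>The restriction of \<open>B\<close> to t = 0.\<close>
  define B0 where "B0 = euler (\<lambda>e. if et e = 0 then 1 else 0) B"
  define Iz where "Iz = vz * euler (\<lambda>e. 1 / (of_int (ez e) + 1)) B0"
  have nz: "of_int i + 1 \<noteq> (0 :: complex)" if "0 \<le> i" for i :: int
    using that of_int_eq_0_iff[of "i + 1", where 'a = complex] by simp
  have It: "lk It (e + Expo 0 0 1) = lk A e / (of_int (et e) + 1)" for e
    by (simp add: It_def lk_sg_mult lk_euler)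
  have Iz: "lk Iz (e + Expo 0 1 0) = lk B0 e / (of_int (ez e) + 1)" for e
    by (simp add: Iz_def lk_sg_mult lk_euler)
  have pol: "It - Iz \<in> pol"
  proof (rule pol_diff)
    have "euler v f \<in> pol" if "f \<in> pol" for v f
      using that ks_euler by (auto simp: pol_def)
    then show "It \<in> pol" "Iz \<in> pol"
      unfolding It_def Iz_def B0_def using A B by (auto intro!: pol_mult pol_sg simp: nonneg_def)
  qed
  have "pt (It - Iz) = A"
  proof (rule poly_mapping_eqI)
    fix e
    have Bz: "lk Iz (e + Expo 0 0 1) * (of_int (et e) + 1) = 0"
    proof -
      have *: "e + Expo 0 0 1 = (e + Expo 0 (- 1) 1) + Expo 0 1 0"
        by (rule expo.expand) simp
      show ?thesis
        unfolding * Iz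
      proof (cases "et e + 1 = 0")
        case True
        then have "of_int (et e) + 1 = (0 :: complex)"
          by (metis of_int_0 of_int_1 of_int_add)
        then show "lk B0 (e + Expo 0 (- 1) 1) / (of_int (ez (e + Expo 0 (- 1) 1)) + 1) * (of_int (et e) + 1) = 0"
          by simp
      qed (simp add: B0_def lk_euler)
    qed
    show "lk (pt (It - Iz)) e = lk A e"
    proof (cases "0 \<le> et e")
      case True
      then show ?thesis
        using Bz nz[of "et e"] by (simp add: lk_partial lookup_minus It)
    next
      case False
      then have "lk A e = 0" "lk Iz (e + Expo 0 0 1) * (of_int (et e) + 1) = 0"
        using pol_lk[OF A, of e] Bz by (auto simp: nonneg_def)
      then show ?thesis
        by (simp add: lk_partial lookup_minus It algebra_simps)
    qed
  qed
  moreover have "pz (It - Iz) = - B"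
  proof (rule poly_mapping_eqI)
    fix e
    \<comment> \<open>By the vanishing divergence the z-derivative of \<open>It\<close> is minus the
      part of \<open>B\<close> divisible by t; \<open>Iz\<close> accounts for the rest.\<close>
    have AB: "(of_int (ez e') + 1) * lk A (e' + Expo 0 1 0) = - ((of_int (et e') + 1) * lk B (e' + Expo 0 0 1))" for e'
      using arg_cong[OF div, of "\<lambda>f. lk f e'"] by (simp add: lookup_add lk_partial eq_neg_iff_add_eq_0)
    have e: "e + Expo 0 1 0 = (e + Expo 0 1 (- 1)) + Expo 0 0 1" "e + Expo 0 0 (- 1) + Expo 0 0 1 = e"
      "e + Expo 0 1 (- 1) = e + Expo 0 0 (- 1) + Expo 0 1 0"
      by (rule expo.expand; simp)+
    have It': "(of_int (ez e) + 1) * lk It (e + Expo 0 1 0) = (if et e = 0 then 0 else - lk B e)"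
    proof -
      have "lk It (e + Expo 0 1 0) = lk A (e + Expo 0 1 (- 1)) / of_int (et e)"
        unfolding e(1) It by simp
      then have "(of_int (ez e) + 1) * lk It (e + Expo 0 1 0) = (of_int (et e) * - lk B e) / of_int (et e)"
        using AB[of "e + Expo 0 0 (- 1)"] unfolding e(2) e(3) by simp
      then show ?thesis by auto
    qed
    have "(of_int (ez e) + 1) * lk Iz (e + Expo 0 1 0) = (if et e = 0 then lk B e else 0)"
    proof (cases "0 \<le> ez e")
      case True
      then show ?thesis
        unfolding Iz using nz[of "ez e"] by (auto simp: B0_def lk_euler)
    next
      case False
      then have "lk B e = 0" using pol_lk[OF B, of e] by (auto simp: nonneg_def)
      then show ?thesis unfolding Iz by (auto simp: B0_def lk_euler)
    qed
    then show "lk (pz (It - Iz)) e = lk (- B) e"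
      using It' by (simp add: lk_partial lookup_minus right_diff_distrib)
  qed
  ultimately show ?thesis
    using that pol by blast
qed

context koras
begin

subsection \<open>Periods of the Brieskorn curve\<close>

text \<open>\<open>period\<close> is, up to normalisation, the integral of the form \<open>f dz \<and> dt / dF\<close> over a
  vanishing cycle of the curves \<open>z\<^sup>k + t\<^sup>l = - x\<close>, given on monomials by Beta functions
  and restricted to the weight of \<open>x\<^sup>d\<close>.\<close>

definition wt :: "expo \<Rightarrow> int" where "wt e = int k * int l * ex e + int l * ez e + int k * et e"

text \<open>The quotient of B(p + 1/k, r + 1/l) by B(1/k, 1/l), B being Euler's Beta
  function.\<close>

definition beta :: "nat \<Rightarrow> nat \<Rightarrow> complex" where
  "beta p r = pochhammer (1 / of_nat k) p * pochhammer (1 / of_nat l) r /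
     pochhammer (1 / of_nat k + 1 / of_nat l) (p + r)"

text \<open>On z^k + t^l = -x the monomial x^a z^(k p) t^(l r) scales like (-1)^a (-x)^(a + p + r),
  whence the sign; the weight condition reads a + p + r = d.\<close>

definition mu :: "expo \<Rightarrow> complex" where
  "mu e = (if nonneg e \<and> int k dvd ez e \<and> int l dvd et e \<and> wt e = int k * int l * int d
     then (- 1) ^ nat (ex e) * beta (nat (ez e div int k)) (nat (et e div int l)) else 0)"

definition period :: "laur \<Rightarrow> complex" where "period f = (\<Sum>e\<in>ks f. lk f e * mu e)"

lemma period_superset: "finite S \<Longrightarrow> ks f \<subseteq> S \<Longrightarrow> period f = (\<Sum>e\<in>S. lk f e * mu e)"
  unfolding period_def by (rule sum.mono_neutral_left) (auto simp: in_keys_iff)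

lemma period_add: "period (f + g) = period f + period g"
proof -
  have "period (f + g) = (\<Sum>e\<in>ks f \<union> ks g. lk (f + g) e * mu e)"
    using keys_add[of f g] by (intro period_superset) auto
  moreover have "period f = (\<Sum>e\<in>ks f \<union> ks g. lk f e * mu e)"
    "period g = (\<Sum>e\<in>ks f \<union> ks g. lk g e * mu e)"
    by (intro period_superset; auto)+
  ultimately show ?thesis
    by (simp add: lookup_add algebra_simps sum.distrib)
qed

lemma period_minus: "period (- f) = - period f"
  by (simp add: period_def ks_minus sum_negf)

lemma period_diff: "period (f - g) = period f - period g"
  using period_add[of f "- g"] period_minus by simp

lemma period_sg: "period (sg e c) = c * mu e"
  by (simp add: period_def)

lemma period_0 [simp]: "period 0 = 0"
  by (simp add: period_def)

lemma period_cst: "period (cst c * f) = c * period f"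
proof (induction f rule: laur_induct')
  case (single e b)
  then show ?case by (simp add: sg_cst period_sg)
qed (simp add: distrib_left period_add)

lemma pochhammer_nz: "pochhammer (1 / of_nat k + 1 / of_nat l :: complex) n \<noteq> 0"
proof
  assume "pochhammer (1 / of_nat k + 1 / of_nat l :: complex) n = 0"
  then obtain i where "1 / of_nat k + 1 / of_nat l = - (of_nat i :: complex)"
    by (auto simp: pochhammer_eq_0_iff)
  then have "complex_of_real (1 / real k + 1 / real l + real i) = 0"
    by simp
  then have "1 / real k + 1 / real l + real i = 0"
    using of_real_eq_0_iff by blast
  moreover have "1 / real k + 1 / real l + real i > 0"
    using k0 l by (intro add_pos_nonneg) auto
  ultimately show False by simp
qed

lemma beta_Suc:
  "beta (Suc p) r = beta p r * (1 / of_nat k + of_nat p) / (1 / of_nat k + 1 / of_nat l + of_nat (p + r))"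
  "beta p (Suc r) = beta p r * (1 / of_nat l + of_nat r) / (1 / of_nat k + 1 / of_nat l + of_nat (p + r))"
  by (simp_all add: beta_def pochhammer_Suc)

lemma beta_denom_nz: "1 / of_nat k + 1 / of_nat l + of_nat n \<noteq> (0 :: complex)"
  using pochhammer_nz[of "Suc n"] by (simp add: pochhammer_Suc)

text \<open>The identity B(a + 1, b) + B(a, b + 1) = B(a, b), by which multiples of \<open>F\<close>
  have period 0.\<close>

lemma beta_sum: "beta (Suc p) r + beta p (Suc r) = beta p r"
proof -
  have "beta (Suc p) r + beta p (Suc r) = beta p r * (1 / of_nat k + 1 / of_nat l + of_nat (p + r)) /
      (1 / of_nat k + 1 / of_nat l + of_nat (p + r))"
    unfolding beta_Suc by (simp add: add_divide_distrib[symmetric] algebra_simps)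
  then show ?thesis
    using beta_denom_nz[of "p + r"] by simp
qed

text \<open>The identity b B(a + 1, b) = a B(a, b + 1), cleared of denominators; it makes the
  periods of exact forms vanish.\<close>

lemma beta_shift:
  "of_nat k * of_nat (l * r + 1) * beta (Suc p) r = of_nat l * of_nat (k * p + 1) * beta p (Suc r)"
proof -
  have kl: "of_nat k \<noteq> (0 :: complex)" "of_nat l \<noteq> (0 :: complex)"
    using k0 l by simp_all
  have "of_nat k * (1 / of_nat k + of_nat p) = (of_nat (k * p + 1) :: complex)" (is "?a * ?c = ?a''")
    using kl by (simp add: distrib_left)
  moreover have "of_nat l * (1 / of_nat l + of_nat r) = (of_nat (l * r + 1) :: complex)" (is "?a' * ?c' = ?b")
    using kl by (simp add: distrib_left)
  ultimately have "?a * ?b * ?c = ?a' * ?a'' * ?c'"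
    by (metis mult.assoc mult.commute)
  then have "beta p r * (?a * ?b * ?c) / s = beta p r * (?a' * ?a'' * ?c') / s" for s
    by simp
  then show ?thesis
    unfolding beta_Suc by (simp only: mult_ac times_divide_eq_right)
qed

lemma mu_eq:
  "mu (Expo (int a) (int k * int p) (int l * int r)) =
     (if a + p + r = d then (- 1) ^ a * beta p r else 0)"
proof -
  have "wt (Expo (int a) (int k * int p) (int l * int r)) = int k * int l * int (a + p + r)"
    by (simp add: wt_def algebra_simps)
  then show ?thesis
    using k0 l by (simp add: mu_def nonneg_def del: of_nat_add)
qed

lemma mu_0: "nonneg e \<Longrightarrow> \<not> (int k dvd ez e \<and> int l dvd et e) \<Longrightarrow> mu e = 0"
  by (auto simp: mu_def)

lemma nonneg_dvdE:
  assumes "nonneg e" "int k dvd ez e" "int l dvd et e"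
  obtains a p r where "e = Expo (int a) (int k * int p) (int l * int r)"
proof -
  obtain p' r' where pr: "ez e = int k * p'" "et e = int l * r'"
    using assms(2,3) by (auto elim!: dvdE)
  then have "p' \<ge> 0" "r' \<ge> 0" "ex e \<ge> 0"
    using assms(1) k0 l by (auto simp: nonneg_def zero_le_mult_iff)
  then obtain a p r where "ex e = int a" "p' = int p" "r' = int r"
    by (metis nonneg_int_cases)
  then show ?thesis
    using that[of a p r] pr by (metis expo.collapse)
qed

lemma period_F_mult: "f \<in> pol \<Longrightarrow> period (F * f) = 0"
proof (rule laur_induct[of f])
  fix e c assume "f \<in> pol" "e \<in> ks f"
  then have e: "nonneg e" by (rule polD)
  have eq: "period (F * sg e c) = c * (mu (Expo 0 (int k) 0 + e) + mu (Expo 0 0 (int l) + e) + mu (Expo 1 0 0 + e))"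
    by (simp add: F_def H_def sg_power distrib_right mult_single period_add period_sg algebra_simps)
  show "period (F * sg e c) = 0"
  proof (cases "int k dvd ez e \<and> int l dvd et e")
    case True
    then obtain a p r where epr: "e = Expo (int a) (int k * int p) (int l * int r)"
      using nonneg_dvdE[OF e] by blast
    have "Expo 0 (int k) 0 + e = Expo (int a) (int k * int (Suc p)) (int l * int r)"
      "Expo 0 0 (int l) + e = Expo (int a) (int k * int p) (int l * int (Suc r))"
      "Expo 1 0 0 + e = Expo (int (Suc a)) (int k * int p) (int l * int r)"
      by (simp_all add: epr algebra_simps)
    then show ?thesis
      unfolding eq by (simp only: mu_eq) (simp add: beta_sum[of p r, symmetric] algebra_simps)
  next
    case False
    then have "mu (Expo 0 (int k) 0 + e) = 0" "mu (Expo 0 0 (int l) + e) = 0" "mu (Expo 1 0 0 + e) = 0"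
      using e by (auto intro!: mu_0 simp: nonneg_def)
    then show ?thesis unfolding eq by simp
  qed
qed (simp_all add: distrib_left period_add)

text \<open>The Poisson bracket {F, q} in z and t, with x as a parameter.\<close>

definition bracket :: "laur \<Rightarrow> laur" where
  "bracket q = of_nat k * vz ^ (k - 1) * pt q - of_nat l * vt ^ (l - 1) * pz q"

lemma bracket_add: "bracket (f + g) = bracket f + bracket g"
  by (simp add: bracket_def pz.add pt.add algebra_simps)

lemma bracket_pol: "q \<in> pol \<Longrightarrow> bracket q \<in> pol"
  unfolding bracket_def by (intro pol_diff pol_mult pol_power pol_of_nat pol_vars pol_partial)

lemma bracket_sg:
  "bracket (sg (Expo a i j) c) = sg (Expo a (i + int (k - 1)) (j - 1)) (of_nat k * of_int j * c)
     - sg (Expo a (i - 1) (j + int (l - 1))) (of_nat l * of_int i * c)"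
  by (simp add: bracket_def partial_sg sg_power mult_single algebra_simps flip: single_of_nat)

text \<open>On the curve \<open>bracket q\<close> times dz dt / dF is the differential of
  \<open>q\<close>; on monomials its vanishing period is \<open>beta_shift\<close>.\<close>

lemma period_bracket: "q \<in> pol \<Longrightarrow> period (bracket q) = 0"
proof (rule laur_induct[of q])
  fix e c assume "q \<in> pol" "e \<in> ks q"
  then have e: "nonneg e" by (rule polD)
  obtain a i j where aij: "e = Expo a i j" by (cases e)
  have nn: "0 \<le> a" "0 \<le> i" "0 \<le> j" using e by (auto simp: aij nonneg_def)
  have k1: "int (k - 1) = int k - 1" and l1: "int (l - 1) = int l - 1"
    using k0 l by (simp_all add: of_nat_diff)
  let ?e1 = "Expo a (i + int (k - 1)) (j - 1)" and ?e2 = "Expo a (i - 1) (j + int (l - 1))"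
  show "period (bracket (sg e c)) = 0"
  proof (cases "int k dvd i - 1 \<and> int l dvd j - 1")
    case True
    have "i \<noteq> 0" "j \<noteq> 0"
      using True k l by (auto simp: zdvd1_eq)
    then have "nonneg (Expo a (i - 1) (j - 1))" using nn by (simp add: nonneg_def)
    then obtain a' p r where apr: "Expo a (i - 1) (j - 1) = Expo (int a') (int k * int p) (int l * int r)"
      using nonneg_dvdE[of "Expo a (i - 1) (j - 1)"] True by auto
    then have ij: "i = int (k * p + 1)" "j = int (l * r + 1)" and a': "a = int a'" by simp_all
    have e1: "?e1 = Expo (int a') (int k * int (Suc p)) (int l * int r)"
      by (simp only: ij k1 a') (simp add: algebra_simps)
    have e2: "?e2 = Expo (int a') (int k * int p) (int l * int (Suc r))"
      by (simp only: ij l1 a') (simp add: algebra_simps)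
    have "period (bracket (sg e c)) = (of_nat k * of_int j * c) * mu ?e1 - (of_nat l * of_int i * c) * mu ?e2"
      unfolding aij bracket_sg period_diff period_sg ..
    also have "\<dots> = (if a' + p + r + 1 = d then c * (- 1) ^ a' *
        (of_nat k * of_nat (l * r + 1) * beta (Suc p) r - of_nat l * of_nat (k * p + 1) * beta p (Suc r)) else 0)"
      unfolding e1 e2 unfolding mu_eq unfolding ij of_int_of_nat_eq
      by (simp add: right_diff_distrib mult_ac)
    also have "\<dots> = 0"
      unfolding beta_shift by simp
    finally show ?thesis .
  next
    case False
    have 1: "of_int j * mu ?e1 = 0"
    proof (cases "j = 0")
      case False
      have eq: "i + int (k - 1) = (i - 1) + int k" unfolding k1 by simp
      have "int k dvd i + int (k - 1) \<longleftrightarrow> int k dvd i - 1"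
        unfolding eq by (rule dvd_add_triv_right_iff)
      then have "mu ?e1 = 0"
        using \<open>\<not> (int k dvd i - 1 \<and> int l dvd j - 1)\<close> False nn by (intro mu_0) (auto simp: nonneg_def)
      then show ?thesis by simp
    qed simp
    have 2: "of_int i * mu ?e2 = 0"
    proof (cases "i = 0")
      case False
      have eq: "j + int (l - 1) = (j - 1) + int l" unfolding l1 by simp
      have "int l dvd j + int (l - 1) \<longleftrightarrow> int l dvd j - 1"
        unfolding eq by (rule dvd_add_triv_right_iff)
      then have "mu ?e2 = 0"
        using \<open>\<not> (int k dvd i - 1 \<and> int l dvd j - 1)\<close> False nn by (intro mu_0) (auto simp: nonneg_def)
      then show ?thesis by simp
    qed simp
    have "period (bracket (sg e c)) = of_nat k * c * (of_int j * mu ?e1) - of_nat l * c * (of_int i * mu ?e2)"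
      unfolding aij bracket_sg period_diff period_sg by simp
    then show ?thesis unfolding 1 2 by simp
  qed
qed (simp_all add: bracket_add period_add, simp add: bracket_def)

lemma weight_wt: "weight (\<lambda>e. - wt e)"
  by (simp add: weight_def wt_def algebra_simps)

lemma wt_nonneg: "nonneg e \<Longrightarrow> 0 \<le> wt e"
  by (simp add: nonneg_def wt_def)

lemma wt_pos: "nonneg e \<Longrightarrow> e \<noteq> 0 \<Longrightarrow> 0 < wt e"
proof -
  assume e: "nonneg e" "e \<noteq> 0"
  then have "ex e > 0 \<or> ez e > 0 \<or> et e > 0"
    by (metis expo.expand expo_sel(1-3) nonneg_def order_le_less)
  then show ?thesis
    using e(1) k0 l unfolding wt_def nonneg_def
    by (smt (verit) mult_nonneg_nonneg mult_pos_pos of_nat_0_less_iff)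
qed

lemma period_high_weight: "wle (\<lambda>e. - wt e) n f \<Longrightarrow> n < - (int k * int l * int d) \<Longrightarrow> period f = 0"
  unfolding period_def by (rule sum.neutral) (force simp: wle_def mu_def)

text \<open>\<open>vx ^ d\<close> already has the weight selected by \<open>mu\<close>, so only the
  constant term of \<open>f\<close> contributes.\<close>

lemma period_x_d: "f \<in> pol \<Longrightarrow> period (vx ^ d * f) = (- 1) ^ d * lk f 0"
proof -
  assume f: "f \<in> pol"
  have "period (vx ^ d * f) = (\<Sum>e\<in>(+) (Expo (int d) 0 0) ` ks f. lk (vx ^ d * f) e * mu e)"
    by (rule period_superset) (auto simp: sg_power in_keys_iff lk_sg_mult intro!: image_eqI[of _ _ "_ - Expo (int d) 0 0"])
  also have "\<dots> = (\<Sum>e\<in>ks f. lk f e * mu (Expo (int d) 0 0 + e))"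
    by (subst sum.reindex) (auto simp: sg_power lk_sg_mult)
  also have "\<dots> = (\<Sum>e\<in>ks f. if e = 0 then (- 1) ^ d * lk f 0 else 0)"
  proof (rule sum.cong)
    fix e assume "e \<in> ks f"
    then have e: "nonneg e" using polD f by blast
    show "lk f e * mu (Expo (int d) 0 0 + e) = (if e = 0 then (- 1) ^ d * lk f 0 else 0)"
    proof (cases "e = 0")
      case True
      then show ?thesis
        using mu_eq[of d 0 0] by (simp add: beta_def)
    next
      case False
      then have "wt (Expo (int d) 0 0 + e) \<noteq> int k * int l * int d"
        using wt_pos[OF e] by (simp add: wt_def algebra_simps)
      then show ?thesis using False by (simp add: mu_def)
    qed
  qed simp
  also have "\<dots> = (- 1) ^ d * lk f 0"
    by (auto simp: in_keys_iff)
  finally show ?thesis .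
qed

text \<open>Dividing by \<open>u\<close>, as a power series truncated beyond the weight of \<open>x\<^sup>d\<close>, and taking
  periods.\<close>

lemma constant_term_eq_0:
  assumes pol: "S \<in> pol" "u \<in> pol" "q \<in> pol" "K \<in> pol" and u: "lk u 0 \<noteq> 0"
    and eq: "F * S + u * bracket q + vx ^ d * K = 0"
  shows "lk K 0 = 0"
proof -
  \<comment> \<open>Monomials of \<open>r\<close> have weight at least 1, so multiples of
    \<open>r ^ Suc N\<close> by polynomials lie beyond the weight k l d of x^d.\<close>
  define N where "N = k * l * d"
  define r where "r = 1 - cst (1 / lk u 0) * u"
  define v where "v = (\<Sum>i\<le>N. r ^ i)"
  have r: "r \<in> pol"
    unfolding r_def by (intro pol_diff pol_mult pol_cst pol_1 pol)
  then have v: "v \<in> pol"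
    unfolding v_def by (intro pol_sum pol_power)
  have r0: "lk r 0 = 0"
    unfolding r_def using u by (simp add: lookup_minus ev_0_mult[OF pol_cst pol(2)])
  have "u = cst (lk u 0) * (1 - r)"
    unfolding r_def using u by (simp flip: mult.assoc cst_mult)
  then have "u * v = cst (lk u 0) * ((1 - r) * v)"
    by (metis mult.assoc)
  also have "(1 - r) * v = 1 - r ^ Suc N"
    unfolding v_def by (rule sum_gp_basic)
  finally have uv: "u * v = cst (lk u 0) * (1 - r ^ Suc N)" .
  have "F * (S * v) + u * v * bracket q + vx ^ d * (K * v) = (F * S + u * bracket q + vx ^ d * K) * v"
    by (simp add: algebra_simps)
  also have "\<dots> = 0"
    using eq by simp
  finally have "0 = period (F * (S * v) + u * v * bracket q + vx ^ d * (K * v))"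
    by simp
  also have "\<dots> = period (u * v * bracket q) + (- 1) ^ d * lk (K * v) 0"
    using pol v by (simp add: period_add period_F_mult period_x_d pol_mult)
  also have "u * v * bracket q = cst (lk u 0) * (bracket q - r ^ Suc N * bracket q)"
    unfolding uv by (simp add: algebra_simps)
  also have "period \<dots> = - lk u 0 * period (r ^ Suc N * bracket q)"
    unfolding period_cst period_diff period_bracket[OF pol(3)] by simp
  also have "period (r ^ Suc N * bracket q) = 0"
  proof (rule period_high_weight)
    have "e \<noteq> 0" if "e \<in> ks r" for e using that r0 by (auto simp: in_keys_iff)
    then have "wle (\<lambda>e. - wt e) (- 1) r"
      using wt_pos polD[OF r] by (fastforce simp: wle_def)
    then have "wle (\<lambda>e. - wt e) (int (Suc N) * - 1) (r ^ Suc N)"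
      using wle_power[OF weight_wt, of "- 1" r "Suc N"] by (simp only: funpow_add_int add_0)
    moreover have "wle (\<lambda>e. - wt e) 0 (bracket q)"
      using wt_nonneg polD[OF bracket_pol[OF pol(3)]] by (fastforce simp: wle_def)
    ultimately show "wle (\<lambda>e. - wt e) (int (Suc N) * - 1 + 0) (r ^ Suc N * bracket q)"
      by (rule wle_mult[OF weight_wt])
    show "int (Suc N) * - 1 + 0 < - (int k * int l * int d)"
      by (simp add: N_def)
  qed
  also have "lk (K * v) 0 = lk K 0"
  proof -
    have "lk (r ^ i) 0 = (if i = 0 then 1 else 0)" for i
      using r r0 by (cases i) (simp_all add: ev_0_mult pol_power)
    then have "lk v 0 = 1"
      by (simp add: v_def lookup_sum)
    then show ?thesis
      using pol v by (simp add: ev_0_mult)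
  qed
  finally show ?thesis by simp
qed

end

context koras
begin

text \<open>The derivation \<open>E\<close> below is the Euler field of the weights \<open>1, 1/k, 1/l\<close>, pulled back by
  \<open>(x, z, t) \<mapsto> (a x, Z, T)\<close>. It differs from the Euler field itself by a Hamiltonian field.\<close>

lemma second_coordinate_at_0:
  assumes pol: "Z \<in> pol" "T \<in> pol" "u \<in> pol" "g \<in> pol"
    and jac: "pz Z * pt T - pt Z * pz T = cst c" "c \<noteq> 0"
    and M: "Z ^ k + T ^ l + cst a * vx = u * F + vx ^ d * g" and u: "lk u 0 \<noteq> 0"
  shows "lk g 0 = 0"
proof -
  define Zx where "Zx = cst (1 / of_nat k) * Z - vx * px Z"
  define Tx where "Tx = cst (1 / of_nat l) * T - vx * px T"
  \<comment> \<open>Cramer's rule for E Z = Z / k and E T = T / l, with the constant Jacobian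
    \<open>c\<close> as determinant.\<close>
  define A where "A = cst (1 / c) * (Zx * pt T - Tx * pt Z)"
  define B where "B = cst (1 / c) * (Tx * pz Z - Zx * pz T)"
  define E where "E f = vx * px f + A * pz f + B * pt f" for f
  have AB: "A \<in> pol" "B \<in> pol"
    unfolding A_def B_def Zx_def Tx_def
    by (intro pol_mult pol_diff pol_cst pol_partial pol_vars pol)+
  have cc: "cst (1 / c) * cst c = 1"
    using jac(2) by (simp flip: cst_mult)
  interpret E: deriv E
    by standard (simp add: derivation_def E_def px.add pz.add pt.add px.mult pz.mult pt.mult algebra_simps)
  have E_cst [simp]: "E (cst b) = 0" for b
    by (simp add: E_def)
  have "E Z = vx * px Z + cst (1 / c) * (Zx * (pz Z * pt T - pt Z * pz T))"
    by (simp add: E_def A_def B_def algebra_simps)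
  also have "\<dots> = vx * px Z + (cst (1 / c) * cst c) * Zx"
    unfolding jac(1) by (simp only: mult_ac)
  finally have EZ: "E Z = cst (1 / of_nat k) * Z"
    unfolding cc by (simp add: Zx_def)
  have "E T = vx * px T + cst (1 / c) * (Tx * (pz Z * pt T - pt Z * pz T))"
    by (simp add: E_def A_def B_def algebra_simps)
  also have "\<dots> = vx * px T + (cst (1 / c) * cst c) * Tx"
    unfolding jac(1) by (simp only: mult_ac)
  finally have ET: "E T = cst (1 / of_nat l) * T"
    unfolding cc by (simp add: Tx_def)
  \<comment> \<open>Pulling back along a map of constant Jacobian preserves the divergence; it is 1
    + 1/k + 1/l for the Euler field, the 1 coming from x.\<close>
  have "pz A + pt B = cst (1 / c) * ((cst (1 / of_nat k) + cst (1 / of_nat l)) * (pz Z * pt T - pt Z * pz T)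
      - vx * px (pz Z * pt T - pt Z * pz T))"
    by (simp add: A_def B_def Zx_def Tx_def pz.mult pt.mult px.mult pz.diff pt.diff px.diff
        pz.add pt.add px.add partial_commute algebra_simps)
  also have "\<dots> = (cst (1 / c) * cst c) * (cst (1 / of_nat k) + cst (1 / of_nat l))"
    unfolding jac(1) partial_cst mult_zero_right diff_zero by (simp only: mult_ac)
  finally have div: "pz A + pt B = cst (1 / of_nat k) + cst (1 / of_nat l)"
    unfolding cc by simp
  obtain q where q: "q \<in> pol" "pt q = A - cst (1 / of_nat k) * vz" "pz q = - (B - cst (1 / of_nat l) * vt)"
  proof (rule hamiltonian_exists)
    show "A - cst (1 / of_nat k) * vz \<in> pol" "B - cst (1 / of_nat l) * vt \<in> pol"
      by (intro pol_diff pol_mult AB pol_cst pol_vars)+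
    show "pz (A - cst (1 / of_nat k) * vz) + pt (B - cst (1 / of_nat l) * vt) = 0"
      using div by (simp add: pz.diff pt.diff pz.mult pt.mult algebra_simps)
  qed
  have A: "A = cst (1 / of_nat k) * vz + pt q" and B: "B = cst (1 / of_nat l) * vt - pz q"
    unfolding q(2,3) by simp_all
  have k1: "of_nat k * (cst (1 / of_nat k) * f) = f" and l1: "of_nat l * (cst (1 / of_nat l) * f) = f" for f
    unfolding mult.assoc[symmetric] single_of_nat[symmetric] cst_mult[symmetric] using k0 l by simp_all
  have powk: "f ^ (k - 1) * f = f ^ k" and powl: "f ^ (l - 1) * f = f ^ l" and powd: "f ^ (d - 1) * f = f ^ d"
    for f :: laur
    using k0 l d by (simp_all add: power_eq_if mult.commute)
  have EM: "E (Z ^ k + T ^ l + cst a * vx) = Z ^ k + T ^ l + cst a * vx"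
  proof -
    have "E (Z ^ k) = Z ^ (k - 1) * (of_nat k * (cst (1 / of_nat k) * Z))"
      unfolding E.power EZ by (simp only: mult_ac)
    moreover have "E (T ^ l) = T ^ (l - 1) * (of_nat l * (cst (1 / of_nat l) * T))"
      unfolding E.power ET by (simp only: mult_ac)
    moreover have "E vx = vx" by (simp add: E_def)
    ultimately show ?thesis
      unfolding k1 l1 powk powl by (simp add: E.add E.mult)
  qed
  have EF: "E F = F + bracket q"
  proof -
    have "E (vz ^ k) = vz ^ (k - 1) * (of_nat k * (cst (1 / of_nat k) * vz)) + of_nat k * vz ^ (k - 1) * pt q"
      unfolding E.power by (simp add: E_def A algebra_simps)
    moreover have "E (vt ^ l) = vt ^ (l - 1) * (of_nat l * (cst (1 / of_nat l) * vt)) - of_nat l * vt ^ (l - 1) * pz q"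
      unfolding E.power by (simp add: E_def B algebra_simps)
    moreover have "E vx = vx" by (simp add: E_def)
    ultimately show ?thesis
      unfolding k1 l1 powk powl F_def H_def bracket_def by (simp add: E.add)
  qed
  have Exd: "E (vx ^ d) = of_nat d * vx ^ d"
  proof -
    have "E vx = vx" by (simp add: E_def)
    then show ?thesis
      unfolding E.power by (simp only: mult.assoc powd)
  qed
  \<comment> \<open>The cofactor of x^d when E is applied to \<open>u * F + vx ^ d * g\<close> and
    the polynomial itself is subtracted.\<close>
  define K where "K = of_nat d * g - g + E g"
  have pol_E: "E f \<in> pol" if "f \<in> pol" for f
    unfolding E_def by (intro pol_add pol_mult AB pol_vars pol_partial that)
  have K: "K \<in> pol"
    unfolding K_def by (intro pol_add pol_diff pol_mult pol_of_nat pol_E pol)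
  have "E (u * F + vx ^ d * g) = u * F + vx ^ d * g"
    using EM unfolding M .
  then have eq: "F * E u + u * bracket q + vx ^ d * K = 0"
    unfolding E.add E.mult EF Exd K_def by (simp add: algebra_simps)
  \<comment> \<open>The coefficients of z^(k-1) and t^(l-1) see neither multiples of
    \<open>F\<close> nor of x^d. As u(0) is nonzero, both derivatives of \<open>q\<close> vanish at
    0, hence so do \<open>A\<close>, \<open>B\<close> and \<open>E g\<close>.\<close>
  have vanish: "lk (F * f) (Expo 0 i j) = 0" if "f \<in> pol" "i < int k" "j < int l" for f i j
    unfolding F_def H_def distrib_right
    using that pol_lk[OF that(1)] by (simp add: sg_power lookup_add lk_sg_mult nonneg_def)
  have vanish_x: "lk (vx ^ d * K) (Expo 0 i j) = 0" for i j
    using pol_lk[OF K] d by (simp add: sg_power lk_sg_mult nonneg_def)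
  have u_bracket: "lk (u * bracket q) (Expo 0 i j) = 0" if "i < int k" "j < int l" for i j
    using arg_cong[OF eq, of "\<lambda>f. lk f (Expo 0 i j)"] vanish[OF pol_E[OF pol(3)] that] vanish_x
    by (simp add: lookup_add)
  have ub: "u * bracket q = sg (Expo 0 (int k - 1) 0) (of_nat k) * (u * pt q) - sg (Expo 0 0 (int l - 1)) (of_nat l) * (u * pz q)"
  proof -
    have "of_nat k * vz ^ (k - 1) = sg (Expo 0 (int k - 1) 0) (of_nat k)"
      "of_nat l * vt ^ (l - 1) = sg (Expo 0 0 (int l - 1)) (of_nat l)"
      unfolding single_of_nat[symmetric] sg_power mult_single using k0 l by (simp_all add: of_nat_diff)
    then show ?thesis
      unfolding bracket_def by (simp add: algebra_simps)
  qed
  have upol: "u * pt q \<in> pol" "u * pz q \<in> pol"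
    by (intro pol_mult pol pol_partial q)+
  have e0: "Expo 0 i j - Expo 0 i j = 0" for i j
    by simp
  have "lk (u * bracket q) (Expo 0 (int k - 1) 0) = of_nat k * lk (u * pt q) 0"
    unfolding ub using pol_lk[OF upol(2)] l by (simp add: lookup_minus lk_sg_mult nonneg_def)
  then have "lk (u * pt q) 0 = 0"
    using u_bracket[of "int k - 1" 0] k0 l by simp
  then have q1: "lk (pt q) 0 = 0"
    using u ev_0_mult[OF pol(3) pol_partial(3)[OF q(1)]] by simp
  have "lk (u * bracket q) (Expo 0 0 (int l - 1)) = - of_nat l * lk (u * pz q) 0"
    unfolding ub using pol_lk[OF upol(1)] k by (simp add: lookup_minus lk_sg_mult nonneg_def)
  then have "lk (u * pz q) 0 = 0"
    using u_bracket[of 0 "int l - 1"] k0 l by simp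
  then have q2: "lk (pz q) 0 = 0"
    using u ev_0_mult[OF pol(3) pol_partial(2)[OF q(1)]] by simp
  have var0: "lk vx 0 = 0" "lk vz 0 = 0" "lk vt 0 = 0"
    by (simp_all add: lookup_single when_def)
  have AB0: "lk A 0 = 0" "lk B 0 = 0"
    unfolding A B using q1 q2 var0 by (simp_all add: lookup_add lookup_minus ev_0_mult)
  have "lk (E g) 0 = 0"
    unfolding E_def by (simp add: lookup_add ev_0_mult AB AB0 var0 pol_partial pol)
  moreover have "lk K 0 = 0"
    by (rule constant_term_eq_0[OF pol_E[OF pol(3)] pol(3) q(1) K u eq])
  ultimately have "of_nat d * lk g 0 - lk g 0 = 0"
    unfolding K_def using pol by (simp add: lookup_add lookup_minus ev_0_mult lookup_of_nat)
  then have "(of_nat d - 1) * lk g 0 = 0"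
    by (simp add: algebra_simps)
  moreover have "of_nat d \<noteq> (1 :: complex)"
    using d by simp
  ultimately show ?thesis by simp
qed

subsection \<open>Automorphisms preserve the projection to \<open>(x, z, t)\<close>\<close>

text \<open>The correction of y is the change of the n-th power of coordinate \<open>j\<close>
  divided by x^d, written as a polynomial that also makes sense at x = 0.\<close>

definition shear :: "4 \<Rightarrow> nat \<Rightarrow> complex \<Rightarrow> complex ^ 4 \<Rightarrow> complex ^ 4" where
  "shear j n s v = (\<chi> i. if i = j then v $ j + s * (v $ 1) ^ d
     else if i = 2 then v $ 2 - s * (\<Sum>p<n. (v $ j) ^ (n - Suc p) * (v $ j + s * (v $ 1) ^ d) ^ p)
     else v $ i)"

lemma shear_flow:
  assumes "j = 3 \<and> n = k \<or> j = 4 \<and> n = l"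
  shows "alg_flow X (shear j n)"
proof -
  have j: "j \<noteq> 1" "j \<noteq> 2" "(1 :: 4) \<noteq> j" "(2 :: 4) \<noteq> j" using assms by auto
  have n: "n \<noteq> 0" using assms k0 l by auto
  define \<kappa> where "\<kappa> s b w = s * (\<Sum>p<n. b ^ (n - Suc p) * (b + s * w) ^ p)" for s b w :: complex
  have \<kappa>: "w * \<kappa> s b w = (b + s * w) ^ n - b ^ n" for s b w
    unfolding \<kappa>_def power_diff_sumr2[of "b + s * w" n b] by (simp add: mult_ac)
  have sel: "shear j n s v $ 1 = v $ 1" "shear j n s v $ j = v $ j + s * (v $ 1) ^ d"
    "shear j n s v $ 2 = v $ 2 - \<kappa> s (v $ j) ((v $ 1) ^ d)"
    "i \<noteq> j \<Longrightarrow> i \<noteq> 2 \<Longrightarrow> shear j n s v $ i = v $ i" for s v i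
    using j by (simp_all add: shear_def \<kappa>_def)
  have \<kappa>_add: "\<kappa> (s + r) b w = \<kappa> r b w + \<kappa> s (b + r * w) w" for s r b w
  proof (cases "w = 0")
    case False
    have "w * \<kappa> (s + r) b w = w * (\<kappa> r b w + \<kappa> s (b + r * w) w)"
      unfolding distrib_left \<kappa> by (simp add: algebra_simps)
    then show ?thesis using False by simp
  qed (simp add: \<kappa>_def distrib_right)
  show ?thesis
    unfolding alg_flow_def
  proof (intro conjI ballI allI impI)
    fix v s r assume v: "v \<in> X"
    have "(v $ 1) ^ d * (v $ 2 - \<kappa> s (v $ j) ((v $ 1) ^ d)) =
        (v $ 1) ^ d * v $ 2 - ((v $ j + s * (v $ 1) ^ d) ^ n - (v $ j) ^ n)"
      unfolding right_diff_distrib \<kappa> ..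
    moreover have "(shear j n s v $ 3) ^ k + (shear j n s v $ 4) ^ l =
        (v $ 3) ^ k + (v $ 4) ^ l + ((v $ j + s * (v $ 1) ^ d) ^ n - (v $ j) ^ n)"
      using assms sel(4)[of 3 s v] sel(4)[of 4 s v] sel(2)[of s v] by auto
    ultimately have "(shear j n s v $ 1) ^ d * shear j n s v $ 2 + ((shear j n s v $ 3) ^ k + (shear j n s v $ 4) ^ l) +
        shear j n s v $ 1 = (v $ 1) ^ d * v $ 2 + ((v $ 3) ^ k + (v $ 4) ^ l) + v $ 1"
      unfolding sel(1,3) by simp
    then show "shear j n s v \<in> X"
      using v by (simp add: hypersurface_X_def add.assoc)
    show "shear j n 0 v = v"
      by (simp add: shear_def vec_eq_iff)
    show "shear j n (s + r) v = shear j n s (shear j n r v)"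
    proof (rule vec_eq_iff[THEN iffD2], rule allI)
      fix i
      show "shear j n (s + r) v $ i = shear j n s (shear j n r v) $ i"
      proof (cases "i = j")
        case True
        then show ?thesis by (simp add: sel(1,2) algebra_simps)
      next
        case False
        then show ?thesis
          by (cases "i = 2") (simp_all add: sel \<kappa>_add)
      qed
    qed
  next
    fix f :: "complex ^ 4 \<Rightarrow> complex" assume f: "polynomial_fun f"
    have coord: "poly_family X (\<lambda>s v. v $ i)" for i
      by (intro poly_family_const polynomial_fun_coord)
    have w: "poly_family X (\<lambda>s v. v $ j + s * (v $ 1) ^ d)"
      by (intro poly_family_add coord poly_family_mult poly_family_id poly_family_power)
    have minus: "poly_family X (\<lambda>s v. - 1 :: complex)"
      by (intro poly_family_const polynomial_fun_const)
    have "poly_family X (\<lambda>s v. v $ 2 + - 1 * (s * (\<Sum>p<n. (v $ j) ^ (n - Suc p) * (v $ j + s * (v $ 1) ^ d) ^ p)))"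
      by (intro poly_family_add coord poly_family_mult minus poly_family_id poly_family_sum poly_family_power w)
    then have "poly_family X (\<lambda>s v. shear j n s v $ i)" for i
      using w coord[of i] by (cases "i = j"; cases "i = 2") (simp_all add: shear_def)
    then show "poly_family X (\<lambda>s v. f (shear j n s v))"
      by (rule poly_family_compose[OF f])
  qed
qed

definition inverse_pair :: "(complex ^ 4 \<Rightarrow> complex ^ 4) \<Rightarrow> (complex ^ 4 \<Rightarrow> complex ^ 4) \<Rightarrow> bool" where
  "inverse_pair \<phi> \<psi> \<longleftrightarrow> regular_map X X \<phi> \<and> regular_map X X \<psi> \<and>
     (\<forall>v\<in>X. \<psi> (\<phi> v) = v) \<and> (\<forall>v\<in>X. \<phi> (\<psi> v) = v)"

lemma inverse_pair_sym: "inverse_pair \<phi> \<psi> \<Longrightarrow> inverse_pair \<psi> \<phi>"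
  by (auto simp: inverse_pair_def)

lemma inverse_pair_X: "inverse_pair \<phi> \<psi> \<Longrightarrow> v \<in> X \<Longrightarrow> \<phi> v \<in> X"
  by (auto simp: inverse_pair_def regular_map_def)

text \<open>A shear that moves z or t but not coordinate \<open>j\<close>, conjugated by
  \<open>\<phi>\<close>, leaves this component of \<open>\<phi>\<close> invariant, so
  \<open>invariant_pol\<close> applies.\<close>

lemma component_pol:
  assumes inv: "inverse_pair \<phi> \<psi>" and j: "j \<noteq> 2"
  shows "\<exists>G\<in>pol. \<forall>v\<in>X. \<phi> v $ j = evv v G"
proof -
  have \<phi>: "regular_map X X \<phi>" and \<psi>: "regular_map X X \<psi>"
    and id: "\<forall>v\<in>X. \<psi> (\<phi> v) = v" "\<forall>v\<in>X. \<phi> (\<psi> v) = v"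
    using inv by (auto simp: inverse_pair_def)
  obtain i n where i: "i = 3 \<and> n = k \<or> i = 4 \<and> n = l" "i \<noteq> j"
  proof (cases "j = 3")
    case True
    then show ?thesis using that[of 4 l] by simp
  next
    case False
    then show ?thesis using that[of 3 k] by simp
  qed
  define \<alpha> where "\<alpha> s v = \<psi> (shear i n s (\<phi> v))" for s v
  interpret koras_flow d k l \<alpha>
    unfolding \<alpha>_def by unfold_locales (rule alg_flow_conj[OF shear_flow[OF i(1)] \<phi> \<psi> id])
  have \<phi>_\<alpha>: "\<phi> (\<alpha> s v) = shear i n s (\<phi> v)" if "v \<in> X" for s v
    using that id(2) shear_flow[OF i(1)] inverse_pair_X[OF inv] by (simp add: \<alpha>_def alg_flow_def)
  obtain p where p: "polynomial_fun p" "\<And>v. v \<in> X \<Longrightarrow> \<phi> v $ j = p v"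
    using \<phi> unfolding regular_map_def by metis
  obtain q where q: "polynomial_fun q" "\<And>v. v \<in> X \<Longrightarrow> \<phi> v $ i = q v"
    using \<phi> unfolding regular_map_def by metis
  obtain b G where G: "arep b p G" using arep_poly_fun p by blast
  \<comment> \<open>At x = 1 the shear with s = 1 adds 1 to coordinate \<open>i\<close>, so the
    conjugated flow is nontrivial.\<close>
  obtain w where w: "w \<in> X" "w $ 1 = 1"
    using point_exists[of 1 0 0] by auto
  have "\<psi> w \<in> X" using inverse_pair_X[OF inverse_pair_sym[OF inv]] w by blast
  have "G \<in> pol"
  proof (rule invariant_pol[OF p(1) G _ q(1) \<open>\<psi> w \<in> X\<close>])
    show "p (\<alpha> s v) = p v" if "v \<in> X" for v s
      using p(2)[OF \<alpha>_X[OF that]] p(2)[OF that] \<phi>_\<alpha>[OF that] i j by (auto simp: shear_def)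
    have "q (\<alpha> 1 (\<psi> w)) = w $ i + 1" "q (\<psi> w) = w $ i"
      using q(2)[OF \<alpha>_X[OF \<open>\<psi> w \<in> X\<close>]] q(2)[OF \<open>\<psi> w \<in> X\<close>] \<phi>_\<alpha>[OF \<open>\<psi> w \<in> X\<close>] w id(2)
      by (simp_all add: shear_def)
    then show "q (\<alpha> 1 (\<psi> w)) \<noteq> q (\<psi> w)" by simp
  qed
  then show ?thesis
    using arep_pol_ev[OF G] p(2) by (intro bexI[of _ G]) auto
qed

definition lifts :: "(complex ^ 4 \<Rightarrow> complex ^ 4) \<Rightarrow> laur \<Rightarrow> laur \<Rightarrow> laur \<Rightarrow> bool" where
  "lifts \<phi> a b c \<longleftrightarrow> a \<in> pol \<and> b \<in> pol \<and> c \<in> pol \<and>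
     (\<forall>v\<in>X. \<phi> v $ 1 = evv v a \<and> \<phi> v $ 3 = evv v b \<and> \<phi> v $ 4 = evv v c)"

lemma lifts_exist:
  assumes "inverse_pair \<phi> \<psi>"
  obtains a b c where "lifts \<phi> a b c"
proof -
  obtain a b c where "a \<in> pol" "\<forall>v\<in>X. \<phi> v $ 1 = evv v a" "b \<in> pol" "\<forall>v\<in>X. \<phi> v $ 3 = evv v b"
    "c \<in> pol" "\<forall>v\<in>X. \<phi> v $ 4 = evv v c"
    using component_pol[OF assms, of 1] component_pol[OF assms, of 3] component_pol[OF assms, of 4] by auto
  then show ?thesis
    using that[of a b c] by (simp add: lifts_def)
qed

lemma lifts_inverse:
  assumes inv: "inverse_pair \<phi> \<psi>" and \<phi>: "lifts \<phi> a b c" and \<psi>: "lifts \<psi> a' b' c'"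
  shows "ev (ev x z t a) (ev x z t b) (ev x z t c) a' = x"
    and "ev (ev x z t a) (ev x z t b) (ev x z t c) b' = z"
    and "ev (ev x z t a) (ev x z t b) (ev x z t c) c' = t"
proof -
  have pol: "a \<in> pol" "b \<in> pol" "c \<in> pol" "a' \<in> pol" "b' \<in> pol" "c' \<in> pol"
    using \<phi> \<psi> by (auto simp: lifts_def)
  have off: "ev (ev x z t a) (ev x z t b) (ev x z t c) a' = x \<and>
      ev (ev x z t a) (ev x z t b) (ev x z t c) b' = z \<and>
      ev (ev x z t a) (ev x z t b) (ev x z t c) c' = t" if x: "x \<noteq> 0" for x
  proof -
    obtain v where v: "v \<in> X" "v $ 1 = x" "v $ 3 = z" "v $ 4 = t"
      using point_exists[OF x] by blast
    have "\<phi> v $ 1 = ev x z t a" "\<phi> v $ 3 = ev x z t b" "\<phi> v $ 4 = ev x z t c"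
      using \<phi> v by (auto simp: lifts_def)
    moreover have "\<phi> v \<in> X" "\<psi> (\<phi> v) = v"
      using inv v inverse_pair_X[OF inv] by (auto simp: inverse_pair_def)
    ultimately show ?thesis
      using \<psi> v unfolding lifts_def by metis
  qed
  have "ev (ev x z t a) (ev x z t b) (ev x z t c) f = ev x z t g"
    if fg: "f \<in> pol" "g \<in> pol" "\<And>x. x \<noteq> 0 \<Longrightarrow> ev (ev x z t a) (ev x z t b) (ev x z t c) f = ev x z t g" for f g
  proof -
    obtain h where "h \<in> pol" "\<And>x z t. ev x z t h = ev (ev x z t a) (ev x z t b) (ev x z t c) f"
      using pol_compose[OF fg(1) pol(1-3)] by metis
    then show ?thesis
      using ev_eq_extend[of h g z t x] fg by simp
  qed
  from this[OF pol(4) pol_vars(1)] this[OF pol(5) pol_vars(2)] this[OF pol(6) pol_vars(3)] off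
  show "ev (ev x z t a) (ev x z t b) (ev x z t c) a' = x"
    "ev (ev x z t a) (ev x z t b) (ev x z t c) b' = z"
    "ev (ev x z t a) (ev x z t b) (ev x z t c) c' = t"
    by simp_all
qed

text \<open>The image of the projection is the complement of \<open>x = 0 \<noteq> z\<^sup>k + t\<^sup>l\<close>, so this set and
  its closure \<open>x = 0\<close> are preserved.\<close>

lemma lifts_x_dvd:
  assumes inv: "inverse_pair \<phi> \<psi>" and \<phi>: "lifts \<phi> a b c"
  obtains u where "u \<in> pol" "a = vx * u"
proof -
  obtain a' b' c' where \<psi>: "lifts \<psi> a' b' c'"
    using lifts_exist[OF inverse_pair_sym[OF inv]] .
  have a: "a \<in> pol" using \<phi> by (simp add: lifts_def)
  have zero: "ev 0 z t a = 0" if "z ^ k + t ^ l \<noteq> 0" for z t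
  proof (rule ccontr)
    \<comment> \<open>The image would then lift to the hypersurface, and its preimage would have x =
      0 and z^k + t^l nonzero.\<close>
    assume "ev 0 z t a \<noteq> 0"
    then obtain w where w: "w \<in> X" "w $ 1 = ev 0 z t a" "w $ 3 = ev 0 z t b" "w $ 4 = ev 0 z t c"
      using point_exists by blast
    then have "\<psi> w $ 1 = 0" "\<psi> w $ 3 = z" "\<psi> w $ 4 = t"
      using \<psi> lifts_inverse[OF inv \<phi> \<psi>, of 0 z t] by (auto simp: lifts_def)
    moreover have "\<psi> w \<in> X"
      using inverse_pair_X[OF inverse_pair_sym[OF inv] w(1)] .
    ultimately show False
      using that d by (simp add: hypersurface_X_def power_0_left)
  qed
  \<comment> \<open>The polynomial a(0, z, t), which vanishes wherever \<open>H\<close> does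
    not.\<close>
  define a0 where "a0 = hc Wx 0 a"
  have a0: "a0 \<in> pol" using a by (auto simp: a0_def pol_def ks_hc)
  have ev_a0: "ev x z t a0 = ev 0 z t a" for x z t
  proof -
    have "ev x z t a0 = (\<Sum>e\<in>ks a. lk a0 e * evm x z t e)"
      by (rule ev_superset) (auto simp: a0_def ks_hc)
    also have "\<dots> = (\<Sum>e\<in>ks a. lk a e * evm 0 z t e)"
      by (intro sum.cong) (auto simp: a0_def lk_hc Wx_def evm_def power_int_0_left_if)
    finally show ?thesis by (simp add: ev_def)
  qed
  have "a0 * H = 0"
  proof (rule ev_eq_0_imp)
    fix x z t :: complex
    have "ev x z t H = z ^ k + t ^ l"
      by (simp add: H_def pol_power)
    then show "ev x z t (a0 * H) = 0"
      using zero[of z t] a0 ev_a0 by auto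
  qed
  then have "a0 = 0" using H_nz by simp
  have "nonneg (e - Expo 1 0 0)" if e: "e \<in> ks a" for e
  proof -
    have "ex e \<noteq> 0"
    proof
      assume "ex e = 0"
      then have "e \<in> ks a0" using e by (simp add: a0_def ks_hc Wx_def)
      then show False using \<open>a0 = 0\<close> by simp
    qed
    then show ?thesis
      using polD[OF a e] by (simp add: nonneg_def)
  qed
  then show ?thesis
    using sg_shift_pol[OF a] that by blast
qed

text \<open>Both \<open>a\<close> and the first component of the inverse are divisible by x;
  composing them to x makes the cofactor \<open>u\<close> a unit.\<close>

lemma lifts_x:
  assumes inv: "inverse_pair \<phi> \<psi>" and \<phi>: "lifts \<phi> a b c"
  obtains \<mu> where "a = cst \<mu> * vx" "\<mu> \<noteq> 0"
proof -
  obtain a' b' c' where \<psi>: "lifts \<psi> a' b' c'"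
    using lifts_exist[OF inverse_pair_sym[OF inv]] .
  have pol: "a \<in> pol" "b \<in> pol" "c \<in> pol" using \<phi> by (auto simp: lifts_def)
  obtain u where u: "u \<in> pol" "a = vx * u"
    using lifts_x_dvd[OF inv \<phi>] .
  obtain u' where u': "u' \<in> pol" "a' = vx * u'"
    using lifts_x_dvd[OF inverse_pair_sym[OF inv] \<psi>] .
  obtain h where h: "h \<in> pol" "\<And>x z t. ev x z t h = ev (ev x z t a) (ev x z t b) (ev x z t c) u'"
    using pol_compose[OF u'(1) pol] by metis
  have "u * h = 1"
  proof (rule ev_inject)
    fix x z t :: complex assume x: "x \<noteq> 0"
    have "ev x z t a * ev x z t h = x"
      using lifts_inverse(1)[OF inv \<phi> \<psi>, of x z t] u' h(2) by simp
    then have "x * (ev x z t u * ev x z t h) = x"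
      using u by (simp add: mult.assoc)
    then show "ev x z t (u * h) = ev x z t 1"
      using x u h by simp
  qed
  with u h obtain \<mu> where "u = cst \<mu>" "\<mu> \<noteq> 0"
    using pol_unit by blast
  then show ?thesis
    using that[of \<mu>] u by (simp add: mult.commute)
qed

lemma chain_rule:
  assumes pol: "f \<in> pol" "a \<in> pol" "b \<in> pol" "c \<in> pol" "r \<in> pol" "fx \<in> pol" "fz \<in> pol" "ft \<in> pol"
    and r: "\<And>x z t. ev x z t r = ev (ev x z t a) (ev x z t b) (ev x z t c) f"
    and f: "\<And>x z t. ev x z t fx = ev (ev x z t a) (ev x z t b) (ev x z t c) (px f)"
      "\<And>x z t. ev x z t fz = ev (ev x z t a) (ev x z t b) (ev x z t c) (pz f)"
      "\<And>x z t. ev x z t ft = ev (ev x z t a) (ev x z t b) (ev x z t c) (pt f)"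
  shows "pz r = pz a * fx + pz b * fz + pz c * ft" "pt r = pt a * fx + pt b * fz + pt c * ft"
proof -
  have Dz: "((\<lambda>s. ev x s t g) has_field_derivative ev x z t (pz g)) (at z)"
    and Dt: "((\<lambda>s. ev x z s g) has_field_derivative ev x z t (pt g)) (at t)" if "g \<in> pol" for x z t g
    using DERIV_ev_pol[OF that, of "\<lambda>_. x" 0 z "\<lambda>s. s" 1 "\<lambda>_. t" 0]
      DERIV_ev_pol[OF that, of "\<lambda>_. x" 0 t "\<lambda>_. z" 0 "\<lambda>s. s" 1] by simp_all
  show "pz r = pz a * fx + pz b * fz + pz c * ft"
  proof (rule ev_inject)
    fix x z t :: complex
    have "ev x z t (pz r) = ev x z t (pz a) * ev x z t fx + ev x z t (pz b) * ev x z t fz + ev x z t (pz c) * ev x z t ft"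
      using DERIV_unique[OF Dz[OF pol(5)]] DERIV_ev_pol[OF pol(1) Dz[OF pol(2)] Dz[OF pol(3)] Dz[OF pol(4)]]
      unfolding r f by blast
    then show "ev x z t (pz r) = ev x z t (pz a * fx + pz b * fz + pz c * ft)"
      using pol by (simp add: pol_partial pol_mult)
  qed
  show "pt r = pt a * fx + pt b * fz + pt c * ft"
  proof (rule ev_inject)
    fix x z t :: complex
    have "ev x z t (pt r) = ev x z t (pt a) * ev x z t fx + ev x z t (pt b) * ev x z t fz + ev x z t (pt c) * ev x z t ft"
      using DERIV_unique[OF Dt[OF pol(5)]] DERIV_ev_pol[OF pol(1) Dt[OF pol(2)] Dt[OF pol(3)] Dt[OF pol(4)]]
      unfolding r f by blast
    then show "ev x z t (pt r) = ev x z t (pt a * fx + pt b * fz + pt c * ft)"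
      using pol by (simp add: pol_partial pol_mult)
  qed
qed

text \<open>The first component involves x only, so the z, t-blocks of the Jacobian matrices are
  inverse to each other, and a determinant that is a unit is constant.\<close>

lemma lifts_jacobian:
  assumes inv: "inverse_pair \<phi> \<psi>" and \<phi>: "lifts \<phi> (cst \<mu> * vx) b c"
  obtains \<gamma> where "pz b * pt c - pt b * pz c = cst \<gamma>" "\<gamma> \<noteq> 0"
proof -
  let ?a = "cst \<mu> * vx"
  obtain a' b' c' where \<psi>: "lifts \<psi> a' b' c'"
    using lifts_exist[OF inverse_pair_sym[OF inv]] .
  have pol: "?a \<in> pol" "b \<in> pol" "c \<in> pol" "b' \<in> pol" "c' \<in> pol"
    using \<phi> \<psi> by (auto simp: lifts_def)
  define sub where "sub f h \<longleftrightarrow> h \<in> pol \<and> (\<forall>x z t. ev x z t h = ev (ev x z t ?a) (ev x z t b) (ev x z t c) f)" for f h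
  have ex: "\<exists>h. sub f h" if "f \<in> pol" for f
    using pol_compose[OF that pol(1-3)] unfolding sub_def by metis
  obtain bx bz bt where 1: "sub (px b') bx" "sub (pz b') bz" "sub (pt b') bt"
    using ex pol_partial pol(4) by meson
  obtain cx cz ct where 2: "sub (px c') cx" "sub (pz c') cz" "sub (pt c') ct"
    using ex pol_partial pol(5) by meson
  have a0: "pz ?a = 0" "pt ?a = 0"
    by (simp_all add: pz.mult pt.mult)
  have b: "pz vz = pz ?a * bx + pz b * bz + pz c * bt" "pt vz = pt ?a * bx + pt b * bz + pt c * bt"
    by (rule chain_rule[OF pol(4,1-3) pol_vars(2)];
        use 1 lifts_inverse(2)[OF inv \<phi> \<psi>] in \<open>simp add: sub_def\<close>)+
  have c: "pz vt = pz ?a * cx + pz b * cz + pz c * ct" "pt vt = pt ?a * cx + pt b * cz + pt c * ct"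
    by (rule chain_rule[OF pol(5,1-3) pol_vars(3)];
        use 2 lifts_inverse(3)[OF inv \<phi> \<psi>] in \<open>simp add: sub_def\<close>)+
  have "(pz b * pt c - pt b * pz c) * (bz * ct - bt * cz) =
      (pz b * bz + pz c * bt) * (pt b * cz + pt c * ct) - (pt b * bz + pt c * bt) * (pz b * cz + pz c * ct)"
    by (simp add: algebra_simps)
  also have "\<dots> = 1"
    using b c unfolding a0 by simp
  finally have "(pz b * pt c - pt b * pz c) * (bz * ct - bt * cz) = 1" .
  moreover have "pz b * pt c - pt b * pz c \<in> pol" "bz * ct - bt * cz \<in> pol"
    using 1 2 pol by (auto simp: sub_def intro!: pol_diff pol_mult pol_partial)
  ultimately show ?thesis
    using pol_unit that by metis
qed

text \<open>Solving the equation of the hypersurface for the second component shows a pole of order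
  at most d, so it is linear in y.\<close>

lemma second_component:
  assumes inv: "inverse_pair \<phi> \<psi>" and \<phi>: "lifts \<phi> (cst \<mu> * vx) b c" and \<mu>: "\<mu> \<noteq> 0"
  shows "\<exists>u\<in>pol. \<exists>g\<in>pol. (\<forall>v\<in>X. \<phi> v $ 2 = v $ 2 * evv v u + evv v g) \<and>
    b ^ k + c ^ l + cst \<mu> * vx = cst (\<mu> ^ d) * (u * F - vx ^ d * g)"
proof -
  have pol: "b \<in> pol" "c \<in> pol"
    using \<phi> by (auto simp: lifts_def)
  let ?M = "b ^ k + c ^ l + cst \<mu> * vx"
  obtain p where p: "polynomial_fun p" "\<And>v. v \<in> X \<Longrightarrow> \<phi> v $ 2 = p v"
    using inv unfolding inverse_pair_def regular_map_def by metis
  obtain n Y where Y: "arep n p Y" using arep_poly_fun p by blast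
  have rel: "cst (\<mu> ^ d) * vx ^ d * Y + ?M = 0"
  proof (rule ev_eq_0_imp)
    fix x z t :: complex assume nz: "x \<noteq> 0" "z \<noteq> 0" "t \<noteq> 0"
    obtain v where v: "v \<in> X" "v $ 1 = x" "v $ 3 = z" "v $ 4 = t"
      using point_exists nz by blast
    have "\<phi> v \<in> X" by (rule inverse_pair_X[OF inv v(1)])
    moreover have "\<phi> v $ 1 = \<mu> * x" "\<phi> v $ 3 = ev x z t b" "\<phi> v $ 4 = ev x z t c"
      using \<phi> v by (auto simp: lifts_def)
    moreover have "\<phi> v $ 2 = ev x z t Y"
      using p(2)[OF v(1)] arep_ev[OF Y v(1)] v nz by simp
    ultimately show "ev x z t (cst (\<mu> ^ d) * vx ^ d * Y + ?M) = 0"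
      using nz pol by (simp add: hypersurface_X_def ev_mult_torus ev_power_torus power_mult_distrib add.assoc)
  qed
  have "Y = sg (Expo (- int d) 0 0) (1 / \<mu> ^ d) * (cst (\<mu> ^ d) * vx ^ d) * Y"
    using \<mu> by (simp add: sg_power mult_single)
  also have "\<dots> = sg (Expo (- int d) 0 0) (1 / \<mu> ^ d) * (cst (\<mu> ^ d) * vx ^ d * Y)"
    by (simp only: mult.assoc)
  also have "cst (\<mu> ^ d) * vx ^ d * Y = - ?M"
    using rel by (simp only: eq_neg_iff_add_eq_0)
  finally have "Y = - (sg (Expo (- int d) 0 0) (1 / \<mu> ^ d) * ?M)"
    by (simp only: mult_minus_right)
  moreover have "wle Wx (int d + 0) (sg (Expo (- int d) 0 0) (1 / \<mu> ^ d) * ?M)"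
    by (intro wle_mult[OF weight_Wx] wle_sg wle_Wx_pol pol_add pol_power pol pol_mult pol_cst pol_vars)
      (simp_all add: Wx_def)
  ultimately have "wle Wx (int d) Y"
    using wle_minus by simp
  then obtain u g where ug: "u \<in> pol" "g \<in> pol" "Y = yy * u + g"
    "\<And>v. v \<in> X \<Longrightarrow> p v = v $ 2 * evv v u + evv v g"
    using arep_linear[OF Y] by metis
  have "cst (\<mu> ^ d) * vx ^ d * Y = cst (\<mu> ^ d) * ((vx ^ d * yy) * u + vx ^ d * g)"
    by (simp add: ug(3) algebra_simps)
  moreover have "?M = - (cst (\<mu> ^ d) * vx ^ d * Y)"
    using rel by (simp only: eq_neg_iff_add_eq_0 add.commute)
  ultimately have "?M = cst (\<mu> ^ d) * (u * F - vx ^ d * g)"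
    unfolding x_d_yy by (simp add: algebra_simps)
  then show ?thesis
    using ug(1,2,4) p(2) by (intro bexI[of _ u] bexI[of _ g]) simp_all
qed

lemma fixes_origin:
  assumes inv: "inverse_pair \<phi> \<psi>"
  shows "\<phi> 0 = 0"
proof -
  obtain a b c where "lifts \<phi> a b c"
    using lifts_exist[OF inv] .
  moreover obtain \<mu> where "a = cst \<mu> * vx" and \<mu>: "\<mu> \<noteq> 0"
    using lifts_x[OF inv calculation] .
  ultimately have \<phi>: "lifts \<phi> (cst \<mu> * vx) b c" by simp
  then have pol: "b \<in> pol" "c \<in> pol" by (auto simp: lifts_def)
  obtain \<gamma> where \<gamma>: "pz b * pt c - pt b * pz c = cst \<gamma>" "\<gamma> \<noteq> 0"
    using lifts_jacobian[OF inv \<phi>] .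
  obtain u g where ug: "u \<in> pol" "g \<in> pol"
    and y: "\<And>v. v \<in> X \<Longrightarrow> \<phi> v $ 2 = v $ 2 * evv v u + evv v g"
    and M: "b ^ k + c ^ l + cst \<mu> * vx = cst (\<mu> ^ d) * (u * F - vx ^ d * g)"
    using second_component[OF inv \<phi> \<mu>] by blast
  define P where "P s = ((\<chi> i. if i = 2 then s else 0) :: complex ^ 4)" for s :: complex
  have P: "P s \<in> X" "P s $ 1 = 0" "P s $ 2 = s" "P s $ 3 = 0" "P s $ 4 = 0" for s
    using k0 l d by (simp_all add: P_def hypersurface_X_def power_0_left)
  \<comment> \<open>Otherwise \<open>\<phi>\<close> would be constant on the line x = z = t =
    0.\<close>
  have u0: "lk u 0 \<noteq> 0"
  proof
    assume "lk u 0 = 0"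
    then have "\<phi> (P s) $ 2 = lk g 0" "\<phi> (P s) $ 1 = 0" "\<phi> (P s) $ 3 = lk b 0" "\<phi> (P s) $ 4 = lk c 0" for s
      using y[OF P(1)] \<phi> P ug pol by (simp_all add: lifts_def ev_0_pol)
    then have "\<phi> (P 0) = \<phi> (P 1)"
      unfolding vec_eq_iff forall_4 by simp
    then have "P 0 = P 1"
      using P(1) inv unfolding inverse_pair_def by metis
    then show False
      using P(3) by (metis zero_neq_one)
  qed
  have bc0: "lk b 0 = 0 \<and> lk c 0 = 0"
  proof -
    \<comment> \<open>\<open>F\<close> and x^d vanish at 0 and have no linear terms in z, t, so the
      z, t-gradient of the right side of \<open>M\<close> vanishes there.\<close>
    have F0: "lk F 0 = 0" "lk (pz F) 0 = 0" "lk (pt F) 0 = 0"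
      using k l kl by (auto simp: F_def lookup_add lk_partial lk_H lookup_single when_def)
    have vx0: "lk (vx ^ d) 0 = 0"
      using d by (simp add: sg_power lookup_single when_def)
    have R0: "lk (pz (cst (\<mu> ^ d) * (u * F - vx ^ d * g))) 0 = 0" "lk (pt (cst (\<mu> ^ d) * (u * F - vx ^ d * g))) 0 = 0"
      using ug F0 vx0
      by (simp_all add: pz.mult pt.mult pz.diff pt.diff pz.power pt.power lookup_minus lookup_add
          ev_0_mult pol_partial pol_mult pol_diff pol_power pol_add)
    define \<alpha> where "\<alpha> = of_nat k * lk b 0 ^ (k - 1)"
    define \<beta> where "\<beta> = of_nat l * lk c 0 ^ (l - 1)"
    have pw: "lk (f ^ n) 0 = lk f 0 ^ n" if "f \<in> pol" for f n
      using that by (simp flip: ev_0_pol add: pol_power)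
    have 1: "\<alpha> * lk (pz b) 0 + \<beta> * lk (pz c) 0 = 0" "\<alpha> * lk (pt b) 0 + \<beta> * lk (pt c) 0 = 0"
      using R0 unfolding M[symmetric]
      by (simp_all add: \<alpha>_def \<beta>_def pz.add pt.add pz.mult pt.mult pz.power pt.power lookup_add ev_0_mult
          lookup_of_nat pol pol_partial pol_mult pol_power pw)
    have J: "lk (pz b) 0 * lk (pt c) 0 - lk (pt b) 0 * lk (pz c) 0 = \<gamma>"
      using arg_cong[OF \<gamma>(1), of "\<lambda>f. lk f 0"] by (simp add: lookup_minus ev_0_mult pol pol_partial)
    \<comment> \<open>Inverting the Jacobian block of determinant \<open>\<gamma>\<close>; since k
      and l are at least 2, \<open>\<alpha> = \<beta> = 0\<close> makes \<open>b\<close> and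
      \<open>c\<close> vanish at 0.\<close>
    have "\<alpha> * \<gamma> = (\<alpha> * lk (pz b) 0 + \<beta> * lk (pz c) 0) * lk (pt c) 0 - (\<alpha> * lk (pt b) 0 + \<beta> * lk (pt c) 0) * lk (pz c) 0"
      "\<beta> * \<gamma> = (\<alpha> * lk (pt b) 0 + \<beta> * lk (pt c) 0) * lk (pz b) 0 - (\<alpha> * lk (pz b) 0 + \<beta> * lk (pz c) 0) * lk (pt b) 0"
      unfolding J[symmetric] by (simp_all add: algebra_simps)
    then have "\<alpha> = 0" "\<beta> = 0"
      using \<gamma>(2) unfolding 1 by simp_all
    then show ?thesis
      using k l by (simp add: \<alpha>_def \<beta>_def)
  qed
  have "lk (- (cst (\<mu> ^ d) * g)) 0 = 0"
  proof (rule second_coordinate_at_0[OF pol _ _ \<gamma>])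
    show "cst (\<mu> ^ d) * u \<in> pol" "- (cst (\<mu> ^ d) * g) \<in> pol"
      by (intro pol_minus pol_mult pol_cst ug)+
    show "b ^ k + c ^ l + cst \<mu> * vx = cst (\<mu> ^ d) * u * F + vx ^ d * - (cst (\<mu> ^ d) * g)"
      unfolding M by (simp add: algebra_simps)
    show "lk (cst (\<mu> ^ d) * u) 0 \<noteq> 0"
      using u0 \<mu> ug by (simp add: ev_0_mult)
  qed
  then have g0: "lk g 0 = 0"
    using \<mu> ug by (simp add: ev_0_mult)
  have 0: "0 \<in> X" using k0 l by (simp add: origin_in_hypersurface_X)
  show ?thesis
    unfolding vec_eq_iff forall_4
    using \<phi> 0 bc0 g0 y[OF 0] pol ug by (simp add: lifts_def ev_0_pol)
qed

end

theorem corollary6p1: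
  fixes d k l :: nat and \<phi> :: "complex ^ 4 \<Rightarrow> complex ^ 4"
  assumes "d \<ge> 2" and "2 \<le> k" and "k < l" and "coprime k l"
    and "variety_automorphism (hypersurface_X d k l) \<phi>"
  shows "\<phi> 0 = 0"
proof -
  interpret koras d k l
    by standard (use assms in auto)
  from assms(5) obtain \<psi> where "inverse_pair \<phi> \<psi>"
    unfolding variety_automorphism_def inverse_pair_def by blast
  then show ?thesis
    by (rule fixes_origin)
qed

end
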